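(* Let $\underline{\omega}(0)$ be any smooth hypersymplectic structure of simple type on $\mathbb{T}^4$ and let $\underline{\omega}(t)$, $t\in[0,\infty)$, be the hypersymplectic flow starting from it. On $\mathbb{T}^7=\mathbb{T}^4\times\mathbb{T}^3$, with angular coordinates $t^1,t^2,t^3$ on the second factor, let $$\phi(t)=dt^1\wedge dt^2\wedge dt^3-dt^1\wedge\omega_1(t)-dt^2\wedge\omega_2(t)-dt^3\wedge\omega_3(t).$$ Then $(\mathbb{T}^7,\phi(t))_{t\in[0,\infty)}$ is a family of cohomogeneity-one closed $G_2$-structures satisfying the $G_2$-Laplacian flow $\partial_t\phi=\Delta_\phi\phi$, and there are diffeomorphisms $F_t:\mathbb{T}^7=S^1\times\mathbb{T}^6\to S^1\times\mathbb{T}^6=\mathbb{T}^7$, each only reparametrizing the $S^1$ factor with coordinate $x_0$, such that $F_t^*\phi(t)$ converges smoothly, as $t\to\infty$, to the standard torsion-free $G_2$-structure $dt^1\wedge dt^2\wedge dt^3-\sum_{i=1}^3dt^i\wedge\omega_i^0$.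
   Context: Let $S^1=\mathbb{R}/2\pi\mathbb{Z}$ and $\mathbb{T}^4=S^1\times\mathbb{T}^3$ with standard coordinates $x_0$ on $S^1$ and $x_1,x_2,x_3$ on $\mathbb{T}^3$ (all of period $2\pi$). The standard hyperk\"ahler triple is $\omega_i^0=dx_0\wedge dx_i+dx_j\wedge dx_k$ for each cyclic permutation $(i,j,k)$ of $(1,2,3)$. Hypersymplectic structure. A triple $\underline\omega=(\omega_1,\omega_2,\omega_3)$ of closed 2-forms on a 4-manifold $X$ is a hypersymplectic structure if there is a nowhere vanishing 4-form $\mu_0$ such that the matrix $\big(\frac{\omega_i\wedge\omega_j}{2\mu_0}\big)$ is positive definite everywhere. It determines a Riemannian metric $g$ by $g(u,v)\,d\mathrm{vol}_g=\frac16\epsilon_{ijk}\,\iota_u\omega_i\wedge\iota_v\omega_j\wedge\omega_k$. Put $\mu=d\mathrm{vol}_g$ and $Q=(Q_{ij})=\big(\frac{\omega_i\wedge\omega_j}{2\mu}\big)$. Let $*$ be the Hodge star of $g$, let $E_i(\alpha)=-*(\alpha\wedge\omega_i)$ on 1-forms, and define the torsion 1-forms $\tau_i=-\sum_{j=1}^3E_j\big((dQ\,Q^{-1})_{ij}\big)$. The hypersymplectic flow is the system $\partial_t\omega_i=d\tau_i$, $i=1,2,3$. Simple type. A hypersymplectic structure on $\mathbb{T}^4$ is of simple type if $\omega_i=(1+\phi_i'')\,dx_0\wedge dx_i+dx_j\wedge dx_k$ for each cyclic permutation $(i,j,k)$ of $(1,2,3)$, where $\phi_1,\phi_2,\phi_3$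 are real functions on $S^1$ (functions of $x_0$ only), $'$ denotes $d/dx_0$, and $1+\phi_i''>0$. With $A_i=1+\phi_i''$, $V=(A_1A_2A_3)^{1/3}$, the hypersymplectic flow from a structure of simple type is understood as the flow through structures of simple type, i.e. it is the system $\partial_tA_i=\big((\log\frac{A_i}{V})'\frac{A_i}{V^2}\big)'$, $i=1,2,3$; starting from a smooth structure of simple type it exists for all $t\in[0,\infty)$. $\Delta_\phi$ is the Hodge Laplacian of the Riemannian metric determined by the $G_2$-structure $\phi$; a $G_2$-structure $\phi$ is closed if $d\phi=0$. Cohomogeneity-one here means: invariant under the $\mathbb{T}^6$ acting by translations in the coordinates $x_1,x_2,x_3,t^1,t^2,t^3$, whose orbits are hypersurfaces. Smooth convergence means convergence in $C^k$ for every $k$. *)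

theory Defs
  imports "HOL-Analysis.Analysis"
begin

section \<open>Smooth functions\<close>

text \<open>
  Iterated directional derivatives, taken within a set \<open>S\<close>.  They are used for \<open>S = UNIV\<close> and for
  \<open>S = {0..} \<times> UNIV\<close> (time times space, one-sided in time at \<open>0\<close>); for both sets derivatives
  within \<open>S\<close> are unique.
\<close>

primrec iter_deriv ::
  "'a::real_normed_vector set \<Rightarrow> 'a list \<Rightarrow> ('a \<Rightarrow> 'b::real_normed_vector) \<Rightarrow> 'a \<Rightarrow> 'b" where
  "iter_deriv S [] f = f"
| "iter_deriv S (v # vs) f = (\<lambda>x. frechet_derivative (iter_deriv S vs f) (at x within S) v)"

definition smooth_on ::
  "'a::real_normed_vector set \<Rightarrow> ('a \<Rightarrow> 'b::real_normed_vector) \<Rightarrow> bool" where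
  "smooth_on S f \<longleftrightarrow> (\<forall>vs. \<forall>x\<in>S. iter_deriv S vs f differentiable (at x within S))"


section \<open>Differential forms\<close>

text \<open>
  An element of the exterior algebra of the dual of \<open>V\<close> is a real function of lists of vectors:
  its degree-\<open>k\<close> part is its restriction to lists of length \<open>k\<close>.  A form assigns such an element to
  each point.  A form on the torus \<open>\<real>\<^sup>n / (2 \<pi> \<int>)\<^sup>n\<close> is a form on \<open>\<real>\<^sup>n\<close> that is \<open>2 \<pi>\<close>-periodic
  in every coordinate.
\<close>

type_synonym 'v covec = "'v list \<Rightarrow> real"
type_synonym 'v form = "'v \<Rightarrow> 'v list \<Rightarrow> real"

definition alternating :: "nat \<Rightarrow> 'v::real_vector covec \<Rightarrow> bool" where
  "alternating k a \<longleftrightarrow>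
     (\<forall>vs. length vs \<noteq> k \<longrightarrow> a vs = 0) \<and>
     (\<forall>vs i. length vs = k \<and> i < k \<longrightarrow> linear (\<lambda>v. a (vs[i := v]))) \<and>
     (\<forall>vs. \<not> distinct vs \<longrightarrow> a vs = 0)"

definition torus_form :: "nat \<Rightarrow> (real^'n) form \<Rightarrow> bool" where
  "torus_form k \<alpha> \<longleftrightarrow>
     (\<forall>x. alternating k (\<alpha> x)) \<and>
     (\<forall>x i. \<alpha> (x + axis i (2 * pi)) = \<alpha> x) \<and>
     (\<forall>vs. smooth_on UNIV (\<lambda>x. \<alpha> x vs))"

text \<open>
  Normalised so that \<open>(\<alpha> \<and> \<beta>)(u, v) = \<alpha>(u) \<beta>(v) - \<alpha>(v) \<beta>(u)\<close> for 1-forms; the degrees \<open>p\<close> and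
  \<open>length vs - p\<close> of the factors are summed over.
\<close>

definition wedge :: "'v form \<Rightarrow> 'v form \<Rightarrow> 'v form" (infixr "\<^bold>\<and>" 75) where
  "(\<alpha> \<^bold>\<and> \<beta>) x vs =
     (\<Sum>p\<le>length vs. \<Sum>\<sigma> | \<sigma> permutes {..<length vs}.
        of_int (sign \<sigma>) / (fact p * fact (length vs - p))
        * \<alpha> x (map (\<lambda>i. vs ! \<sigma> i) [0..<p])
        * \<beta> x (map (\<lambda>i. vs ! \<sigma> i) [p..<length vs]))"

definition ext_deriv :: "'v::real_normed_vector form \<Rightarrow> 'v form" where
  "ext_deriv \<alpha> x vs =
     (\<Sum>i<length vs. (-1) ^ i *
        frechet_derivative (\<lambda>y. \<alpha> y (take i vs @ drop (Suc i) vs)) (at x) (vs ! i))"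

definition contraction :: "'v \<Rightarrow> 'v form \<Rightarrow> 'v form" where
  "contraction u \<alpha> = (\<lambda>x vs. \<alpha> x (u # vs))"

definition pullback ::
  "('v::real_normed_vector \<Rightarrow> 'w::real_normed_vector) \<Rightarrow> 'w form \<Rightarrow> 'v form" where
  "pullback F \<alpha> = (\<lambda>x vs. \<alpha> (F x) (map (frechet_derivative F (at x)) vs))"

definition fun_form :: "('v \<Rightarrow> real) \<Rightarrow> 'v form" where
  "fun_form f = (\<lambda>x vs. if vs = [] then f x else 0)"

definition coord_form :: "'n \<Rightarrow> (real^'n) form" where
  "coord_form i = (\<lambda>x vs. if length vs = 1 then hd vs $ i else 0)"

text \<open>The factor \<open>r\<close> with \<open>a = r m\<close>, for \<open>a\<close> of top degree and \<open>m\<close> nonzero of top degree.\<close>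

definition top_ratio :: "'v covec \<Rightarrow> 'v covec \<Rightarrow> real" where
  "top_ratio a m = (THE r. \<forall>vs. a vs = r * m vs)"


section \<open>Metrics, Hodge star and Hodge Laplacian\<close>

definition inner_product :: "('v::real_vector \<Rightarrow> 'v \<Rightarrow> real) \<Rightarrow> bool" where
  "inner_product g \<longleftrightarrow>
     (\<forall>u. linear (g u)) \<and> (\<forall>u v. g u v = g v u) \<and> (\<forall>u. u \<noteq> 0 \<longrightarrow> g u u > 0)"

text \<open>\<open>m\<close> is one of the two volume elements (one for each orientation) of \<open>g\<close>.\<close>

definition volume_element :: "(real^'n \<Rightarrow> real^'n \<Rightarrow> real) \<Rightarrow> (real^'n) covec \<Rightarrow> bool" where
  "volume_element g m \<longleftrightarrow>
     alternating CARD('n) m \<and>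
     (\<forall>es. length es = CARD('n) \<and>
           (\<forall>i<CARD('n). \<forall>j<CARD('n). g (es ! i) (es ! j) = (if i = j then 1 else 0))
       \<longrightarrow> \<bar>m es\<bar> = 1)"

text \<open>
  The metric \<open>g\<close> and volume element \<open>m\<close> of \<open>g\<close> determined by \<open>g(u,v) m = B(u,v)\<close>, where \<open>B\<close> has
  values in the top-degree covectors.  The orientation is part of the solution: since \<open>g\<close> is
  positive definite, only one sign of \<open>m\<close> is possible.
\<close>

definition metric_of ::
  "(real^'n \<Rightarrow> real^'n \<Rightarrow> (real^'n) covec) \<Rightarrow>
     (real^'n \<Rightarrow> real^'n \<Rightarrow> real) \<times> (real^'n) covec" where
  "metric_of B = (THE (g, m). inner_product g \<and> volume_element g m \<and>
                     (\<forall>u v vs. g u v * m vs = B u v vs))"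

definition inverse_gram :: "(real^'n \<Rightarrow> real^'n \<Rightarrow> real) \<Rightarrow> real^'n^'n" where
  "inverse_gram g = matrix_inv (\<chi> i j. g (axis i 1) (axis j 1))"

text \<open>
  In index notation
  \<open>(*\<beta>)\<^sub>K = 1/p! \<Sum>\<^sub>I\<^sub>J g\<^sup>I\<^sup>J \<beta>\<^sub>I m\<^sub>J\<^sub>K\<close>
  for \<open>\<beta>\<close> of degree \<open>p\<close>, with \<open>m\<close> the volume form; this is the star with
  \<open>\<alpha> \<and> *\<beta> = \<langle>\<alpha>, \<beta>\<rangle> m\<close>.
\<close>

definition hodge_star ::
  "(real^'n \<Rightarrow> real^'n \<Rightarrow> real^'n \<Rightarrow> real) \<Rightarrow> (real^'n) form \<Rightarrow> (real^'n) form \<Rightarrow> (real^'n) form" where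
  "hodge_star g m \<beta> x vs =
     (if length vs \<le> CARD('n) then
        (let p = CARD('n) - length vs in
           (\<Sum>I | length I = p. \<Sum>J | length J = p.
              (\<Prod>a<p. inverse_gram (g x) $ (I ! a) $ (J ! a))
              * \<beta> x (map (\<lambda>i. axis i 1) I)
              * m x (map (\<lambda>j. axis j 1) J @ vs)) / fact p)
      else 0)"

text \<open>Codifferential and Hodge Laplacian \<open>d \<delta> + \<delta> d\<close> on \<open>p\<close>-forms.\<close>

definition codiff ::
  "(real^'n \<Rightarrow> real^'n \<Rightarrow> real^'n \<Rightarrow> real) \<Rightarrow> (real^'n) form \<Rightarrow> nat \<Rightarrow> (real^'n) form \<Rightarrow> (real^'n) form"
  where
  "codiff g m p \<alpha> =
     (\<lambda>x vs. (-1) ^ (CARD('n) * (p + 1) + 1) *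
               hodge_star g m (ext_deriv (hodge_star g m \<alpha>)) x vs)"

definition hodge_laplacian ::
  "(real^'n \<Rightarrow> real^'n \<Rightarrow> real^'n \<Rightarrow> real) \<Rightarrow> (real^'n) form \<Rightarrow> nat \<Rightarrow> (real^'n) form \<Rightarrow> (real^'n) form"
  where
  "hodge_laplacian g m p \<alpha> =
     (\<lambda>x vs. ext_deriv (codiff g m p \<alpha>) x vs + codiff g m (p + 1) (ext_deriv \<alpha>) x vs)"


section \<open>Hypersymplectic structures on the 4-torus\<close>

text \<open>
  Triples are indexed by the type \<open>3\<close>, whose arithmetic is modulo 3 (so \<open>3 = 0\<close>): the cyclic
  permutations of \<open>(1,2,3)\<close> are the triples \<open>(i, i + 1, i + 2)\<close>.  The coordinates of the 4-torus are
  indexed by the type \<open>4\<close>, with \<open>x\<^sub>0\<close> at index \<open>0\<close>; \<open>spatial\<close> sends \<open>1, 2, 3\<close> to \<open>1, 2, 3\<close>.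
\<close>

definition spatial :: "3 \<Rightarrow> 4" where
  "spatial i = (if i = 1 then 1 else if i = 2 then 2 else 3)"

definition levi_civita :: "3 \<Rightarrow> 3 \<Rightarrow> 3 \<Rightarrow> real" where
  "levi_civita i j k =
     (if j = i + 1 \<and> k = i + 2 then 1 else if j = i + 2 \<and> k = i + 1 then -1 else 0)"

type_synonym triple = "3 \<Rightarrow> (real^4) form"

definition pos_def_matrix :: "real^'n^'n \<Rightarrow> bool" where
  "pos_def_matrix M \<longleftrightarrow> transpose M = M \<and> (\<forall>v. v \<noteq> 0 \<longrightarrow> v \<bullet> (M *v v) > 0)"

definition hypersymplectic :: "triple \<Rightarrow> bool" where
  "hypersymplectic \<omega> \<longleftrightarrow>
     (\<forall>i. torus_form 2 (\<omega> i) \<and> ext_deriv (\<omega> i) = (\<lambda>x vs. 0)) \<and>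
     (\<exists>\<mu>\<^sub>0. torus_form 4 \<mu>\<^sub>0 \<and> (\<forall>x. \<exists>vs. \<mu>\<^sub>0 x vs \<noteq> 0) \<and>
        (\<forall>x. pos_def_matrix
               (\<chi> i j. top_ratio ((\<omega> i \<^bold>\<and> \<omega> j) x) (\<lambda>vs. 2 * \<mu>\<^sub>0 x vs))))"

definition hs_metric_volume ::
  "triple \<Rightarrow> real^4 \<Rightarrow> (real^4 \<Rightarrow> real^4 \<Rightarrow> real) \<times> (real^4) covec" where
  "hs_metric_volume \<omega> x = metric_of (\<lambda>u v vs. 1 / 6 *
     (\<Sum>i\<in>UNIV. \<Sum>j\<in>UNIV. \<Sum>k\<in>UNIV. levi_civita i j k *
        (contraction u (\<omega> i) \<^bold>\<and> contraction v (\<omega> j) \<^bold>\<and> \<omega> k) x vs))"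

definition hs_metric :: "triple \<Rightarrow> real^4 \<Rightarrow> real^4 \<Rightarrow> real^4 \<Rightarrow> real" where
  "hs_metric \<omega> x = fst (hs_metric_volume \<omega> x)"

definition hs_volume :: "triple \<Rightarrow> (real^4) form" where
  "hs_volume \<omega> x = snd (hs_metric_volume \<omega> x)"

definition hs_Q :: "triple \<Rightarrow> real^4 \<Rightarrow> real^3^3" where
  "hs_Q \<omega> x = (\<chi> i j. top_ratio ((\<omega> i \<^bold>\<and> \<omega> j) x) (\<lambda>vs. 2 * hs_volume \<omega> x vs))"

definition hs_dQ_Qinv :: "triple \<Rightarrow> 3 \<Rightarrow> 3 \<Rightarrow> (real^4) form" where
  "hs_dQ_Qinv \<omega> i j = (\<lambda>x vs. \<Sum>k\<in>UNIV.
     ext_deriv (fun_form (\<lambda>y. hs_Q \<omega> y $ i $ k)) x vs * matrix_inv (hs_Q \<omega> x) $ k $ j)"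

definition hs_E :: "triple \<Rightarrow> 3 \<Rightarrow> (real^4) form \<Rightarrow> (real^4) form" where
  "hs_E \<omega> i \<alpha> = (\<lambda>x vs. - hodge_star (hs_metric \<omega>) (hs_volume \<omega>) (\<alpha> \<^bold>\<and> \<omega> i) x vs)"

definition hs_torsion :: "triple \<Rightarrow> 3 \<Rightarrow> (real^4) form" where
  "hs_torsion \<omega> i = (\<lambda>x vs. - (\<Sum>j\<in>UNIV. hs_E \<omega> j (hs_dQ_Qinv \<omega> i j) x vs))"

definition smooth_family :: "(real \<Rightarrow> 'v::real_normed_vector form) \<Rightarrow> bool" where
  "smooth_family \<alpha> \<longleftrightarrow> (\<forall>vs. smooth_on ({0..} \<times> UNIV) (\<lambda>(t, x). \<alpha> t x vs))"

definition hypersymplectic_flow :: "(real \<Rightarrow> triple) \<Rightarrow> bool" where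
  "hypersymplectic_flow \<omega> \<longleftrightarrow>
     (\<forall>t\<ge>0. hypersymplectic (\<omega> t)) \<and>
     (\<forall>i. smooth_family (\<lambda>t. \<omega> t i)) \<and>
     (\<forall>t\<ge>0. \<forall>i x vs. ((\<lambda>s. \<omega> s i x vs) has_real_derivative ext_deriv (hs_torsion (\<omega> t) i) x vs)
                        (at t within {0..}))"

definition standard_triple :: triple where
  "standard_triple i = (\<lambda>x vs.
     (coord_form 0 \<^bold>\<and> coord_form (spatial i)) x vs +
     (coord_form (spatial (i + 1)) \<^bold>\<and> coord_form (spatial (i + 2))) x vs)"

definition simple_type :: "triple \<Rightarrow> bool" where
  "simple_type \<omega> \<longleftrightarrow> hypersymplectic \<omega> \<and>
     (\<exists>\<phi> :: 3 \<Rightarrow> real \<Rightarrow> real.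
        (\<forall>i. smooth_on UNIV (\<phi> i)) \<and>
        (\<forall>i s. \<phi> i (s + 2 * pi) = \<phi> i s) \<and>
        (\<forall>i s. 1 + deriv (deriv (\<phi> i)) s > 0) \<and>
        (\<forall>i. \<omega> i = (\<lambda>x vs.
           (1 + deriv (deriv (\<phi> i)) (x $ 0)) * (coord_form 0 \<^bold>\<and> coord_form (spatial i)) x vs +
           (coord_form (spatial (i + 1)) \<^bold>\<and> coord_form (spatial (i + 2))) x vs)))"


section \<open>\<open>G\<^sub>2\<close>-structures on the 7-torus\<close>

text \<open>
  The coordinates of \<open>T\<^sup>7 = T\<^sup>4 \<times> T\<^sup>3\<close> are indexed by the disjoint sum \<open>4 + 3\<close>: \<open>Inl\<close> for the
  \<open>x\<^sub>i\<close> and \<open>Inr\<close> for the \<open>t\<^sup>i\<close>.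
\<close>

definition proj4 :: "real^(4 + 3) \<Rightarrow> real^4" where
  "proj4 x = (\<chi> i. x $ Inl i)"

definition dt :: "3 \<Rightarrow> (real^(4 + 3)) form" where
  "dt i = coord_form (Inr i)"

definition G2_form :: "triple \<Rightarrow> (real^(4 + 3)) form" where
  "G2_form \<omega> = (\<lambda>x vs.
     (dt 1 \<^bold>\<and> dt 2 \<^bold>\<and> dt 3) x vs - (\<Sum>i\<in>UNIV. (dt i \<^bold>\<and> pullback proj4 (\<omega> i)) x vs))"

text \<open>
  A 3-form is a \<open>G\<^sub>2\<close>-structure if at every point it is linearly equivalent to the model form, here
  the (constant-coefficient) form built from the standard triple.
\<close>

definition G2_structure :: "(real^(4 + 3)) form \<Rightarrow> bool" where
  "G2_structure \<phi> \<longleftrightarrow> torus_form 3 \<phi> \<and>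
     (\<forall>x. \<exists>A. linear A \<and> bij A \<and> (\<forall>vs. \<phi> x vs = G2_form standard_triple 0 (map A vs)))"

definition closed_G2_structure :: "(real^(4 + 3)) form \<Rightarrow> bool" where
  "closed_G2_structure \<phi> \<longleftrightarrow> G2_structure \<phi> \<and> ext_deriv \<phi> = (\<lambda>x vs. 0)"

text \<open>\<open>g(u,v) dvol = 1/6 \<iota>\<^sub>u\<phi> \<and> \<iota>\<^sub>v\<phi> \<and> \<phi>\<close>\<close>

definition G2_metric_volume ::
  "(real^(4 + 3)) form \<Rightarrow> real^(4 + 3) \<Rightarrow>
     (real^(4 + 3) \<Rightarrow> real^(4 + 3) \<Rightarrow> real) \<times> (real^(4 + 3)) covec" where
  "G2_metric_volume \<phi> x =
     metric_of (\<lambda>u v vs. 1 / 6 * (contraction u \<phi> \<^bold>\<and> contraction v \<phi> \<^bold>\<and> \<phi>) x vs)"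

definition G2_metric ::
  "(real^(4 + 3)) form \<Rightarrow> real^(4 + 3) \<Rightarrow> real^(4 + 3) \<Rightarrow> real^(4 + 3) \<Rightarrow> real" where
  "G2_metric \<phi> x = fst (G2_metric_volume \<phi> x)"

definition G2_volume :: "(real^(4 + 3)) form \<Rightarrow> (real^(4 + 3)) form" where
  "G2_volume \<phi> x = snd (G2_metric_volume \<phi> x)"

definition torsion_free_G2_structure :: "(real^(4 + 3)) form \<Rightarrow> bool" where
  "torsion_free_G2_structure \<phi> \<longleftrightarrow> closed_G2_structure \<phi> \<and>
     ext_deriv (hodge_star (G2_metric \<phi>) (G2_volume \<phi>) \<phi>) = (\<lambda>x vs. 0)"

definition G2_laplacian_flow :: "(real \<Rightarrow> (real^(4 + 3)) form) \<Rightarrow> bool" where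
  "G2_laplacian_flow \<phi> \<longleftrightarrow>
     (\<forall>t\<ge>0. G2_structure (\<phi> t)) \<and>
     smooth_family \<phi> \<and>
     (\<forall>t\<ge>0. \<forall>x vs.
        ((\<lambda>s. \<phi> s x vs) has_real_derivative
           hodge_laplacian (G2_metric (\<phi> t)) (G2_volume (\<phi> t)) 3 (\<phi> t) x vs) (at t within {0..}))"

text \<open>Invariance under translations in all coordinates other than \<open>x\<^sub>0\<close>.\<close>

definition cohomogeneity_one :: "(real^(4 + 3)) form \<Rightarrow> bool" where
  "cohomogeneity_one \<phi> \<longleftrightarrow> (\<forall>c. c $ Inl 0 = 0 \<longrightarrow> pullback (\<lambda>x. x + c) \<phi> = \<phi>)"


section \<open>Diffeomorphisms of tori and smooth convergence\<close>

definition period_lattice :: "(real^'n) set" where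
  "period_lattice = {l. \<forall>i. \<exists>n::int. l $ i = 2 * pi * of_int n}"

text \<open>Maps between tori are given by their lifts to the universal cover.\<close>

definition smooth_torus_map :: "(real^'n \<Rightarrow> real^'n) \<Rightarrow> bool" where
  "smooth_torus_map F \<longleftrightarrow> smooth_on UNIV F \<and>
     (\<forall>x. \<forall>l\<in>period_lattice. F (x + l) - F x \<in> period_lattice)"

definition torus_diffeomorphism :: "(real^'n \<Rightarrow> real^'n) \<Rightarrow> bool" where
  "torus_diffeomorphism F \<longleftrightarrow> smooth_torus_map F \<and>
     (\<exists>G. smooth_torus_map G \<and>
        (\<forall>x. G (F x) - x \<in> period_lattice \<and> F (G x) - x \<in> period_lattice))"

definition reparametrizes_x0 :: "(real^(4 + 3) \<Rightarrow> real^(4 + 3)) \<Rightarrow> bool" where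
  "reparametrizes_x0 F \<longleftrightarrow>
     (\<exists>f :: real \<Rightarrow> real. \<forall>x. F x = (\<chi> i. if i = Inl 0 then f (x $ Inl 0) else x $ i))"

text \<open>
  Uniform convergence of all derivatives of order at most \<open>k\<close> of all coefficients (\<open>\<alpha>\<close> evaluated
  on constant vectors \<open>ws\<close>); for periodic forms, uniformity on \<open>\<real>\<^sup>n\<close> is uniformity on the torus.
\<close>

definition Ck_converges ::
  "nat \<Rightarrow> (real \<Rightarrow> (real^'n) form) \<Rightarrow> (real^'n) form \<Rightarrow> bool" where
  "Ck_converges k \<alpha> \<beta> \<longleftrightarrow>
     (\<forall>ws vs. length vs \<le> k \<longrightarrow>
        uniform_limit UNIV (\<lambda>t. iter_deriv UNIV vs (\<lambda>x. \<alpha> t x ws))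
          (iter_deriv UNIV vs (\<lambda>x. \<beta> x ws)) at_top)"

definition smoothly_converges :: "(real \<Rightarrow> (real^'n) form) \<Rightarrow> (real^'n) form \<Rightarrow> bool" where
  "smoothly_converges \<alpha> \<beta> \<longleftrightarrow> (\<forall>k. Ck_converges k \<alpha> \<beta>)"

end

theory Submission
  imports Defs "Jordan_Normal_Form.Determinant" "HOL-Real_Asymp.Real_Asymp"
begin

hide_fact (open) Matrix.vec_eq_iff
no_notation Matrix.vec_index (infixl "$" 100)
no_notation Matrix.scalar_prod (infix "\<bullet>" 70)

text \<open>
  Write \<open>A\<^sub>i\<close> for the coefficients \<open>1 + \<phi>\<^sub>i''\<close>, \<open>V = (A\<^sub>1 A\<^sub>2 A\<^sub>3)\<^sup>1\<^sup>/\<^sup>3\<close> and \<open>u\<^sub>i = log (A\<^sub>i / V)\<close>.  The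
  hypersymplectic metric is the diagonal one with entries \<open>V\<^sup>2\<close> and \<open>A\<^sub>i / V\<close>, and the \<open>G\<^sub>2\<close> metric has
  the additional entries \<open>A\<^sub>i / V\<close> in the directions \<open>t\<^sup>i\<close>.  Computing both Hodge stars, the torsion forms
  and the codifferential of \<open>\<phi>\<close> have the same coefficients \<open>u\<^sub>i' A\<^sub>i / V\<^sup>2\<close>, so that the hypersymplectic
  flow is the Laplacian flow.

  For the convergence let \<open>D = V\<^sup>-\<^sup>1 d/dx\<^sub>0\<close> be the arc length derivative and \<open>q\<close> the sum of the \<open>(D u\<^sub>i)\<^sup>2\<close>.
  Then \<open>\<partial>\<^sub>t u\<^sub>i = D\<^sup>2 u\<^sub>i + (D u\<^sub>i)\<^sup>2 - q / 3\<close>, the length element \<open>V\<close> grows at rate \<open>q / 3\<close>, and the total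
  length is at most \<open>2 \<pi>\<close> by the inequality of arithmetic and geometric means.  Let \<open>E\<^sub>k\<close> be the sum
  over \<open>i\<close> of the squared \<open>L\<^sup>2\<close> norms of \<open>D\<^sup>k u\<^sub>i\<close>.  In the derivative of \<open>E\<^sub>1\<close> the cubic terms cancel, because they
  are exact or because the \<open>u\<^sub>i\<close> sum to zero; so \<open>E\<^sub>1' \<le> - 2 E\<^sub>2\<close> and \<open>E\<^sub>1\<close> decays exponentially by the
  Poincare inequality.  In general the nonlinear terms of \<open>E\<^sub>k'\<close> pair \<open>D\<^sup>k\<^sup>+\<^sup>1 u\<^sub>i\<close> with products of two or three
  derivatives of total order \<open>k + 1\<close>, and since \<open>k \<mapsto> E\<^sub>k\<close> is logarithmically convex, the squared norms
  of these products are at most \<open>C (E\<^sub>1 + E\<^sub>1\<^sup>2) E\<^sub>k\<^sub>+\<^sub>1\<close>, which is absorbed for large times.  Hence every \<open>E\<^sub>k\<close> tends to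
  \<open>0\<close>.  As each \<open>A\<^sub>i = V e\<^sup>u\<close> (with \<open>u = u\<^sub>i\<close>) has integral \<open>2 \<pi>\<close>, also \<open>u\<^sub>i \<rightarrow> 0\<close>, and the circle
  diffeomorphisms are the parametrizations proportional to arc length.
\<close>

section \<open>Coordinate covectors\<close>

text \<open>The obstacle is degeneracy: the evolution of \<open>V\<close> contains no second
  derivative (\<open>dt_w\<close>), so diffusion acts on the ratios \<open>A_i / V\<close> only, and
  nothing drives the \<open>A_i\<close> themselves to constants in the coordinate \<open>x0\<close>.
  Hence functions are differentiated by \<open>D\<close> and integrated by \<open>M\<close>, both
  independent of the parametrization, and coordinates return only in the final change of variable,
  after which one derivative is \<open>D\<close> times \<open>L / (2 pi)\<close> with
  \<open>L\<close> the total length. Interpolation inequalities are replaced by an elementary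
  device. Each \<open>D^k u_i\<close> with \<open>k >= 1\<close> has a zero on the circle, so its
  square is at most \<open>2 pi\<close> times the squared norm of the next derivative, and
  log-convexity gathers the derivatives spent in this way on a single factor. Only the upper bound
  \<open>2 pi\<close> for the length enters the constants, so they do not depend on time. The
  geometry is finite symbolic algebra: forms are lists of coefficients and index lists, on which
  wedge, contraction, star and exterior derivative act as list operations.\<close>

definition coord_covec :: "'n list \<Rightarrow> (real^'n) list \<Rightarrow> real" where
  "coord_covec I vs =
     (if length vs = length I
      then Determinant.det (Matrix.mat (length I) (length I) (\<lambda>(i, j). vs ! j $ (I ! i))) else 0)"

abbreviation drop_nth :: "nat \<Rightarrow> 'a list \<Rightarrow> 'a list" where
  "drop_nth i xs \<equiv> take i xs @ drop (Suc i) xs"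

lemma coord_covec_Nil [simp]: "coord_covec [] vs = (if vs = [] then 1 else 0)"
  by (auto simp: coord_covec_def)

lemma coord_covec_length: "length vs \<noteq> length I \<Longrightarrow> coord_covec I vs = 0"
  by (simp add: coord_covec_def)

text \<open>Laplace expansion along the row of \<open>a\<close>. The right-hand side has the shape
  of \<open>ext_deriv\<close>: one vector is removed at a time, with alternating signs.\<close>

lemma coord_covec_Cons:
  "coord_covec (a # I) vs =
     (\<Sum>i<length vs. (-1) ^ i * (vs ! i $ a) * coord_covec I (drop_nth i vs))"
proof (cases "length vs = Suc (length I)")
  case False
  have "coord_covec I (drop_nth i vs) = 0" if "i < length vs" for i
    using that False by (intro coord_covec_length) (auto simp: min_def)
  then show ?thesis
    using False by (simp add: coord_covec_length)
next
  case len: True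
  let ?n = "Suc (length I)"
  let ?M = "Matrix.mat ?n ?n (\<lambda>(i, j). vs ! j $ ((a # I) ! i))"
  have "coord_covec (a # I) vs = Determinant.det ?M"
    using len by (simp add: coord_covec_def)
  also have "\<dots> = (\<Sum>j<?n. ?M $$ (0, j) * cofactor ?M 0 j)"
    by (rule laplace_expansion_row[of _ ?n]) auto
  also have "\<dots> = (\<Sum>i<length vs. (-1) ^ i * (vs ! i $ a) * coord_covec I (drop_nth i vs))"
  proof (rule sum.cong)
    fix j assume "j \<in> {..<length vs}"
    then have j: "j < ?n" using len by simp
    have "mat_delete ?M 0 j =
        Matrix.mat (length I) (length I) (\<lambda>(i, k). drop_nth j vs ! k $ (I ! i))"
      using j len by (intro eq_matI) (auto simp: mat_delete_def nth_append min_def)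
    then show "?M $$ (0, j) * cofactor ?M 0 j = (-1) ^ j * (vs ! j $ a) * coord_covec I (drop_nth j vs)"
      using j len by (simp add: cofactor_def coord_covec_def min_def)
  qed (use len in simp)
  finally show ?thesis .
qed

text \<open>Laplace expansion along the column of \<open>v\<close>; this is the antiderivation rule
  for contracting \<open>v\<close> into the covector.\<close>

lemma coord_covec_Cons_vec:
  "coord_covec I (v # vs) =
     (\<Sum>i<length I. (-1) ^ i * (v $ (I ! i)) * coord_covec (drop_nth i I) vs)"
proof (cases "length I = Suc (length vs)")
  case False
  have "coord_covec (drop_nth i I) vs = 0" if "i < length I" for i
    using that False by (intro coord_covec_length) (auto simp: min_def)
  then show ?thesis
    using False by (simp add: coord_covec_length)
next
  case len: True
  let ?n = "Suc (length vs)"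
  let ?M = "Matrix.mat ?n ?n (\<lambda>(i, j). (v # vs) ! j $ (I ! i))"
  have "coord_covec I (v # vs) = Determinant.det ?M"
    using len by (simp add: coord_covec_def)
  also have "\<dots> = (\<Sum>i<?n. ?M $$ (i, 0) * cofactor ?M i 0)"
    by (rule laplace_expansion_column[of _ ?n]) auto
  also have "\<dots> = (\<Sum>i<length I. (-1) ^ i * (v $ (I ! i)) * coord_covec (drop_nth i I) vs)"
  proof (rule sum.cong)
    fix j assume "j \<in> {..<length I}"
    then have j: "j < ?n" using len by simp
    have "mat_delete ?M j 0 =
        Matrix.mat (length vs) (length vs) (\<lambda>(i, k). vs ! k $ (drop_nth j I ! i))"
      using j len by (intro eq_matI) (auto simp: mat_delete_def nth_append min_def)
    then show "?M $$ (j, 0) * cofactor ?M j 0 = (-1) ^ j * (v $ (I ! j)) * coord_covec (drop_nth j I) vs"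
      using j len by (simp add: cofactor_def coord_covec_def min_def)
  qed (use len in simp)
  finally show ?thesis .
qed

lemma coord_covec_leibniz:
  assumes "length vs = length I"
  shows "coord_covec I vs =
    (\<Sum>p | p permutes {..<length I}. of_int (sign p) * (\<Prod>i<length I. vs ! p i $ (I ! i)))"
proof -
  have "p i < length I" if "p permutes {..<length I}" "i < length I" for p i
    using permutes_in_image[OF that(1), of i] that(2) by simp
  then show ?thesis
    using assms unfolding coord_covec_def Determinant.det_def
    by (auto simp: lessThan_atLeast0 intro!: sum.cong prod.cong)
qed

text \<open>Left composition with \<open>p\<close> reindexes the Leibniz sum, and
  \<open>sign p\<close> squares to 1.\<close>

lemma coord_covec_permute_vecs:
  assumes p: "p permutes {..<length vs}"
  shows "coord_covec I (map (\<lambda>i. vs ! p i) [0..<length vs]) = of_int (sign p) * coord_covec I vs"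
proof (cases "length vs = length I")
  case False
  then show ?thesis by (simp add: coord_covec_length)
next
  case len: True
  let ?n = "length I"
  note p' = p[unfolded len]
  have "coord_covec I (map (\<lambda>i. vs ! p i) [0..<length vs]) =
    (\<Sum>q | q permutes {..<?n}. of_int (sign q) * (\<Prod>i<?n. vs ! p (q i) $ (I ! i)))"
  proof -
    have "q i < ?n" if "q permutes {..<?n}" "i < ?n" for q i
      using permutes_in_image[OF that(1), of i] that(2) by simp
    then show ?thesis
      using len by (subst coord_covec_leibniz) (auto intro!: sum.cong prod.cong)
  qed
  also have "\<dots> = (\<Sum>q | q permutes {..<?n}. of_int (sign p) *
      (of_int (sign (p \<circ> q)) * (\<Prod>i<?n. vs ! (p \<circ> q) i $ (I ! i))))"
  proof (rule sum.cong[OF refl])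
    fix q assume "q \<in> {q. q permutes {..<?n}}"
    then have "sign (p \<circ> q) = sign p * sign q"
      using p' by (intro sign_compose) (auto intro: permutes_imp_permutation[of "{..<?n}"])
    moreover have "sign p * sign p = 1"
      by (simp add: sign_def)
    ultimately show "of_int (sign q) * (\<Prod>i<?n. vs ! p (q i) $ (I ! i)) = of_int (sign p) *
      (of_int (sign (p \<circ> q)) * (\<Prod>i<?n. vs ! (p \<circ> q) i $ (I ! i)))"
      by (simp flip: mult.assoc of_int_mult)
  qed
  also have "\<dots> = of_int (sign p) * (\<Sum>q | q permutes {..<?n}.
      of_int (sign (p \<circ> q)) * (\<Prod>i<?n. vs ! (p \<circ> q) i $ (I ! i)))"
    by (simp add: sum_distrib_left)
  also have "(\<Sum>q | q permutes {..<?n}.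
      of_int (sign (p \<circ> q)) * (\<Prod>i<?n. vs ! (p \<circ> q) i $ (I ! i))) =
      (\<Sum>q | q permutes {..<?n}. of_int (sign q) * (\<Prod>i<?n. vs ! q i $ (I ! i)))"
    using setum_permutations_compose_left[OF p', symmetric] .
  also have "\<dots> = coord_covec I vs"
    using len by (simp add: coord_covec_leibniz)
  finally show ?thesis .
qed

lemma coord_covec_not_distinct_vecs:
  assumes "\<not> distinct vs" shows "coord_covec I vs = 0"
proof (cases "length vs = length I")
  case len: True
  let ?n = "length I"
  let ?M = "Matrix.mat ?n ?n (\<lambda>(i, j). vs ! j $ (I ! i))"
  obtain i j where ij: "i < ?n" "j < ?n" "i \<noteq> j" "vs ! i = vs ! j"
    using assms len by (auto simp: distinct_conv_nth)
  have "Determinant.det ?M = 0"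
    by (rule det_identical_columns[of _ ?n i j]) (use ij in \<open>auto intro!: eq_vecI\<close>)
  then show ?thesis by (simp add: coord_covec_def)
qed (simp add: coord_covec_length)

lemma coord_covec_not_distinct:
  assumes "\<not> distinct I" shows "coord_covec I vs = 0"
proof (cases "length vs = length I")
  case len: True
  let ?n = "length I"
  let ?M = "Matrix.mat ?n ?n (\<lambda>(i, j). vs ! j $ (I ! i))"
  obtain i j where ij: "i < ?n" "j < ?n" "i \<noteq> j" "I ! i = I ! j"
    using assms len by (auto simp: distinct_conv_nth)
  have "Determinant.det ?M = 0"
    by (rule det_identical_rows[of _ ?n i j]) (use ij in \<open>auto intro!: eq_vecI\<close>)
  then show ?thesis by (simp add: coord_covec_def)
qed (simp add: coord_covec_length)

lemma coord_covec_swap_head: "coord_covec (a # b # I) vs = - coord_covec (b # a # I) vs"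
proof (cases "length vs = Suc (Suc (length I))")
  case len: True
  let ?n = "Suc (Suc (length I))"
  let ?M = "\<lambda>J. Matrix.mat ?n ?n (\<lambda>(i, j). vs ! j $ (J ! i))"
  have "swaprows 0 1 (?M (b # a # I)) = ?M (a # b # I)"
    by (rule eq_matI) (auto simp: nth_Cons split: nat.split)
  moreover have "Determinant.det (swaprows 0 1 (?M (b # a # I))) = - Determinant.det (?M (b # a # I))"
    by (rule det_swaprows[of 0 ?n 1]) auto
  ultimately show ?thesis
    using len by (simp add: coord_covec_def)
qed (simp add: coord_covec_length)

lemma coord_covec_Cons_cong:
  "(\<And>vs. coord_covec I vs = c * coord_covec J vs) \<Longrightarrow>
    coord_covec (a # I) vs = c * coord_covec (a # J) vs"
  by (simp add: coord_covec_Cons sum_distrib_left mult_ac)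

lemma linear_coord_covec:
  assumes "i < length vs" shows "linear (\<lambda>v. coord_covec I (vs[i := v]))"
proof (cases "length vs = length I")
  case True
  have *: "p j < length I" if "p permutes {..<length I}" "j < length I" for p j
    using permutes_in_image[OF that(1), of j] that(2) by simp
  have "linear (\<lambda>v. of_int (sign p) * (\<Prod>j<length I. vs[i := v] ! p j $ (I ! j)))"
    if p: "p permutes {..<length I}" for p
  proof -
    \<comment> \<open>The replaced vector occurs in exactly one factor of this Leibniz term, the one
      of row \<open>k\<close>, so the term is linear in it.\<close>
    define k where "k = Hilbert_Choice.inv p i"
    have k: "p k = i" "k < length I"
      using p True assms permutes_inverses(1)[OF p, of i] permutes_in_image[OF p, of k]
      by (auto simp: k_def)
    have "(\<Prod>j<length I. vs[i := v] ! p j $ (I ! j)) =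
        v $ (I ! k) * (\<Prod>j\<in>{..<length I} - {k}. vs ! p j $ (I ! j))" for v
    proof -
      have "(\<Prod>j<length I. vs[i := v] ! p j $ (I ! j)) =
        vs[i := v] ! p k $ (I ! k) * (\<Prod>j\<in>{..<length I} - {k}. vs[i := v] ! p j $ (I ! j))"
        using k by (intro prod.remove) auto
      also have "(\<Prod>j\<in>{..<length I} - {k}. vs[i := v] ! p j $ (I ! j)) =
          (\<Prod>j\<in>{..<length I} - {k}. vs ! p j $ (I ! j))"
      proof (rule prod.cong[OF refl])
        fix j assume j: "j \<in> {..<length I} - {k}"
        then have "p j \<noteq> i" using k permutes_inj[OF p] by (auto dest: injD)
        then show "vs[i := v] ! p j $ (I ! j) = vs ! p j $ (I ! j)" by simp
      qed
      finally show ?thesis using k assms by simp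
    qed
    then show ?thesis
      by (auto intro!: linearI simp: algebra_simps)
  qed
  then have "linear (\<lambda>v. \<Sum>p | p permutes {..<length I}.
      of_int (sign p) * (\<Prod>j<length I. vs[i := v] ! p j $ (I ! j)))"
    by (intro linear_compose_sum) auto
  then show ?thesis
    using True by (simp add: coord_covec_leibniz)
next
  case False
  then show ?thesis
    by (auto intro!: linearI simp: coord_covec_length)
qed

lemma alternating_coord_covec: "alternating (length I) (coord_covec I)"
  unfolding alternating_def
  by (intro conjI allI impI)
    (simp_all add: linear_coord_covec coord_covec_not_distinct_vecs coord_covec_length)

text \<open>In a wedge the second factor is evaluated at the positions from \<open>p\<close> on.
  Conjugation by the shift turns its permutations into permutations of \<open>{p..<n}\<close>, which
  can be composed with those of all positions.\<close>

lemma coord_covec_leibniz_tail: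
  assumes "n = p + length J"
  shows "coord_covec J (map f [p..<n]) =
    (\<Sum>\<rho> | \<rho> permutes {p..<n}. of_int (sign \<rho>) * (\<Prod>i\<in>{p..<n}. f (\<rho> i) $ (J ! (i - p))))"
proof -
  let ?q = "length J"
  have bij: "bij_betw ((+) p) {..<?q} {p..<n}"
    using assms by (auto simp: lessThan_atLeast0 bij_betw_def)
  have "coord_covec J (map f [p..<n]) =
    (\<Sum>\<rho> | \<rho> permutes {..<?q}. of_int (sign \<rho>) * (\<Prod>i<?q. f (p + \<rho> i) $ (J ! i)))"
  proof -
    have "\<rho> i < ?q" if "\<rho> permutes {..<?q}" "i < ?q" for \<rho> i
      using permutes_in_image[OF that(1), of i] that(2) by simp
    then show ?thesis
      using assms by (subst coord_covec_leibniz) (auto intro!: sum.cong prod.cong)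
  qed
  also have "\<dots> = (\<Sum>\<rho> | \<rho> permutes {..<?q}. of_int (sign (map_permutation {..<?q} ((+) p) \<rho>)) *
      (\<Prod>i\<in>{p..<n}. f (map_permutation {..<?q} ((+) p) \<rho> i) $ (J ! (i - p))))"
  proof (rule sum.cong[OF refl])
    fix \<rho> assume "\<rho> \<in> {\<rho>. \<rho> permutes {..<?q}}"
    then have \<rho>: "\<rho> permutes {..<?q}" by simp
    have "map_permutation {..<?q} ((+) p) \<rho> (p + i) = p + \<rho> i" if "i < ?q" for i
      using that by (subst map_permutation_apply) auto
    then have "(\<Prod>i<?q. f (p + \<rho> i) $ (J ! i)) =
        (\<Prod>i<?q. f (map_permutation {..<?q} ((+) p) \<rho> (p + i)) $ (J ! (p + i - p)))"
      by (intro prod.cong) auto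
    also have "\<dots> = (\<Prod>i\<in>{p..<n}. f (map_permutation {..<?q} ((+) p) \<rho> i) $ (J ! (i - p)))"
      by (rule prod.reindex_bij_betw[OF bij])
    finally show "of_int (sign \<rho>) * (\<Prod>i<?q. f (p + \<rho> i) $ (J ! i)) =
      of_int (sign (map_permutation {..<?q} ((+) p) \<rho>)) *
      (\<Prod>i\<in>{p..<n}. f (map_permutation {..<?q} ((+) p) \<rho> i) $ (J ! (i - p)))"
      using \<rho> by (simp add: sign_map_permutation)
  qed
  also have "\<dots> = (\<Sum>\<rho> | \<rho> permutes {p..<n}. of_int (sign \<rho>) * (\<Prod>i\<in>{p..<n}. f (\<rho> i) $ (J ! (i - p))))"
  proof -
    have "map_permutation {..<?q} ((+) p) =
        (\<lambda>\<rho> x. if x \<in> {p..<n} then p + \<rho> (inv_into {..<?q} ((+) p) x) else x)"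
      using bij_betw_imp_surj_on[OF bij] by (auto simp: map_permutation_def restrict_id_def fun_eq_iff)
    with bij_betw_permutations[OF bij] show ?thesis
      by (intro sum.reindex_bij_betw) simp
  qed
  finally show ?thesis .
qed

text \<open>Expanding both factors gives a sum over triples \<open>\<sigma>\<close>,
  \<open>\<tau>\<close>, \<open>\<rho>\<close>. As \<open>\<tau>\<close> and \<open>\<rho>\<close>
  act on disjoint blocks, passing to \<open>\<sigma> \<circ> (\<tau> \<circ> \<rho>)\<close> shows
  that every pair \<open>\<tau>\<close>, \<open>\<rho>\<close> contributes the same sum
  \<open>T\<close>, the Leibniz formula for \<open>I @ J\<close>. The number of pairs cancels the
  factorials in the definition of the wedge.\<close>

lemma wedge_coord_covec:
  fixes \<alpha> \<beta> :: "(real^'n) form"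
  assumes \<alpha>: "\<alpha> x = coord_covec I" and \<beta>: "\<beta> x = coord_covec J"
  shows "(\<alpha> \<^bold>\<and> \<beta>) x = coord_covec (I @ J)"
proof
  fix vs :: "(real^'n) list"
  let ?p = "length I" and ?n = "length vs" and ?q = "length J"
  let ?S = "{\<sigma>. \<sigma> permutes {..<?n}}"
  let ?f = "\<lambda>\<sigma> p. of_int (sign \<sigma>) / (fact p * fact (?n - p)) *
     coord_covec I (map (\<lambda>i. vs ! \<sigma> i) [0..<p]) * coord_covec J (map (\<lambda>i. vs ! \<sigma> i) [p..<?n])"
  have w: "(\<alpha> \<^bold>\<and> \<beta>) x vs = (\<Sum>p\<le>?n. \<Sum>\<sigma>\<in>?S. ?f \<sigma> p)"
    by (simp add: wedge_def \<alpha> \<beta>)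
  show "(\<alpha> \<^bold>\<and> \<beta>) x vs = coord_covec (I @ J) vs"
  proof (cases "?n = ?p + ?q")
    case False
    have "?f \<sigma> p = 0" if "p \<le> ?n" for \<sigma> p
    proof (cases "p = ?p")
      case True
      with that False have "length (map (\<lambda>i. vs ! \<sigma> i) [p..<?n]) \<noteq> ?q" by auto
      then show ?thesis by (simp add: coord_covec_length)
    qed (simp add: coord_covec_length)
    then have "(\<alpha> \<^bold>\<and> \<beta>) x vs = 0"
      unfolding w by (intro sum.neutral ballI) auto
    then show ?thesis using False by (simp add: coord_covec_length)
  next
    case True
    let ?c = "fact ?p * fact ?q :: real"
    define P where "P = (\<lambda>\<sigma>. \<Prod>i<?p. vs ! \<sigma> i $ (I ! i))"
    define R where "R = (\<lambda>\<sigma>. \<Prod>i\<in>{?p..<?n}. vs ! \<sigma> i $ (J ! (i - ?p)))"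
    define T where "T = (\<Sum>\<sigma>\<in>?S. of_int (sign \<sigma>) * P \<sigma> * R \<sigma>)"
    \<comment> \<open>Only the splitting point that matches the degree of the first factor
      contributes.\<close>
    have "(\<alpha> \<^bold>\<and> \<beta>) x vs = (\<Sum>p\<le>?n. if p = ?p then \<Sum>\<sigma>\<in>?S. ?f \<sigma> ?p else 0)"
      unfolding w by (intro sum.cong) (auto intro!: sum.neutral simp: coord_covec_length)
    also have "\<dots> = (\<Sum>\<sigma>\<in>?S. ?f \<sigma> ?p)"
      using True by (simp add: sum.delta)
    also have "\<dots> = (\<Sum>\<sigma>\<in>?S. of_int (sign \<sigma>) *
        coord_covec I (map (\<lambda>i. vs ! \<sigma> i) [0..<?p]) * coord_covec J (map (\<lambda>i. vs ! \<sigma> i) [?p..<?n])) / ?c"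
      using True by (simp add: sum_divide_distrib)
    also have "(\<Sum>\<sigma>\<in>?S. of_int (sign \<sigma>) *
        coord_covec I (map (\<lambda>i. vs ! \<sigma> i) [0..<?p]) * coord_covec J (map (\<lambda>i. vs ! \<sigma> i) [?p..<?n]))
      = (\<Sum>\<sigma>\<in>?S. \<Sum>\<tau> | \<tau> permutes {..<?p}. \<Sum>\<rho> | \<rho> permutes {?p..<?n}.
          of_int (sign \<sigma>) * (of_int (sign \<tau>) * P (\<sigma> \<circ> \<tau>)) * (of_int (sign \<rho>) * R (\<sigma> \<circ> \<rho>)))"
    proof (rule sum.cong[OF refl])
      fix \<sigma> assume "\<sigma> \<in> ?S"
      have *: "\<tau> i < ?p" if "\<tau> permutes {..<?p}" "i < ?p" for \<tau> i
        using permutes_in_image[OF that(1), of i] that(2) by simp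
      have "coord_covec I (map (\<lambda>i. vs ! \<sigma> i) [0..<?p]) =
          (\<Sum>\<tau> | \<tau> permutes {..<?p}. of_int (sign \<tau>) * P (\<sigma> \<circ> \<tau>))"
        by (subst coord_covec_leibniz) (auto simp: P_def * intro!: sum.cong prod.cong)
      moreover have "coord_covec J (map (\<lambda>i. vs ! \<sigma> i) [?p..<?n]) =
          (\<Sum>\<rho> | \<rho> permutes {?p..<?n}. of_int (sign \<rho>) * R (\<sigma> \<circ> \<rho>))"
        by (subst coord_covec_leibniz_tail[OF True]) (simp add: R_def)
      ultimately show "of_int (sign \<sigma>) * coord_covec I (map (\<lambda>i. vs ! \<sigma> i) [0..<?p]) *
          coord_covec J (map (\<lambda>i. vs ! \<sigma> i) [?p..<?n]) =
        (\<Sum>\<tau> | \<tau> permutes {..<?p}. \<Sum>\<rho> | \<rho> permutes {?p..<?n}.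
          of_int (sign \<sigma>) * (of_int (sign \<tau>) * P (\<sigma> \<circ> \<tau>)) * (of_int (sign \<rho>) * R (\<sigma> \<circ> \<rho>)))"
        by (simp add: sum_distrib_left sum_distrib_right mult.assoc)
          (rule sum.swap)
    qed
    also have "\<dots> = (\<Sum>\<tau> | \<tau> permutes {..<?p}. \<Sum>\<rho> | \<rho> permutes {?p..<?n}. \<Sum>\<sigma>\<in>?S.
          of_int (sign \<sigma>) * (of_int (sign \<tau>) * P (\<sigma> \<circ> \<tau>)) * (of_int (sign \<rho>) * R (\<sigma> \<circ> \<rho>)))"
      by (subst sum.swap, rule sum.cong[OF refl], rule sum.swap)
    also have "\<dots> = (\<Sum>\<tau> | \<tau> permutes {..<?p}. \<Sum>\<rho> | \<rho> permutes {?p..<?n}. T)"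
    proof (intro sum.cong refl)
      fix \<tau> \<rho> assume "\<tau> \<in> {\<tau>. \<tau> permutes {..<?p}}" "\<rho> \<in> {\<rho>. \<rho> permutes {?p..<?n}}"
      then have \<tau>: "\<tau> permutes {..<?p}" and \<rho>: "\<rho> permutes {?p..<?n}" by auto
      have \<tau>n: "\<tau> permutes {..<?n}" and \<rho>n: "\<rho> permutes {..<?n}"
        using True by (auto intro: permutes_subset[OF \<tau>] permutes_subset[OF \<rho>])
      have perm: "permutation \<sigma>" if "\<sigma> permutes {..<?n}" for \<sigma>
        using that by (auto intro: permutes_imp_permutation[of "{..<?n}"])
      have \<tau>\<rho>: "\<tau> \<circ> \<rho> permutes {..<?n}"
        using \<tau>n \<rho>n by (rule permutes_compose[rotated])
      have sgn: "sign (\<sigma> \<circ> (\<tau> \<circ> \<rho>)) = sign \<sigma> * sign \<tau> * sign \<rho>" if "\<sigma> permutes {..<?n}" for \<sigma>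
        using that \<tau>n \<rho>n \<tau>\<rho> by (simp add: sign_compose perm)
      have P1: "P (\<sigma> \<circ> (\<tau> \<circ> \<rho>)) = P (\<sigma> \<circ> \<tau>)" for \<sigma>
        unfolding P_def using permutes_not_in[OF \<rho>] by (intro prod.cong) auto
      have R1: "R (\<sigma> \<circ> (\<tau> \<circ> \<rho>)) = R (\<sigma> \<circ> \<rho>)" for \<sigma>
        unfolding R_def
      proof (rule prod.cong[OF refl])
        fix i assume i: "i \<in> {?p..<?n}"
        then have "\<rho> i \<in> {?p..<?n}"
          using permutes_in_image[OF \<rho>] by blast
        then have "\<tau> (\<rho> i) = \<rho> i" using permutes_not_in[OF \<tau>, of "\<rho> i"] by auto
        then show "vs ! (\<sigma> \<circ> (\<tau> \<circ> \<rho>)) i $ (J ! (i - ?p)) = vs ! (\<sigma> \<circ> \<rho>) i $ (J ! (i - ?p))" by simp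
      qed
      have "T = (\<Sum>\<sigma>\<in>?S. of_int (sign (\<sigma> \<circ> (\<tau> \<circ> \<rho>))) * P (\<sigma> \<circ> (\<tau> \<circ> \<rho>)) * R (\<sigma> \<circ> (\<tau> \<circ> \<rho>)))"
        unfolding T_def by (rule sum_permutations_compose_right[OF \<tau>\<rho>])
      also have "\<dots> = (\<Sum>\<sigma>\<in>?S.
          of_int (sign \<sigma>) * (of_int (sign \<tau>) * P (\<sigma> \<circ> \<tau>)) * (of_int (sign \<rho>) * R (\<sigma> \<circ> \<rho>)))"
        by (intro sum.cong) (auto simp: sgn P1 R1)
      finally show "(\<Sum>\<sigma>\<in>?S.
          of_int (sign \<sigma>) * (of_int (sign \<tau>) * P (\<sigma> \<circ> \<tau>)) * (of_int (sign \<rho>) * R (\<sigma> \<circ> \<rho>))) = T" ..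
    qed
    also have "\<dots> = ?c * T"
      using True by (simp add: card_permutations[of _ ?p] card_permutations[of _ ?q])
    also have "T = coord_covec (I @ J) vs"
    proof -
      have "P \<sigma> * R \<sigma> = (\<Prod>i<?n. vs ! \<sigma> i $ ((I @ J) ! i))" for \<sigma>
      proof -
        have "{..<?n} = {..<?p} \<union> {?p..<?n}" using True by auto
        then have "(\<Prod>i<?n. vs ! \<sigma> i $ ((I @ J) ! i)) =
          (\<Prod>i<?p. vs ! \<sigma> i $ ((I @ J) ! i)) * (\<Prod>i\<in>{?p..<?n}. vs ! \<sigma> i $ ((I @ J) ! i))"
          by (simp add: prod.union_disjoint ivl_disj_int)
        then show ?thesis by (simp add: P_def R_def nth_append)
      qed
      then show ?thesis
        using True by (simp add: T_def coord_covec_leibniz mult.assoc)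
    qed
    finally show ?thesis by simp
  qed
qed

lemma wedge_cong: "\<alpha> x = \<alpha>' x \<Longrightarrow> \<beta> x = \<beta>' x \<Longrightarrow> (\<alpha> \<^bold>\<and> \<beta>) x = (\<alpha>' \<^bold>\<and> \<beta>') x"
  by (simp add: wedge_def fun_eq_iff)

lemma wedge_add_left:
  "((\<lambda>x vs. c * \<alpha> x vs + \<gamma> x vs) \<^bold>\<and> \<beta>) x vs = c * (\<alpha> \<^bold>\<and> \<beta>) x vs + (\<gamma> \<^bold>\<and> \<beta>) x vs"
  by (simp add: wedge_def sum_distrib_left sum.distrib algebra_simps)

lemma wedge_add_right:
  "(\<alpha> \<^bold>\<and> (\<lambda>x vs. c * \<beta> x vs + \<gamma> x vs)) x vs = c * (\<alpha> \<^bold>\<and> \<beta>) x vs + (\<alpha> \<^bold>\<and> \<gamma>) x vs"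
  by (simp add: wedge_def sum_distrib_left sum.distrib algebra_simps)

section \<open>Symbolic linear combinations of coordinate covectors\<close>

definition lin_covec :: "(real \<times> 'n list) list \<Rightarrow> (real^'n) covec" where
  "lin_covec P vs = (\<Sum>(c, I)\<leftarrow>P. c * coord_covec I vs)"

lemma lin_covec_Nil [simp]: "lin_covec [] = (\<lambda>vs. 0)"
  and lin_covec_Cons: "lin_covec ((c, I) # P) = (\<lambda>vs. c * coord_covec I vs + lin_covec P vs)"
  and lin_covec_append: "lin_covec (P @ Q) vs = lin_covec P vs + lin_covec Q vs"
  by (simp_all add: lin_covec_def fun_eq_iff)

lemma lin_covec_scale:
  "lin_covec (map (\<lambda>(d, J). (c * d, f J)) Q) vs = c * lin_covec (map (\<lambda>(d, J). (d, f J)) Q) vs"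
  by (induction Q) (auto simp: lin_covec_Cons algebra_simps)

definition wedge_list :: "(real \<times> 'n list) list \<Rightarrow> (real \<times> 'n list) list \<Rightarrow> (real \<times> 'n list) list" where
  "wedge_list P Q = concat (map (\<lambda>(c, I). map (\<lambda>(d, J). (c * d, I @ J)) Q) P)"

lemma wedge_lin_covec:
  fixes \<alpha> \<beta> :: "(real^'n) form"
  assumes "\<alpha> x = lin_covec P" and "\<beta> x = lin_covec Q"
  shows "(\<alpha> \<^bold>\<and> \<beta>) x = lin_covec (wedge_list P Q)"
proof -
  have 1: "((\<lambda>_. coord_covec I) \<^bold>\<and> (\<lambda>_. lin_covec Q)) x vs =
      lin_covec (map (\<lambda>(d, J). (d, I @ J)) Q) vs" for I and vs :: "(real^'n) list"
  proof (induction Q)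
    case Nil
    show ?case by (simp add: wedge_def)
  next
    case (Cons q Q)
    obtain d J where "q = (d, J)" by force
    with Cons show ?case
      by (simp add: lin_covec_Cons wedge_add_right wedge_coord_covec[of _ _ I _ J])
  qed
  have 2: "((\<lambda>_. lin_covec P) \<^bold>\<and> (\<lambda>_. lin_covec Q)) x vs = lin_covec (wedge_list P Q) vs" for vs
  proof (induction P)
    case Nil
    show ?case by (simp add: wedge_def wedge_list_def)
  next
    case (Cons q P)
    obtain c I where "q = (c, I)" by force
    with Cons show ?case
      by (simp add: lin_covec_Cons wedge_add_left 1 wedge_list_def lin_covec_append lin_covec_scale)
  qed
  show ?thesis
    using assms 2 by (subst wedge_cong[of _ _ "\<lambda>_. lin_covec P" _ "\<lambda>_. lin_covec Q"]) auto
qed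

definition contract_list :: "real^'n \<Rightarrow> (real \<times> 'n list) list \<Rightarrow> (real \<times> 'n list) list" where
  "contract_list u P = concat (map (\<lambda>(c, I).
     map (\<lambda>i. ((-1) ^ i * c * (u $ (I ! i)), drop_nth i I)) [0..<length I]) P)"

lemma contraction_lin_covec:
  assumes "\<alpha> x = lin_covec P"
  shows "contraction u \<alpha> x = lin_covec (contract_list u P)"
proof
  fix vs
  have "lin_covec P (u # vs) = lin_covec (contract_list u P) vs"
  proof (induction P)
    case (Cons q P)
    obtain c I where "q = (c, I)" by force
    with Cons show ?case
      by (simp add: lin_covec_Cons contract_list_def lin_covec_append coord_covec_Cons_vec)
        (simp add: lin_covec_def o_def sum_distrib_left mult_ac sum_list_distinct_conv_sum_set
          lessThan_atLeast0)
  qed (simp add: contract_list_def)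
  with assms show "contraction u \<alpha> x vs = lin_covec (contract_list u P) vs"
    by (simp add: contraction_def)
qed

text \<open>Applied between the two wedge products in dimension 7, this leaves 42 of 147 terms and
  so keeps the second product small.\<close>

lemma lin_covec_filter_distinct:
  "lin_covec (filter (\<lambda>(c, I). distinct I) P) = lin_covec P"
  by (induction P) (auto simp: lin_covec_Cons fun_eq_iff coord_covec_not_distinct)

text \<open>The sign of the permutation that sorts a list by the key \<open>k\<close>, and \<open>0\<close> for lists with repetitions.\<close>

primrec list_sign :: "('a \<Rightarrow> nat) \<Rightarrow> 'a list \<Rightarrow> real" where
  "list_sign k [] = 1"
| "list_sign k (a # I) =
    (if a \<in> set I then 0 else (-1) ^ length (filter (\<lambda>b. k b < k a) I) * list_sign k I)"

lemma list_sign_not_distinct: "\<not> distinct I \<Longrightarrow> list_sign k I = 0"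
  by (induction I) auto

text \<open>Insertion carries \<open>a\<close> past each entry of smaller key by one transposition
  of neighbours; sortedness makes these entries an initial segment.\<close>

lemma coord_covec_insort_key:
  assumes "sorted (map k S)"
  shows "coord_covec (a # S) vs =
    (-1) ^ length (filter (\<lambda>b. k b < k a) S) * coord_covec (insort_key k a S) vs"
  using assms
proof (induction S arbitrary: vs)
  case (Cons b S)
  show ?case
  proof (cases "k a \<le> k b")
    case True
    with Cons.prems have "filter (\<lambda>c. k c < k a) (b # S) = []"
      by (auto simp: filter_empty_conv)
    with True show ?thesis by (simp only: list.size) simp
  next
    case False
    have "coord_covec (a # b # S) vs = - coord_covec (b # a # S) vs"
      by (rule coord_covec_swap_head)
    also have "coord_covec (b # a # S) vs =
        (-1) ^ length (filter (\<lambda>b. k b < k a) S) * coord_covec (b # insort_key k a S) vs"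
      using Cons by (intro coord_covec_Cons_cong) auto
    finally show ?thesis using False by simp
  qed
qed simp

lemma coord_covec_sort:
  "coord_covec I vs = list_sign k I * coord_covec (sort_key k I) vs"
proof (induction I arbitrary: vs)
  case (Cons a I)
  show ?case
  proof (cases "a \<in> set I")
    case True
    then show ?thesis by (simp add: coord_covec_not_distinct)
  next
    case False
    have "length (filter (\<lambda>b. k b < k a) (sort_key k I)) = length (filter (\<lambda>b. k b < k a) I)"
      by (metis mset_filter mset_sort size_mset)
    moreover have "coord_covec (a # I) vs = list_sign k I * coord_covec (a # sort_key k I) vs"
      by (intro coord_covec_Cons_cong Cons)
    ultimately show ?thesis
      using False coord_covec_insort_key[of k "sort_key k I" a vs] by simp
  qed
qed simp

text \<open>An index list of full length either repeats an entry or enumerates all indices, and in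
  the second case sorting by an injective key yields \<open>idx\<close>.\<close>

lemma coord_covec_top:
  fixes idx K :: "'n::finite list"
  assumes k: "inj k" and idx: "sorted (map k idx)" "distinct idx" "set idx = UNIV"
    and K: "length K = CARD('n)"
  shows "coord_covec K vs = list_sign k K * coord_covec idx vs"
proof (cases "distinct K")
  case True
  then have "set K = UNIV"
    using K by (simp add: card_subset_eq distinct_card)
  then have "map k (sort_key k K) = map k idx"
    using True idx k by (intro sorted_distinct_set_unique) (auto simp: distinct_map inj_on_def inj_def)
  then have "sort_key k K = idx"
    using k by (simp add: inj_map_eq_map)
  then show ?thesis using coord_covec_sort[of K vs k] by simp
qed (simp add: coord_covec_not_distinct list_sign_not_distinct)

text \<open>Top-degree covectors form a line, so their identities become identities between real
  coefficients that can be evaluated by rewriting.\<close>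

lemma lin_covec_top:
  fixes idx :: "'n::finite list"
  assumes k: "inj k" and idx: "sorted (map k idx)" "distinct idx" "set idx = UNIV"
    and P: "list_all (\<lambda>(c, K). length K = CARD('n)) P"
  shows "lin_covec P vs = (\<Sum>(c, K)\<leftarrow>P. c * list_sign k K) * coord_covec idx vs"
  using P
proof (induction P)
  case (Cons q P)
  then show ?case
    using coord_covec_top[OF k idx, of "snd q" vs]
    by (cases q) (simp add: lin_covec_Cons algebra_simps)
qed simp

section \<open>Diagonal metrics\<close>

definition diag_inner :: "('n \<Rightarrow> real) \<Rightarrow> real^'n \<Rightarrow> real^'n \<Rightarrow> real" where
  "diag_inner G u v = (\<Sum>a\<in>UNIV. G a * u $ a * v $ a)"

lemma diag_inner_axis:
  "diag_inner G (axis a c) (axis b d) = (if a = b then G a * c * d else 0)"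
  by (simp add: diag_inner_def axis_def if_distrib[of "\<lambda>x. _ * x"] cong: if_cong)

lemma inner_product_diag_inner:
  assumes "\<And>a. G a > 0" shows "inner_product (diag_inner G)"
  unfolding inner_product_def
proof (intro conjI allI impI)
  show "linear (diag_inner G u)" for u
    by (intro linearI)
      (auto simp: diag_inner_def algebra_simps sum.distrib sum_distrib_left intro!: sum.cong)
  show "diag_inner G u v = diag_inner G v u" for u v
    by (auto simp: diag_inner_def mult_ac)
  fix u :: "real^'a" assume "u \<noteq> 0"
  then obtain a where a: "u $ a \<noteq> 0" by (auto simp: vec_eq_iff)
  have "0 < G a * u $ a * u $ a" using assms a by (simp add: mult.assoc flip: power2_eq_square)
  also have "\<dots> \<le> diag_inner G u u"
    unfolding diag_inner_def
    by (rule member_le_sum) (use assms in \<open>auto simp: mult.assoc less_imp_le\<close>)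
  finally show "0 < diag_inner G u u" .
qed

lemma diag_inner_scale: "diag_inner G (c *\<^sub>R u) (d *\<^sub>R v) = c * d * diag_inner G u v"
  by (auto simp: diag_inner_def sum_distrib_left mult_ac)

lemma coord_covec_scale:
  "coord_covec I (map (\<lambda>v. c *\<^sub>R v) vs) = c ^ length vs * coord_covec I vs"
proof (cases "length vs = length I")
  case True
  have *: "p i < length I" if "p permutes {..<length I}" "i < length I" for p i
    using permutes_in_image[OF that(1), of i] that(2) by simp
  show ?thesis
    using True
    by (auto simp: coord_covec_leibniz * prod.distrib sum_distrib_left mult_ac intro!: sum.cong)
qed (simp add: coord_covec_length)

text \<open>For the matrix \<open>M\<close> of the frame and \<open>D = diag G\<close>,
  orthonormality says that \<open>M\<close> transposed times \<open>D\<close> times \<open>M\<close>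
  is the identity; the claim is the determinant of this equation.\<close>

lemma coord_covec_orthonormal:
  fixes es :: "(real^'n) list"
  assumes idx: "distinct idx" "set idx = (UNIV :: 'n::finite set)"
    and len: "length es = CARD('n)"
    and on: "\<forall>i<CARD('n). \<forall>j<CARD('n). diag_inner G (es ! i) (es ! j) = (if i = j then 1 else 0)"
  shows "(\<Prod>a\<in>UNIV. G a) * (coord_covec idx es)\<^sup>2 = 1"
proof -
  let ?n = "CARD('n)"
  have n: "length idx = ?n" using idx distinct_card by metis
  have bij: "bij_betw ((!) idx) {..<?n} UNIV"
    using bij_betw_nth[of idx "{..<?n}" UNIV] idx n by simp
  define M where "M = Matrix.mat ?n ?n (\<lambda>(i, j). es ! j $ (idx ! i))"
  define D where "D = Matrix.mat ?n ?n (\<lambda>(i, j). if i = j then G (idx ! i) else 0)"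
  have M [simp]: "M \<in> carrier_mat ?n ?n" and D [simp]: "D \<in> carrier_mat ?n ?n"
    and dims [simp]: "dim_row M = ?n" "dim_col M = ?n" "dim_row D = ?n" "dim_col D = ?n"
    by (auto simp: M_def D_def)
  have M_nth: "M $$ (i, j) = es ! j $ (idx ! i)" if "i < ?n" "j < ?n" for i j
    using that by (simp add: M_def)
  have "transpose_mat M * (D * M) = 1\<^sub>m ?n"
  proof (rule eq_matI)
    fix i j assume "i < dim_row (1\<^sub>m ?n :: real mat)" "j < dim_col (1\<^sub>m ?n :: real mat)"
    then have ij: "i < ?n" "j < ?n" by auto
    have DM: "(D * M) $$ (k, j) = G (idx ! k) * es ! j $ (idx ! k)" if "k < ?n" for k
    proof -
      have "(D * M) $$ (k, j) = (\<Sum>l<?n. (if k = l then G (idx ! k) else 0) * es ! j $ (idx ! l))"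
        using that ij by (simp add: scalar_prod_def lessThan_atLeast0 M_nth) (simp add: D_def)
      also have "\<dots> = (\<Sum>l<?n. if l = k then G (idx ! k) * es ! j $ (idx ! k) else 0)"
        by (intro sum.cong) auto
      finally show ?thesis using that by simp
    qed
    have "(transpose_mat M * (D * M)) $$ (i, j) =
        (\<Sum>k<?n. es ! i $ (idx ! k) * (D * M) $$ (k, j))"
      using ij by (subst index_mult_mat(1))
        (auto simp: scalar_prod_def lessThan_atLeast0 M_nth simp del: index_mult_mat(1) intro!: sum.cong)
    also have "\<dots> = (\<Sum>k<?n. G (idx ! k) * es ! i $ (idx ! k) * es ! j $ (idx ! k))"
      by (intro sum.cong) (simp_all add: DM mult_ac)
    also have "\<dots> = diag_inner G (es ! i) (es ! j)"
      unfolding diag_inner_def by (rule sum.reindex_bij_betw[OF bij])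
    finally show "(transpose_mat M * (D * M)) $$ (i, j) = 1\<^sub>m ?n $$ (i, j)"
      using on ij by simp
  qed simp_all
  then have "Determinant.det (transpose_mat M * (D * M)) = 1" by simp
  moreover have "Determinant.det (transpose_mat M * (D * M)) =
      Determinant.det M * (Determinant.det D * Determinant.det M)"
    using det_mult[of "transpose_mat M" ?n "D * M"] det_mult[of D ?n M] det_transpose[OF M] M D
    by simp
  moreover have "Determinant.det D = (\<Prod>a\<in>UNIV. G a)"
  proof -
    have "Determinant.det D = (\<Prod>i<?n. G (idx ! i))"
      by (subst det_upper_triangular[of _ ?n])
        (auto simp: D_def upper_triangular_def diag_mat_def prod.list_conv_set_nth lessThan_atLeast0
          intro!: prod.cong)
    also have "\<dots> = (\<Prod>a\<in>UNIV. G a)"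
      by (rule prod.reindex_bij_betw[OF bij])
    finally show ?thesis .
  qed
  moreover have "coord_covec idx es = Determinant.det M"
    using n len by (simp add: coord_covec_def M_def)
  ultimately show ?thesis by (simp add: power2_eq_square mult_ac)
qed

text \<open>For uniqueness, a competing pair is proportional to the given one, with a factor
  \<open>l\<close> that is positive by definiteness. An orthonormal frame scaled by
  \<open>1 / sqrt l\<close> is orthonormal for the competitor; comparing volumes gives
  \<open>l * (sqrt l) ^ n = 1\<close> with \<open>n\<close> the dimension, which forces
  \<open>l = 1\<close>.\<close>

lemma metric_of_diag:
  fixes idx :: "'n::finite list" and G :: "'n \<Rightarrow> real"
  assumes idx: "distinct idx" "set idx = UNIV"
    and G: "\<And>a. G a > 0" and s: "s\<^sup>2 = (\<Prod>a\<in>UNIV. G a)"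
    and B: "\<And>u v vs. B u v vs = diag_inner G u v * (s * coord_covec idx vs)"
  shows "metric_of B = (diag_inner G, \<lambda>vs. s * coord_covec idx vs)"
  unfolding metric_of_def
proof (rule the_equality)
  let ?m = "\<lambda>vs. s * coord_covec idx vs"
  have n: "length idx = CARD('n)" using idx distinct_card by metis
  have vol: "\<bar>?m es\<bar> = 1" if "length es = CARD('n)" and
    "\<forall>i<CARD('n). \<forall>j<CARD('n). diag_inner G (es ! i) (es ! j) = (if i = j then 1 else 0)" for es
  proof -
    have "(?m es)\<^sup>2 = 1"
      using coord_covec_orthonormal[OF idx that] s by (simp add: power_mult_distrib)
    then show ?thesis by (simp add: abs_square_eq_1)
  qed
  have alt: "alternating CARD('n) ?m"
    using alternating_coord_covec[of idx] n unfolding alternating_def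
    by (auto simp: linear_iff algebra_simps)
  show "case (diag_inner G, ?m) of (g, m) \<Rightarrow> inner_product g \<and> volume_element g m \<and>
      (\<forall>u v vs. g u v * m vs = B u v vs)"
    using inner_product_diag_inner[OF G] vol alt B by (auto simp: volume_element_def)
  fix gm assume gm: "case gm of (g, m) \<Rightarrow> inner_product g \<and> volume_element g m \<and>
      (\<forall>u v vs. g u v * m vs = B u v vs)"
  obtain g m where gm_eq: "gm = (g, m)" by force
  have ip: "inner_product g" and ve: "volume_element g m"
    and eq: "\<And>u v vs. g u v * m vs = diag_inner G u v * ?m vs"
    using gm B by (auto simp: gm_eq)
  define es where "es = map (\<lambda>a. axis a (1 / sqrt (G a))) idx"
  have es: "length es = CARD('n)" by (simp add: es_def n)
  have on: "diag_inner G (es ! i) (es ! j) = (if i = j then 1 else 0)"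
    if "i < CARD('n)" "j < CARD('n)" for i j
    using that n idx G[of "idx ! i"] less_imp_le[OF G[of "idx ! i"]]
    by (auto simp: es_def diag_inner_axis nth_eq_iff_index_eq)
  have mes: "\<bar>?m es\<bar> = 1"
    using vol[OF es] on by blast
  define u :: "real^'n" where "u = axis undefined 1"
  have u: "u \<noteq> 0" by (simp add: u_def axis_eq_0_iff)
  have guu: "g u u > 0" "diag_inner G u u > 0"
    using u ip inner_product_diag_inner[of G, OF G] unfolding inner_product_def by blast+
  have "m es \<noteq> 0"
    using eq[of u u es] guu mes by auto
  define l where "l = ?m es / m es"
  have g_l: "g x y = l * diag_inner G x y" for x y
    using eq[of x y es] \<open>m es \<noteq> 0\<close> by (simp add: l_def field_simps)
  then have l: "l > 0"
    using guu g_l[of u u] by (simp add: zero_less_mult_iff)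
  have m_l: "?m vs = l * m vs" for vs
    using eq[of u u vs] g_l[of u u] guu by simp
  define fs where "fs = map (\<lambda>v. (1 / sqrt l) *\<^sub>R v) es"
  have "g (fs ! i) (fs ! j) = (if i = j then 1 else 0)" if "i < CARD('n)" "j < CARD('n)" for i j
    using that es on l by (auto simp: fs_def g_l diag_inner_scale)
  then have "\<bar>m fs\<bar> = 1"
    using ve es unfolding volume_element_def by (simp add: fs_def)
  moreover have "?m fs = (1 / sqrt l) ^ CARD('n) * ?m es"
    using es by (simp add: fs_def coord_covec_scale)
  then have "\<bar>?m fs\<bar> = (1 / sqrt l) ^ CARD('n)"
    using mes l by (simp only: abs_mult[of "(1 / sqrt l) ^ CARD('n)"]) simp
  ultimately have "(1 / sqrt l) ^ CARD('n) = l"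
    using m_l[of fs] l by (simp add: abs_mult)
  then have l1: "l * (sqrt l) ^ CARD('n) = 1"
    using l by (simp add: field_simps)
  have "l = 1"
  proof (rule ccontr)
    assume "l \<noteq> 1"
    then consider "l < 1" | "l > 1" by linarith
    then show False
    proof cases
      case 1
      then have "(sqrt l) ^ CARD('n) \<le> 1" using l by (simp add: power_le_one)
      with 1 l have "l * (sqrt l) ^ CARD('n) \<le> l * 1" by (intro mult_left_mono) auto
      with l1 1 show False by simp
    next
      case 2
      then have "(sqrt l) ^ CARD('n) \<ge> 1" using l by (simp add: one_le_power)
      with 2 l have "l * (sqrt l) ^ CARD('n) \<ge> l * 1" by (intro mult_left_mono) auto
      with l1 2 show False by simp
    qed
  qed
  then show "gm = (diag_inner G, ?m)"
    using g_l m_l by (auto simp: gm_eq fun_eq_iff)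
qed

section \<open>Inverse Gram matrices and the Hodge star\<close>

lemma matrix_inv_eq:
  fixes A B :: "real^'n^'n"
  assumes "A ** B = Finite_Cartesian_Product.mat 1" "B ** A = Finite_Cartesian_Product.mat 1" shows "matrix_inv A = B"
proof -
  have "A ** matrix_inv A = Finite_Cartesian_Product.mat 1 \<and> matrix_inv A ** A = Finite_Cartesian_Product.mat 1"
    unfolding matrix_inv_def by (rule someI[of _ B]) (use assms in simp)
  then have *: "A ** matrix_inv A = Finite_Cartesian_Product.mat 1" by blast
  have "matrix_inv A = (B ** A) ** matrix_inv A"
    by (simp only: assms matrix_mul_lid)
  also have "\<dots> = B"
    by (simp only: matrix_mul_assoc[symmetric] * matrix_mul_rid)
  finally show ?thesis .
qed

lemma diag_matrix_mult:
  fixes f g :: "'n::finite \<Rightarrow> real"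
  shows "(\<chi> i j. if i = j then f i else 0) ** (\<chi> i j. if i = j then g i else 0) =
    (\<chi> i j. if i = j then f i * g i else 0)"
proof -
  have *: "(\<Sum>k\<in>UNIV. (if i = k then f i else 0) * (if k = j then g k else 0)) =
      (if i = j then f i * g i else 0)" for i j
  proof -
    have "(\<Sum>k\<in>UNIV. (if i = k then f i else 0) * (if k = j then g k else 0)) =
        (\<Sum>k\<in>UNIV. if k = i then (if i = j then f i * g i else 0) else 0)"
      by (rule sum.cong) auto
    then show ?thesis by (simp only: sum.delta finite_class.finite_UNIV UNIV_I if_True)
  qed
  show ?thesis
    by (simp only: matrix_matrix_mult_def vec_eq_iff vec_lambda_beta *) simp
qed

lemma matrix_inv_diag:
  fixes f :: "'n::finite \<Rightarrow> real"
  assumes "\<And>i. f i \<noteq> 0"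
  shows "matrix_inv (\<chi> i j. if i = j then f i else 0) = (\<chi> i j. if i = j then 1 / f i else 0)"
proof (rule matrix_inv_eq)
  have *: "f i * (1 / f i) = 1" "1 / f i * f i = 1" for i using assms[of i] by simp_all
  show "(\<chi> i j. if i = j then f i else 0) ** (\<chi> i j. if i = j then 1 / f i else 0) =
      Finite_Cartesian_Product.mat 1"
    and "(\<chi> i j. if i = j then 1 / f i else 0) ** (\<chi> i j. if i = j then f i else 0) =
      Finite_Cartesian_Product.mat 1"
    unfolding diag_matrix_mult Finite_Cartesian_Product.mat_def * by (rule refl)+
qed

lemma inverse_gram_diag:
  fixes G :: "'n::finite \<Rightarrow> real"
  assumes "\<And>a. G a > 0"
  shows "inverse_gram (diag_inner G) = (\<chi> i j. if i = j then 1 / G i else 0)"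
proof -
  have *: "(\<chi> i j. diag_inner G (axis i 1) (axis j 1)) = (\<chi> i j. if i = j then G i else 0)"
    by (simp only: diag_inner_axis vec_eq_iff vec_lambda_beta mult_1_right) simp
  have "G a \<noteq> 0" for a using assms[of a] by simp
  then show ?thesis
    unfolding inverse_gram_def * by (rule matrix_inv_diag)
qed

text \<open>Only rearrangements of \<open>I\<close> contribute, and by antisymmetry of
  \<open>F\<close> each term of the Leibniz formula contributes \<open>F I\<close>. The resulting
  factorial cancels the one in \<open>hodge_star\<close>.\<close>

lemma sum_coord_covec_axis:
  fixes F :: "'n::finite list \<Rightarrow> real"
  assumes alt: "\<And>p K. p permutes {..<length I} \<Longrightarrow> length K = length I \<Longrightarrow>
      F (map (\<lambda>i. K ! p i) [0..<length I]) = of_int (sign p) * F K"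
  shows "(\<Sum>K | length K = length I. coord_covec I (map (\<lambda>i. axis i 1) K) * F K) = fact (length I) * F I"
proof -
  let ?n = "length I"
  let ?L = "{K :: 'n list. length K = ?n}"
  have fin: "finite ?L"
    using finite_lists_length_eq[of "UNIV :: 'n set" ?n] by simp
  have "(\<Sum>K\<in>?L. coord_covec I (map (\<lambda>i. axis i 1) K) * F K) =
      (\<Sum>K\<in>?L. \<Sum>p | p permutes {..<?n}. of_int (sign p) * (\<Prod>i<?n. axis (K ! p i) 1 $ (I ! i)) * F K)"
  proof (rule sum.cong[OF refl])
    fix K assume "K \<in> ?L"
    then have K: "length K = ?n" by simp
    have "p i < ?n" if "p permutes {..<?n}" "i < ?n" for p i
      using permutes_in_image[OF that(1), of i] that(2) by simp
    then have "coord_covec I (map (\<lambda>i. axis i 1) K) =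
       (\<Sum>p | p permutes {..<?n}. of_int (sign p) * (\<Prod>i<?n. axis (K ! p i) 1 $ (I ! i)))"
      using K by (subst coord_covec_leibniz) (auto intro!: sum.cong prod.cong)
    then show "coord_covec I (map (\<lambda>i. axis i 1) K) * F K =
       (\<Sum>p | p permutes {..<?n}. of_int (sign p) * (\<Prod>i<?n. axis (K ! p i) 1 $ (I ! i)) * F K)"
      by (simp only: sum_distrib_right)
  qed
  also have "\<dots> = (\<Sum>p | p permutes {..<?n}. \<Sum>K\<in>?L.
      of_int (sign p) * (\<Prod>i<?n. axis (K ! p i) 1 $ (I ! i)) * F K)"
    by (rule sum.swap)
  also have "\<dots> = (\<Sum>p | p permutes {..<?n}. F I)"
  proof (rule sum.cong[OF refl])
    fix p assume "p \<in> {p. p permutes {..<?n}}"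
    then have p: "p permutes {..<?n}" by simp
    let ?q = "Hilbert_Choice.inv p"
    \<comment> \<open>The only index list on which the Leibniz term of \<open>p\<close> does not
      vanish.\<close>
    define K0 where "K0 = map (\<lambda>i. I ! ?q i) [0..<?n]"
    have q: "?q permutes {..<?n}" by (rule permutes_inv[OF p])
    have pn: "p i < ?n" "?q i < ?n" if "i < ?n" for i
      using permutes_in_image[OF p, of i] permutes_in_image[OF q, of i] that by auto
    have *: "(\<Prod>i<?n. axis (K ! p i) 1 $ (I ! i)) = (if K = K0 then 1 else 0 :: real)"
      if "length K = ?n" for K
    proof (cases "K = K0")
      case True
      have "K ! p i = I ! i" if "i < ?n" for i
        using that pn[OF that] permutes_inverses(2)[OF p] by (simp add: True K0_def)
      then have "(\<Prod>i<?n. axis (K ! p i) 1 $ (I ! i)) = (\<Prod>i<?n. 1 :: real)"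
        by (intro prod.cong) (auto simp: axis_def)
      then show ?thesis using True by simp
    next
      case False
      then have "\<exists>j<?n. K ! j \<noteq> K0 ! j"
        using that by (metis K0_def diff_zero length_map length_upt nth_equalityI)
      then obtain j where j: "j < ?n" "K ! j \<noteq> I ! ?q j"
        by (auto simp: K0_def)
      then have "axis (K ! p (?q j)) (1 :: real) $ (I ! ?q j) = 0"
        using permutes_inverses(1)[OF p] by (simp add: axis_def)
      moreover have "?q j \<in> {..<?n}" using pn(2)[OF j(1)] by simp
      ultimately have "(\<Prod>i<?n. axis (K ! p i) (1 :: real) $ (I ! i)) = 0"
        by (intro prod_zero) blast+
      then show ?thesis using False by simp
    qed
    have "K0 \<in> ?L" by (simp add: K0_def)
    have "(\<Sum>K\<in>?L. of_int (sign p) * (\<Prod>i<?n. axis (K ! p i) 1 $ (I ! i)) * F K) =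
        (\<Sum>K\<in>?L. if K = K0 then of_int (sign p) * F K0 else 0)"
      by (intro sum.cong) (auto simp: *)
    also have "\<dots> = of_int (sign p) * F K0"
      using fin \<open>K0 \<in> ?L\<close> by (simp only: sum.delta if_True)
    also have "\<dots> = of_int (sign p) * (of_int (sign ?q) * F I)"
      unfolding K0_def by (subst alt[OF q]) simp_all
    also have "sign ?q = sign p"
      using p by (intro sign_inverse) (auto intro: permutes_imp_permutation[of "{..<?n}"])
    also have "of_int (sign p) * (of_int (sign p) * F I) = F I"
      by (simp add: sign_def)
    finally show "(\<Sum>K\<in>?L. of_int (sign p) * (\<Prod>i<?n. axis (K ! p i) 1 $ (I ! i)) * F K) = F I" .
  qed
  also have "\<dots> = real (card {p. p permutes {..<?n}}) * F I"
    by (rule sum_constant)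
  also have "card {p. p permutes {..<?n}} = fact ?n"
    by (rule card_permutations) auto
  also have "real (fact ?n) * F I = fact ?n * F I"
    by (simp only: of_nat_fact)
  finally show ?thesis .
qed

text \<open>The column of the leading axis has a single nonzero entry, in row 0, so each leading
  axis removes one index.\<close>

lemma coord_covec_axes_append:
  assumes "distinct (I @ J)"
  shows "coord_covec (I @ J) (map (\<lambda>i. axis i 1) I @ vs) = coord_covec J vs"
  using assms
proof (induction I)
  case (Cons a I)
  have "axis a 1 $ ((a # I @ J) ! i) = (if i = 0 then 1 else 0 :: real)"
    if "i < length (a # I @ J)" for i
  proof (cases i)
    case (Suc k)
    with that have "(I @ J) ! k \<in> set (I @ J)" by (intro nth_mem) simp
    with Suc Cons.prems show ?thesis by (auto simp: axis_def)
  qed (simp add: axis_def)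
  then have "coord_covec (a # I @ J) (axis a 1 # map (\<lambda>i. axis i 1) I @ vs) =
    (\<Sum>i<length (a # I @ J). if i = 0 then coord_covec (I @ J) (map (\<lambda>i. axis i 1) I @ vs) else 0)"
    unfolding coord_covec_Cons_vec by (intro sum.cong) auto
  also have "\<dots> = coord_covec (I @ J) (map (\<lambda>i. axis i 1) I @ vs)" by simp
  finally show ?case using Cons by simp
qed simp

text \<open>Each entry of \<open>T\<close> carries, besides its indices \<open>I\<close>, a
  complementary list \<open>J\<close> in an order chosen by the caller; the sign of
  \<open>I @ J\<close> accounts for that choice. The formula is the usual star in orthogonal
  coordinates with volume density \<open>s\<close>.\<close>

lemma hodge_star_diag:
  fixes G :: "'n::finite \<Rightarrow> real" and idx :: "'n list"
  assumes k: "inj k" and idx: "sorted (map k idx)" "distinct idx" "set idx = UNIV"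
    and G: "\<And>a. G a > 0"
    and g: "g x = diag_inner G" and m: "m x = (\<lambda>vs. s * coord_covec idx vs)"
    and \<beta>: "\<beta> x = lin_covec (map (\<lambda>(c, I, J). (c, I)) T)"
    and T: "list_all (\<lambda>(c, I, J). distinct (I @ J) \<and> length (I @ J) = CARD('n)) T"
  shows "hodge_star g m \<beta> x =
    lin_covec (map (\<lambda>(c, I, J). (c * (\<Prod>a\<leftarrow>I. 1 / G a) * s * list_sign k (I @ J), J)) T)"
proof
  fix vs :: "(real^'n) list"
  let ?ax = "map (\<lambda>i. axis i (1 :: real) :: real^'n)"
  let ?r = "\<lambda>I. \<Prod>a\<leftarrow>I. 1 / G a"
  let ?p = "CARD('n) - length vs"
  have n: "length idx = CARD('n)" using idx distinct_card by metis
  have fin: "finite {K :: 'n list. length K = p}" for p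
    using finite_lists_length_eq[of "UNIV :: 'n set" p] by simp
  have ginv: "inverse_gram (g x) $ a $ b = (if a = b then 1 / G a else 0)" for a b
    by (simp only: g inverse_gram_diag[OF G] vec_lambda_beta)
  \<comment> \<open>Raising indices with a diagonal inverse Gram matrix leaves only
    \<open>J = I\<close>.\<close>
  have collapse: "(\<Sum>J | length J = p. (\<Prod>a<p. inverse_gram (g x) $ (I ! a) $ (J ! a)) * A * F J) =
      ?r I * A * F I" if I: "length I = p" for p A and I :: "'n list" and F :: "'n list \<Rightarrow> real"
  proof -
    have "(\<Prod>a<p. inverse_gram (g x) $ (I ! a) $ (J ! a)) = (if J = I then ?r I else 0)"
      if J: "length J = p" for J
    proof (cases "J = I")
      case True
      then show ?thesis using I by (simp add: ginv prod.list_conv_set_nth lessThan_atLeast0)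
    next
      case False
      then obtain a where "a < p" "I ! a \<noteq> J ! a"
        using I J by (auto simp: list_eq_iff_nth_eq)
      then show ?thesis using False by (auto simp: ginv intro!: prod_zero)
    qed
    then have "(\<Sum>J | length J = p. (\<Prod>a<p. inverse_gram (g x) $ (I ! a) $ (J ! a)) * A * F J) =
        (\<Sum>J | length J = p. if J = I then ?r I * A * F I else 0)"
      by (intro sum.cong) auto
    then show ?thesis using I fin by simp
  qed
  show "hodge_star g m \<beta> x vs =
    lin_covec (map (\<lambda>(c, I, J). (c * ?r I * s * list_sign k (I @ J), J)) T) vs"
  proof (cases "length vs \<le> CARD('n)")
    case False
    then have "lin_covec (map (\<lambda>(c, I, J). (c * ?r I * s * list_sign k (I @ J), J)) T) vs = 0"
      using T by (induction T) (auto simp: lin_covec_Cons coord_covec_length)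
    with False show ?thesis by (simp add: hodge_star_def)
  next
    case True
    have "hodge_star g m \<beta> x vs =
        (\<Sum>I | length I = ?p. ?r I * \<beta> x (?ax I) * m x (?ax I @ vs)) / fact ?p"
    proof -
      have "(\<Sum>I | length I = ?p. \<Sum>J | length J = ?p.
            (\<Prod>a<?p. inverse_gram (g x) $ (I ! a) $ (J ! a)) * \<beta> x (?ax I) * m x (?ax J @ vs)) =
          (\<Sum>I | length I = ?p. ?r I * \<beta> x (?ax I) * m x (?ax I @ vs))"
        by (rule sum.cong[OF refl], rule collapse) simp
      with True show ?thesis by (simp add: hodge_star_def Let_def)
    qed
    also have "\<dots> = lin_covec (map (\<lambda>(c, I, J). (c * ?r I * s * list_sign k (I @ J), J)) T) vs"
      using T unfolding \<beta> m
    proof (induction T)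
      case (Cons q T)
      obtain c I J where q: "q = (c, I, J)" by (cases q)
      have IJ: "distinct (I @ J)" "length I + length J = CARD('n)"
        using Cons.prems q by auto
      have "(\<Sum>K | length K = ?p. ?r K * coord_covec I (?ax K) * (s * coord_covec idx (?ax K @ vs))) / fact ?p =
          ?r I * s * list_sign k (I @ J) * coord_covec J vs"
      proof (cases "length I = ?p")
        case False
        then have "(\<Sum>K | length K = ?p. ?r K * coord_covec I (?ax K) * (s * coord_covec idx (?ax K @ vs))) = 0"
          by (intro sum.neutral) (auto simp: coord_covec_length)
        moreover have "length vs \<noteq> length J" using False IJ(2) by auto
        ultimately show ?thesis by (simp add: coord_covec_length)
      next
        case True
        let ?F = "\<lambda>K. ?r K * (s * coord_covec idx (?ax K @ vs))"
        have "(\<Sum>K | length K = length I. coord_covec I (?ax K) * ?F K) = fact (length I) * ?F I"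
        proof (rule sum_coord_covec_axis)
          fix p and K :: "'n list"
          assume p: "p permutes {..<length I}" and K: "length K = length I"
          let ?K = "map (\<lambda>i. K ! p i) [0..<length I]"
          let ?N = "length I + length vs"
          have pn: "p i < length I" if "i < length I" for i
            using permutes_in_image[OF p, of i] that by auto
          have "?r ?K = (\<Prod>i<length I. 1 / G (K ! p i))"
            by (simp add: prod.list_conv_set_nth lessThan_atLeast0)
          also have "\<dots> = (\<Prod>i<length I. 1 / G (K ! i))"
            by (rule prod.reindex_bij_betw[OF permutes_imp_bij[OF p]])
          also have "\<dots> = ?r K"
            using K by (simp add: prod.list_conv_set_nth lessThan_atLeast0)
          finally have 1: "?r ?K = ?r K" .
          have pN: "p permutes {..<?N}"
            by (rule permutes_subset[OF p]) auto
          have "?ax ?K @ vs = map (\<lambda>i. (?ax K @ vs) ! p i) [0..<?N]"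
          proof (rule nth_equalityI)
            fix i assume "i < length (?ax ?K @ vs)"
            then have i: "i < ?N" by simp
            show "(?ax ?K @ vs) ! i = map (\<lambda>i. (?ax K @ vs) ! p i) [0..<?N] ! i"
              using i K pn[of i] permutes_not_in[OF p, of i] by (auto simp: nth_append)
          qed simp
          then have "coord_covec idx (?ax ?K @ vs) = of_int (sign p) * coord_covec idx (?ax K @ vs)"
            using coord_covec_permute_vecs[of p "?ax K @ vs" idx] pN K by simp
          with 1 show "?F ?K = of_int (sign p) * ?F K" by simp
        qed
        moreover have "coord_covec idx (?ax I @ vs) = list_sign k (I @ J) * coord_covec J vs"
        proof -
          have "coord_covec J vs = list_sign k (I @ J) * coord_covec idx (?ax I @ vs)"
            using coord_covec_top[OF k idx, of "I @ J"] IJ coord_covec_axes_append[OF IJ(1), of vs]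
            by simp
          \<comment> \<open>A sign is its own inverse, so \<open>coord_covec_top\<close> can be
            solved for the covector of \<open>idx\<close>.\<close>
          moreover have "list_sign k K * list_sign k K = 1" if "distinct K" for K
            using that by (induction K) (auto simp: power2_eq_square[symmetric] power_mult_distrib minus_one_power_iff)
          ultimately show ?thesis using IJ(1) by (simp flip: mult.assoc)
        qed
        ultimately show ?thesis using True by (simp add: mult_ac)
      qed
      note head = this
      let ?L = "lin_covec (map (\<lambda>(c, I, J). (c, I)) T)"
      have "(\<Sum>K | length K = ?p. ?r K * lin_covec (map (\<lambda>(c, I, J). (c, I)) (q # T)) (?ax K) *
            (s * coord_covec idx (?ax K @ vs))) / fact ?p =
          (\<Sum>K | length K = ?p. c * (?r K * coord_covec I (?ax K) * (s * coord_covec idx (?ax K @ vs))) +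
            ?r K * ?L (?ax K) * (s * coord_covec idx (?ax K @ vs))) / fact ?p"
        by (simp only: q list.map prod.case lin_covec_Cons) (simp only: ring_distribs mult_ac)
      also have "\<dots> = c * ((\<Sum>K | length K = ?p.
            ?r K * coord_covec I (?ax K) * (s * coord_covec idx (?ax K @ vs))) / fact ?p) +
          (\<Sum>K | length K = ?p. ?r K * ?L (?ax K) * (s * coord_covec idx (?ax K @ vs))) / fact ?p"
        by (simp only: sum.distrib sum_distrib_left[symmetric] add_divide_distrib times_divide_eq_right)
      finally show ?case
        using Cons by (simp only: head) (simp add: q lin_covec_Cons)
    qed simp
    finally show ?thesis .
  qed
qed

text \<open>All coefficients depend on the one coordinate \<open>y $ a\<close>, so their derivative
  in direction \<open>h\<close> is a multiple of \<open>h $ a\<close>, and the alternating sum in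
  \<open>ext_deriv\<close> is the expansion \<open>coord_covec_Cons\<close>.\<close>

lemma ext_deriv_lin_covec:
  fixes \<alpha> :: "(real^'n) form"
  assumes \<alpha>: "\<And>y. \<alpha> y = lin_covec (map (\<lambda>(f, I). (f (y $ a), I)) C)"
    and C: "\<And>f I. (f, I) \<in> set C \<Longrightarrow> f differentiable (at (x $ a))"
  shows "ext_deriv \<alpha> x = lin_covec (map (\<lambda>(f, I). (deriv f (x $ a), a # I)) C)"
proof
  fix vs :: "(real^'n) list"
  have D: "((\<lambda>y. \<alpha> y ws) has_derivative
      (\<lambda>h. h $ a * (\<Sum>(f, I)\<leftarrow>C. deriv f (x $ a) * coord_covec I ws))) (at x)" for ws
  proof -
    have "((\<lambda>y. lin_covec (map (\<lambda>(f, I). (f (y $ a), I)) C) ws) has_derivative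
      (\<lambda>h. h $ a * (\<Sum>(f, I)\<leftarrow>C. deriv f (x $ a) * coord_covec I ws))) (at x)"
      using C
    proof (induction C)
      case (Cons q C)
      obtain f I where q: "q = (f, I)" by force
      have "(f has_field_derivative deriv f (x $ a)) (at (x $ a))"
        using Cons.prems q by (metis DERIV_deriv_iff_real_differentiable list.set_intros(1))
      then have "((\<lambda>y. f (y $ a)) has_derivative (\<lambda>h. deriv f (x $ a) * h $ a)) (at x)"
        unfolding has_field_derivative_def
        by (rule has_derivative_compose[rotated])
          (auto intro!: bounded_linear_imp_has_derivative bounded_linear_vec_nth)
      then have "((\<lambda>y. f (y $ a) * coord_covec I ws + lin_covec (map (\<lambda>(f, I). (f (y $ a), I)) C) ws)
          has_derivative (\<lambda>h. (deriv f (x $ a) * h $ a) * coord_covec I ws +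
            h $ a * (\<Sum>(f, I)\<leftarrow>C. deriv f (x $ a) * coord_covec I ws))) (at x)"
        using Cons by (intro has_derivative_add has_derivative_mult_left) auto
      then show ?case
        by (simp add: q lin_covec_Cons algebra_simps)
    qed simp
    then show ?thesis by (simp add: \<alpha>)
  qed
  have "ext_deriv \<alpha> x vs = (\<Sum>i<length vs. (-1) ^ i *
      (vs ! i $ a * (\<Sum>(f, I)\<leftarrow>C. deriv f (x $ a) * coord_covec I (drop_nth i vs))))"
    unfolding ext_deriv_def by (simp add: frechet_derivative_at[OF D, symmetric])
  also have "\<dots> = lin_covec (map (\<lambda>(f, I). (deriv f (x $ a), a # I)) C) vs"
  proof (induction C)
    case (Cons q C)
    then show ?case
      by (cases q) (simp add: lin_covec_Cons coord_covec_Cons algebra_simps sum.distrib sum_distrib_left)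
  qed simp
  finally show "ext_deriv \<alpha> x vs = lin_covec (map (\<lambda>(f, I). (deriv f (x $ a), a # I)) C) vs" .
qed

section \<open>Hypersymplectic structures of simple type\<close>

text \<open>Parametrized by the coefficients rather than the potentials, since metric, torsion and
  star are expressed through the coefficients alone.\<close>

definition simple_triple :: "(3 \<Rightarrow> real \<Rightarrow> real) \<Rightarrow> triple" where
  "simple_triple A i x = lin_covec
     [(A i (x $ 0), [0, spatial i]), (1, [spatial (i + 1), spatial (i + 2)])]"

lemma coord_form_eq: "coord_form i = (\<lambda>x. coord_covec [i])"
proof (intro ext)
  fix x :: "real^'a" and vs :: "(real^'a) list"
  show "coord_form i x vs = coord_covec [i] vs"
  proof (cases "length vs = 1")
    case True
    then show ?thesis by (auto simp: coord_form_def coord_covec_Cons length_Suc_conv)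
  qed (simp add: coord_form_def coord_covec_length)
qed

lemma wedge_coord_form: "(coord_form a \<^bold>\<and> coord_form b) x = coord_covec [a, b]"
  by (subst wedge_coord_covec[of _ _ "[a]" _ "[b]"]) (simp_all add: coord_form_eq)

lemma standard_triple_eq: "standard_triple = simple_triple (\<lambda>i s. 1)"
  by (simp add: fun_eq_iff standard_triple_def simple_triple_def wedge_coord_form lin_covec_Cons)

lemma simple_triple_eq:
  "simple_triple A i = (\<lambda>x vs. A i (x $ 0) * (coord_form 0 \<^bold>\<and> coord_form (spatial i)) x vs +
     (coord_form (spatial (i + 1)) \<^bold>\<and> coord_form (spatial (i + 2))) x vs)"
  by (simp add: fun_eq_iff simple_triple_def wedge_coord_form lin_covec_Cons)

lemma spatial_simps [simp]: "spatial 1 = 1" "spatial 2 = 2" "spatial 3 = 3"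
  by (simp_all add: spatial_def)

text \<open>The shifted indices \<open>3 + 1\<close> and \<open>3 + 2\<close> can surface as the
  numerals 4 and 5, which are 1 and 2 in the type \<open>3\<close>.\<close>

lemma spatial_simps' [simp]: "spatial 4 = 1" "spatial 5 = 2"
proof -
  have "(4 :: 3) = 1" "(5 :: 3) = 2" by simp_all
  then show "spatial 4 = 1" "spatial 5 = 2" by (simp_all only: spatial_simps)
qed

lemma UNIV_4': "(UNIV :: 4 set) = {0, 1, 2, 3}"
  unfolding UNIV_4 by auto

lemma exhaust_4': "(x :: 4) = 0 \<or> x = 1 \<or> x = 2 \<or> x = 3"
  using UNIV_4' by blast

lemma sum_4': "sum f (UNIV :: 4 set) = f 0 + f 1 + f 2 + f 3"
proof -
  have "distinct [0, 1, 2, 3 :: 4]" by simp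
  then have "sum f (set [0, 1, 2, 3 :: 4]) = sum_list (map f [0, 1, 2, 3])"
    by (rule sum.distinct_set_conv_list)
  then show ?thesis by (simp only: UNIV_4' list.set list.map sum_list.Cons sum_list.Nil add.assoc add_0_right)
qed

lemma prod_4': "prod f (UNIV :: 4 set) = f 0 * f 1 * f 2 * f 3"
proof -
  have "distinct [0, 1, 2, 3 :: 4]" by simp
  then have "prod f (set [0, 1, 2, 3 :: 4]) = prod_list (map f [0, 1, 2, 3])"
    by (rule prod.distinct_set_conv_list)
  then show ?thesis by (simp only: UNIV_4' list.set list.map prod_list.Cons prod_list.Nil mult.assoc mult_1_right)
qed

definition pos4 :: "4 \<Rightarrow> nat" where
  "pos4 a = (if a = 0 then 0 else if a = 1 then 1 else if a = 2 then 2 else 3)"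

lemma pos4_simps [simp]: "pos4 0 = 0" "pos4 1 = 1" "pos4 2 = 2" "pos4 3 = 3"
  by (simp_all add: pos4_def)

lemma inj_pos4: "inj pos4"
  using exhaust_4' by (auto simp: pos4_def inj_def split: if_splits)

definition idx4 :: "4 list" where "idx4 = [0, 1, 2, 3]"

lemma idx4: "sorted (map pos4 idx4)" "distinct idx4" "set idx4 = UNIV"
proof -
  show "sorted (map pos4 idx4)" by (simp add: idx4_def)
  show "distinct idx4" by (simp add: idx4_def)
  show "set idx4 = UNIV" by (simp only: idx4_def UNIV_4' list.set)
qed

section \<open>Metric, volume and torsion of a structure of simple type\<close>

definition mean_log :: "(3 \<Rightarrow> real \<Rightarrow> real) \<Rightarrow> real \<Rightarrow> real" where
  "mean_log A s = (ln (A 1 s) + ln (A 2 s) + ln (A 3 s)) / 3"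

text \<open>The geometric mean of the coefficients. Written as the exponential of a mean of
  logarithms it is differentiated without roots.\<close>

definition vol :: "(3 \<Rightarrow> real \<Rightarrow> real) \<Rightarrow> real \<Rightarrow> real" where
  "vol A s = exp (mean_log A s)"

definition log_ratio :: "(3 \<Rightarrow> real \<Rightarrow> real) \<Rightarrow> 3 \<Rightarrow> real \<Rightarrow> real" where
  "log_ratio A i s = ln (A i s) - mean_log A s"

lemma vol_pos [simp]: "vol A s > 0" "vol A s \<noteq> 0"
  by (simp_all add: vol_def)

lemma vol_cube:
  assumes A: "\<And>i. A i s > 0" shows "vol A s ^ 3 = A 1 s * A 2 s * A 3 s"
proof -
  have "vol A s ^ 3 = exp (real 3 * mean_log A s)"
    unfolding vol_def by (rule exp_of_nat_mult[symmetric])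
  also have "real 3 * mean_log A s = ln (A 1 s) + ln (A 2 s) + ln (A 3 s)"
    by (simp add: mean_log_def)
  also have "exp \<dots> = A 1 s * A 2 s * A 3 s"
    by (simp only: exp_add exp_ln[OF A])
  finally show ?thesis .
qed

lemma exp_log_ratio: "A i s > 0 \<Longrightarrow> exp (log_ratio A i s) = A i s / vol A s"
  by (simp add: log_ratio_def vol_def exp_diff)

text \<open>The entries multiply to \<open>V^2 * (A1 * A2 * A3 / V^3) = V^2\<close>, so the volume
  density is \<open>V\<close> itself.\<close>

definition gram4 :: "(3 \<Rightarrow> real \<Rightarrow> real) \<Rightarrow> real \<Rightarrow> 4 \<Rightarrow> real" where
  "gram4 A s a = (if a = 0 then (vol A s)\<^sup>2 else
     (if a = 1 then A 1 s else if a = 2 then A 2 s else A 3 s) / vol A s)"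

lemma gram4_pos:
  assumes A: "\<And>i. A i s > 0" shows "gram4 A s a > 0"
  using A[of 1] A[of 2] A[of 3] by (auto simp: gram4_def)

lemma sum_levi_civita:
  "(\<Sum>i\<in>UNIV. \<Sum>j\<in>UNIV. \<Sum>k\<in>UNIV. levi_civita i j k * F i j k) =
    F 1 2 3 + F 2 3 1 + F 3 1 2 - F 1 3 2 - F 2 1 3 - F 3 2 1"
  by (simp add: sum_3 levi_civita_def)

lemma diag_inner_4:
  "diag_inner G u v = G 0 * u $ 0 * v $ 0 + G 1 * u $ 1 * v $ 1 + G 2 * u $ 2 * v $ 2 + G 3 * u $ 3 * v $ (3 :: 4)"
  by (simp add: diag_inner_def sum_4')

lemma gram4_simps [simp]:
  "gram4 A s 0 = (vol A s)\<^sup>2" "gram4 A s 1 = A 1 s / vol A s"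
  "gram4 A s 2 = A 2 s / vol A s" "gram4 A s 3 = A 3 s / vol A s"
  by (simp_all add: gram4_def)

lemma contraction_simple_triple:
  "contraction w (simple_triple A i) x = lin_covec
     [(A i (x $ 0) * w $ 0, [spatial i]), (- (A i (x $ 0) * w $ spatial i), [0]),
      (w $ spatial (i + 1), [spatial (i + 2)]), (- (w $ spatial (i + 2)), [spatial (i + 1)])]"
  by (subst contraction_lin_covec[of _ _ _ w, OF simple_triple_def]) (simp add: contract_list_def)

lemmas wedge_list_eval = wedge_list_def list.map concat.simps append.simps prod.case
  sum_list.Cons sum_list.Nil list_sign.simps list.set insert_iff empty_iff

lemma idx3: "1 + 1 = (2 :: 3)" "1 + 2 = (3 :: 3)" "2 + 1 = (3 :: 3)" "2 + 2 = (1 :: 3)"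
  "3 + 1 = (1 :: 3)" "3 + 2 = (2 :: 3)"
  by simp_all

text \<open>The six nonzero terms of the epsilon symbol add up to six times the diagonal form with
  entries \<open>A1 * A2 * A3\<close>, \<open>A1\<close>, \<open>A2\<close>, \<open>A3\<close>. The
  first of these is \<open>V^3\<close>, so division by the density \<open>V\<close> gives
  \<open>gram4\<close>.\<close>

lemma hs_metric_volume_simple:
  assumes A: "\<And>i. A i (x $ 0) > 0"
  shows "hs_metric_volume (simple_triple A) x =
    (diag_inner (gram4 A (x $ 0)), \<lambda>vs. vol A (x $ 0) * coord_covec idx4 vs)"
  unfolding hs_metric_volume_def
proof (rule metric_of_diag[OF idx4(2,3)])
  let ?V = "vol A (x $ 0)" and ?A = "\<lambda>i. A i (x $ 0)"
  have [simp]: "?A i \<noteq> 0" for i using A[of i] by simp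
  have cube: "?V * (?V * ?V) = ?A 1 * ?A 2 * ?A 3"
    using vol_cube[of A "x $ 0", OF A] by (simp add: power3_eq_cube)
  show "gram4 A (x $ 0) a > 0" for a using A by (rule gram4_pos)
  show "?V\<^sup>2 = (\<Prod>a\<in>UNIV. gram4 A (x $ 0) a)"
  proof -
    have "?A 1 * ?A 2 * ?A 3 / (?V * (?V * ?V)) = 1"
      unfolding cube by simp
    then show ?thesis
      by (simp add: prod_4' field_simps)
  qed
  fix u v :: "real^4" and vs
  define W where "W i j k = wedge_list
     [(?A i * u $ 0, [spatial i]), (- (?A i * u $ spatial i), [0]),
      (u $ spatial (i + 1), [spatial (i + 2)]), (- (u $ spatial (i + 2)), [spatial (i + 1)])]
     (wedge_list [(?A j * v $ 0, [spatial j]), (- (?A j * v $ spatial j), [0]),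
      (v $ spatial (j + 1), [spatial (j + 2)]), (- (v $ spatial (j + 2)), [spatial (j + 1)])]
      [(A k (x $ 0), [0, spatial k]), (1, [spatial (k + 1), spatial (k + 2)])])" for i j k
  have w: "(contraction u (simple_triple A i) \<^bold>\<and> contraction v (simple_triple A j) \<^bold>\<and> simple_triple A k) x =
      lin_covec (W i j k)" for i j k
    unfolding W_def by (intro wedge_lin_covec contraction_simple_triple simple_triple_def)
  let ?c = "\<lambda>P. \<Sum>(c, K)\<leftarrow>P. c * list_sign pos4 K"
  have top: "lin_covec (W i j k) vs = ?c (W i j k) * coord_covec idx4 vs" for i j k
    by (rule lin_covec_top[OF inj_pos4 idx4]) (simp add: W_def wedge_list_def)
  have "?c (W 1 2 3) + ?c (W 2 3 1) + ?c (W 3 1 2) - ?c (W 1 3 2) - ?c (W 2 1 3) - ?c (W 3 2 1) =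
      6 * (?A 1 * ?A 2 * ?A 3 * u $ 0 * v $ 0 + ?A 1 * u $ 1 * v $ 1 + ?A 2 * u $ 2 * v $ 2 + ?A 3 * u $ 3 * v $ 3)"
    by (simp only: W_def idx3 spatial_simps wedge_list_eval) simp
  moreover have "diag_inner (gram4 A (x $ 0)) u v * ?V =
      ?A 1 * ?A 2 * ?A 3 * u $ 0 * v $ 0 + ?A 1 * u $ 1 * v $ 1 + ?A 2 * u $ 2 * v $ 2 + ?A 3 * u $ 3 * v $ 3"
  proof -
    have "diag_inner (gram4 A (x $ 0)) u v * ?V =
      ?V\<^sup>2 * ?V * u $ 0 * v $ 0 + ?A 1 / ?V * ?V * u $ 1 * v $ 1 +
      ?A 2 / ?V * ?V * u $ 2 * v $ 2 + ?A 3 / ?V * ?V * u $ 3 * v $ 3"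
      by (simp only: diag_inner_4 gram4_simps ring_distribs mult_ac)
    also have "?V\<^sup>2 * ?V = ?A 1 * ?A 2 * ?A 3"
      by (simp only: power2_eq_square mult.assoc cube)
    finally show ?thesis by simp
  qed
  ultimately show "1 / 6 * (\<Sum>i\<in>UNIV. \<Sum>j\<in>UNIV. \<Sum>k\<in>UNIV. levi_civita i j k *
        (contraction u (simple_triple A i) \<^bold>\<and> contraction v (simple_triple A j) \<^bold>\<and> simple_triple A k) x vs) =
     diag_inner (gram4 A (x $ 0)) u v * (?V * coord_covec idx4 vs)"
    unfolding sum_levi_civita w top
    by (simp only: distrib_right[symmetric] left_diff_distrib[symmetric] mult.assoc[symmetric])
qed

lemma hs_metric_simple: "(\<And>i. A i (x $ 0) > 0) \<Longrightarrow>
    hs_metric (simple_triple A) x = diag_inner (gram4 A (x $ 0))"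
  and hs_volume_simple: "(\<And>i. A i (x $ 0) > 0) \<Longrightarrow>
    hs_volume (simple_triple A) x = (\<lambda>vs. vol A (x $ 0) * coord_covec idx4 vs)"
  by (simp_all add: hs_metric_def hs_volume_def hs_metric_volume_simple)

lemma coord_covec_axes: "distinct I \<Longrightarrow> coord_covec I (map (\<lambda>i. axis i 1) I) = 1"
  using coord_covec_axes_append[of I "[]" "[]"] by simp

lemma top_ratio_eq:
  assumes "distinct idx" "c \<noteq> 0" "m = (\<lambda>vs. c * coord_covec idx vs)"
    "\<And>vs. a vs = r * c * coord_covec idx vs"
  shows "top_ratio a m = r"
  unfolding top_ratio_def
proof (rule the_equality)
  fix r' assume "\<forall>vs. a vs = r' * m vs"
  then have "a (map (\<lambda>i. axis i 1) idx) = r' * m (map (\<lambda>i. axis i 1) idx)" by blast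
  then show "r' = r"
    using assms coord_covec_axes[of idx] by simp
qed (use assms in simp)

text \<open>The square of the \<open>i\<close>-th form is \<open>2 * A i\<close> times the
  coordinate volume and mixed products vanish, while \<open>hs_volume\<close> has density
  \<open>V\<close>. The exponential form of \<open>A i / V\<close> prepares the logarithmic
  derivative of \<open>Q\<close>.\<close>

lemma hs_Q_simple:
  assumes A: "\<And>i. A i (x $ 0) > 0"
  shows "hs_Q (simple_triple A) x = (\<chi> i j. if i = j then exp (log_ratio A i (x $ 0)) else 0)"
proof -
  let ?V = "vol A (x $ 0)"
  let ?c = "\<lambda>P. \<Sum>(c, K)\<leftarrow>P. c * list_sign pos4 K"
  define P where "P i = [(A i (x $ 0), [0, spatial i]), (1, [spatial (i + 1), spatial (i + 2)])]" for i
  have P: "simple_triple A i x = lin_covec (P i)" for i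
    by (simp add: simple_triple_def P_def)
  have wP: "(simple_triple A i \<^bold>\<and> simple_triple A j) x = lin_covec (wedge_list (P i) (P j))" for i j
    by (rule wedge_lin_covec) (rule P)+
  have c: "?c (wedge_list (P i) (P j)) = (if i = j then 2 * A i (x $ 0) else 0)" for i j
  proof -
    consider "i = 1" | "i = 2" | "i = 3" using exhaust_3[of i] by blast
    then show ?thesis
    proof cases
      case 1
      show ?thesis unfolding 1 using exhaust_3[of j]
        by (elim disjE; simp only: P_def idx3 spatial_simps wedge_list_eval; simp)
    next
      case 2
      show ?thesis unfolding 2 using exhaust_3[of j]
        by (elim disjE; simp only: P_def idx3 spatial_simps wedge_list_eval; simp)
    next
      case 3
      show ?thesis unfolding 3 using exhaust_3[of j]
        by (elim disjE; simp only: P_def idx3 spatial_simps wedge_list_eval; simp)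
    qed
  qed
  have "top_ratio ((simple_triple A i \<^bold>\<and> simple_triple A j) x)
      (\<lambda>vs. 2 * hs_volume (simple_triple A) x vs) = (if i = j then exp (log_ratio A i (x $ 0)) else 0)" for i j
  proof (rule top_ratio_eq[OF idx4(2), of "2 * ?V"])
    fix vs
    have "lin_covec (wedge_list (P i) (P j)) vs = ?c (wedge_list (P i) (P j)) * coord_covec idx4 vs"
      by (rule lin_covec_top[OF inj_pos4 idx4]) (simp add: wedge_list_def P_def)
    then show "(simple_triple A i \<^bold>\<and> simple_triple A j) x vs =
        (if i = j then exp (log_ratio A i (x $ 0)) else 0) * (2 * ?V) * coord_covec idx4 vs"
      using A by (simp add: wP c exp_log_ratio)
  qed (use A in \<open>simp_all add: hs_volume_simple mult.assoc\<close>)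
  then show ?thesis by (simp add: hs_Q_def)
qed

lemma mean_log_differentiable:
  assumes A: "\<And>i s. A i s > 0" and d: "\<And>i s. A i differentiable (at s)"
  shows "mean_log A differentiable (at s)" "log_ratio A i differentiable (at s)"
    "vol A differentiable (at s)"
proof -
  have ln: "(\<lambda>s. ln (A i s)) differentiable (at s)" for i s
  proof -
    have "(A i has_real_derivative deriv (A i) s) (at s)"
      using d by (simp add: DERIV_deriv_iff_real_differentiable)
    then have "((\<lambda>s. ln (A i s)) has_real_derivative deriv (A i) s / A i s) (at s)"
      using A by (auto intro!: derivative_eq_intros)
    then show ?thesis by (auto simp: real_differentiable_def)
  qed
  show *: "mean_log A differentiable (at s)"
    unfolding mean_log_def by (intro differentiable_divide differentiable_add ln) auto
  show "log_ratio A i differentiable (at s)"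
    unfolding log_ratio_def by (intro differentiable_diff ln *)
  show "vol A differentiable (at s)"
  proof -
    obtain D where "(mean_log A has_real_derivative D) (at s)"
      using * by (auto simp: real_differentiable_def)
    from DERIV_fun_exp[OF this] show ?thesis
      unfolding real_differentiable_def vol_def[abs_def] by blast
  qed
qed

text \<open>For a diagonal \<open>Q\<close> this is the logarithmic derivative of each diagonal
  entry.\<close>

lemma hs_dQ_Qinv_simple:
  assumes A: "\<And>i s. A i s > 0" and d: "\<And>i s. A i differentiable (at s)"
  shows "hs_dQ_Qinv (simple_triple A) i j x =
    lin_covec [(if i = j then deriv (log_ratio A i) (x $ 0) else 0, [0])]"
proof -
  define F where "F k s = (if i = k then exp (log_ratio A i s) else 0)" for k s
  have Q: "hs_Q (simple_triple A) = (\<lambda>y. \<chi> i j. if i = j then exp (log_ratio A i (y $ 0)) else 0)"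
    using A by (intro ext hs_Q_simple)
  have F: "(F k has_real_derivative (if i = k then exp (log_ratio A i s) * deriv (log_ratio A i) s else 0)) (at s)" for k s
  proof (cases "i = k")
    case True
    have "(log_ratio A i has_real_derivative deriv (log_ratio A i) s) (at s)"
      using mean_log_differentiable(2)[OF A d] by (simp add: DERIV_deriv_iff_real_differentiable)
    from DERIV_fun_exp[OF this] show ?thesis
      using True by (simp add: F_def[abs_def])
  qed (simp add: F_def[abs_def])
  have "ext_deriv (fun_form (\<lambda>y. hs_Q (simple_triple A) y $ i $ k)) x =
      lin_covec (map (\<lambda>(f, I). (deriv f (x $ 0), 0 # I)) [(F k, [])])" for k
  proof (rule ext_deriv_lin_covec)
    show "fun_form (\<lambda>y. hs_Q (simple_triple A) y $ i $ k) y =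
        lin_covec (map (\<lambda>(f, I). (f (y $ 0), I)) [(F k, [])])" for y
      by (auto simp: fun_form_def Q F_def lin_covec_Cons)
    show "f differentiable (at (x $ 0))" if "(f, I) \<in> set [(F k, [])]" for f I
      using that F real_differentiable_def by auto
  qed
  then have dQ: "ext_deriv (fun_form (\<lambda>y. hs_Q (simple_triple A) y $ i $ k)) x vs =
      (if i = k then exp (log_ratio A i (x $ 0)) * deriv (log_ratio A i) (x $ 0) else 0) * coord_covec [0] vs" for k vs
    by (simp add: lin_covec_Cons DERIV_imp_deriv[OF F])
  have Qinv: "matrix_inv (hs_Q (simple_triple A) x) $ k $ j =
      (if k = j then 1 / exp (log_ratio A k (x $ 0)) else 0)" for k
    unfolding Q by (subst matrix_inv_diag) auto
  show ?thesis
    unfolding hs_dQ_Qinv_def dQ Qinv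
    by (rule ext, subst sum.remove[of _ i]) (auto simp: lin_covec_Cons intro!: sum.neutral)
qed

definition flux :: "(3 \<Rightarrow> real \<Rightarrow> real) \<Rightarrow> 3 \<Rightarrow> real \<Rightarrow> real" where
  "flux A i s = deriv (log_ratio A i) s * A i s / (vol A s)\<^sup>2"

text \<open>The wedge with \<open>dx_0\<close> kills the first term of the simple form. If
  \<open>k\<close>, \<open>l\<close> are the other two indices, the star contributes
  \<open>V * V^-2 * (V / A_k) * (V / A_l)\<close>, which equals \<open>A_j / V^2\<close> because
  \<open>V^3 = A_1 * A_2 * A_3\<close>.\<close>

lemma hs_E_simple:
  assumes A: "\<And>i s. A i s > 0" and \<alpha>: "\<alpha> x = lin_covec [(p, [0])]"
  shows "hs_E (simple_triple A) j \<alpha> x =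
    lin_covec [(- (p * A j (x $ 0) / (vol A (x $ 0))\<^sup>2), [spatial j])]"
proof -
  let ?V = "vol A (x $ 0)"
  let ?I = "[0, spatial (j + 1), spatial (j + 2)]"
  have [simp]: "A i (x $ 0) \<noteq> 0" for i using A[of i "x $ 0"] by simp
  have cube: "?V * (?V * ?V) = A 1 (x $ 0) * A 2 (x $ 0) * A 3 (x $ 0)"
    using vol_cube[of A "x $ 0", OF A] by (simp add: power3_eq_cube)
  have "(\<alpha> \<^bold>\<and> simple_triple A j) x = lin_covec (map (\<lambda>(c, I, J). (c, I)) [(p, ?I, [spatial j])])"
    unfolding wedge_lin_covec[of \<alpha>, OF \<alpha> simple_triple_def]
    by (rule ext) (simp add: wedge_list_def lin_covec_Cons coord_covec_not_distinct)
  then have "hodge_star (hs_metric (simple_triple A)) (hs_volume (simple_triple A)) (\<alpha> \<^bold>\<and> simple_triple A j) x =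
     lin_covec (map (\<lambda>(c, I, J). (c * (\<Prod>a\<leftarrow>I. 1 / gram4 A (x $ 0) a) * ?V * list_sign pos4 (I @ J), J))
       [(p, ?I, [spatial j])])"
    by (rule hodge_star_diag[OF inj_pos4 idx4, rotated 3])
      (use A exhaust_3[of j] in \<open>auto simp: hs_metric_simple hs_volume_simple intro: gram4_pos\<close>)
  moreover have "p * (\<Prod>a\<leftarrow>?I. 1 / gram4 A (x $ 0) a) * ?V * list_sign pos4 (?I @ [spatial j]) =
      p * A j (x $ 0) / ?V\<^sup>2"
  proof -
    have *: "p * (1 / ?V\<^sup>2 * (?V / a * (?V / b))) * ?V = p * c / ?V\<^sup>2"
      if "?V * (?V * ?V) = a * b * c" "a \<noteq> 0" "b \<noteq> 0" for a b c
    proof -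
      have "p * (1 / ?V\<^sup>2 * (?V / a * (?V / b))) * ?V = p * (?V * (?V * ?V)) / (a * b) / ?V\<^sup>2"
        by (simp add: mult_ac)
      also have "\<dots> = p * c / ?V\<^sup>2" using that(2,3) by (simp only: that(1)) simp
      finally show ?thesis .
    qed
    have s: "list_sign pos4 ([0, 2, 3] @ [1]) = 1" "list_sign pos4 ([0, 3, 1] @ [2]) = 1"
      "list_sign pos4 ([0, 1, 2] @ [3]) = 1"
      by simp_all
    have r: "(\<Prod>a\<leftarrow>[0, 2, 3]. 1 / gram4 A (x $ 0) a) = 1 / ?V\<^sup>2 * (?V / A 2 (x $ 0) * (?V / A 3 (x $ 0)))"
      "(\<Prod>a\<leftarrow>[0, 3, 1]. 1 / gram4 A (x $ 0) a) = 1 / ?V\<^sup>2 * (?V / A 3 (x $ 0) * (?V / A 1 (x $ 0)))"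
      "(\<Prod>a\<leftarrow>[0, 1, 2]. 1 / gram4 A (x $ 0) a) = 1 / ?V\<^sup>2 * (?V / A 1 (x $ 0) * (?V / A 2 (x $ 0)))"
      by simp_all
    consider "j = 1" | "j = 2" | "j = 3" using exhaust_3[of j] by blast
    then show ?thesis
    proof cases
      case 1
      show ?thesis unfolding 1 idx3 spatial_simps s r mult_1_right
        by (rule *) (simp_all add: cube)
    next
      case 2
      show ?thesis unfolding 2 idx3 spatial_simps s r mult_1_right
        by (rule *) (simp_all add: cube)
    next
      case 3
      show ?thesis unfolding 3 idx3 spatial_simps s r mult_1_right
        by (rule *) (simp_all add: cube)
    qed
  qed
  ultimately have "hodge_star (hs_metric (simple_triple A)) (hs_volume (simple_triple A)) (\<alpha> \<^bold>\<and> simple_triple A j) x =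
      lin_covec [(p * A j (x $ 0) / ?V\<^sup>2, [spatial j])]"
    by (simp only: list.map prod.case)
  then show ?thesis
    unfolding hs_E_def by (simp add: lin_covec_Cons fun_eq_iff)
qed

lemma hs_torsion_simple:
  assumes A: "\<And>i s. A i s > 0" and d: "\<And>i s. A i differentiable (at s)"
  shows "hs_torsion (simple_triple A) i x = lin_covec [(flux A i (x $ 0), [spatial i])]"
proof -
  have *: "hs_E (simple_triple A) j (hs_dQ_Qinv (simple_triple A) i j) x vs =
      (if j = i then - flux A i (x $ 0) * coord_covec [spatial i] vs else 0)" for j vs
    using hs_E_simple[of A "hs_dQ_Qinv (simple_triple A) i j" x, OF A hs_dQ_Qinv_simple[OF A d], of j]
    by (auto simp: flux_def lin_covec_Cons)
  show ?thesis
    unfolding hs_torsion_def * by (simp add: lin_covec_Cons)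
qed

lemma ext_deriv_hs_torsion_simple:
  assumes A: "\<And>i s. A i s > 0" and d: "\<And>i s. A i differentiable (at s)"
    and f: "\<And>s. flux A i differentiable (at s)"
  shows "ext_deriv (hs_torsion (simple_triple A) i) x = lin_covec [(deriv (flux A i) (x $ 0), [0, spatial i])]"
  by (subst ext_deriv_lin_covec[where C = "[(flux A i, [spatial i])]" and a = 0])
    (use hs_torsion_simple[OF A d] f in auto)

section \<open>The \<open>G\<^sub>2\<close>-structure of a triple of simple type\<close>

text \<open>This order of the coordinates is also the orientation: with it the bilinear form in
  \<open>G2_metric_volume\<close> comes out positive.\<close>

definition pos7 :: "4 + 3 \<Rightarrow> nat" where
  "pos7 a = (case a of Inl b \<Rightarrow> pos4 b | Inr i \<Rightarrow> if i = 1 then 4 else if i = 2 then 5 else 6)"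

lemma pos7_simps [simp]: "pos7 (Inl b) = pos4 b" "pos7 (Inr 1) = 4" "pos7 (Inr 2) = 5" "pos7 (Inr 3) = 6"
  by (simp_all add: pos7_def)

lemma inj_pos7: "inj pos7"
proof -
  have 1: "pos4 b < 4" for b by (simp add: pos4_def)
  have 2: "pos7 (Inr i) \<ge> 4" for i by (simp add: pos7_def)
  have 3: "pos7 (Inr i) = pos7 (Inr j) \<Longrightarrow> i = j" for i j
    using exhaust_3[of i] exhaust_3[of j] by (auto simp: pos7_def)
  have 4: "pos4 a \<noteq> pos7 (Inr j)" for a j
    using 1[of a] 2[of j] by linarith
  show ?thesis
  proof (rule injI)
    fix a b assume "pos7 a = pos7 b"
    then show "a = b"
      using inj_pos4 3 4 4[symmetric] by (cases a; cases b) (simp_all add: inj_eq del: pos7_simps(2-4))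
  qed
qed

definition idx7 :: "(4 + 3) list" where
  "idx7 = [Inl 0, Inl 1, Inl 2, Inl 3, Inr 1, Inr 2, Inr 3]"

lemma UNIV_7: "(UNIV :: (4 + 3) set) = set idx7"
proof -
  have "a \<in> set idx7" for a
  proof (cases a)
    case (Inl b)
    then show ?thesis using exhaust_4'[of b] by (auto simp: idx7_def)
  next
    case (Inr i)
    then show ?thesis using exhaust_3[of i] by (auto simp: idx7_def)
  qed
  then show ?thesis by blast
qed

lemma idx7: "sorted (map pos7 idx7)" "distinct idx7" "set idx7 = UNIV"
proof -
  show "sorted (map pos7 idx7)" by (simp add: idx7_def)
  show "distinct idx7" by (simp add: idx7_def)
  show "set idx7 = UNIV" by (rule UNIV_7[symmetric])
qed

lemma sum_7: "sum f (UNIV :: (4 + 3) set) =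
    f (Inl 0) + f (Inl 1) + f (Inl 2) + f (Inl 3) + f (Inr 1) + f (Inr 2) + f (Inr 3)"
  using sum.distinct_set_conv_list[OF idx7(2), of f] by (simp add: UNIV_7) (simp add: idx7_def add.assoc)

lemma prod_7: "prod f (UNIV :: (4 + 3) set) =
    f (Inl 0) * f (Inl 1) * f (Inl 2) * f (Inl 3) * f (Inr 1) * f (Inr 2) * f (Inr 3)"
  using prod.distinct_set_conv_list[OF idx7(2), of f] by (simp add: UNIV_7) (simp add: idx7_def mult.assoc)

lemma linear_proj4: "linear proj4"
  by (intro linearI) (simp_all add: proj4_def vec_eq_iff)

lemma pullback_linear:
  fixes L :: "'a::euclidean_space \<Rightarrow> 'b::real_normed_vector"
  assumes "linear L" shows "pullback L \<alpha> x vs = \<alpha> (L x) (map L vs)"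
proof -
  have "frechet_derivative L (at x) = L"
    using linear_imp_differentiable[OF assms] assms
    by (metis frechet_derivative_at has_derivative_bounded_linear linear_conv_bounded_linear bounded_linear_imp_has_derivative)
  then show ?thesis by (simp add: pullback_def)
qed

lemma coord_covec_proj4: "coord_covec I (map proj4 vs) = coord_covec (map Inl I) vs"
proof -
  have "Matrix.mat (length I) (length I) (\<lambda>(i, j). map proj4 vs ! j $ (I ! i)) =
      Matrix.mat (length I) (length I) (\<lambda>(i, j). vs ! j $ (map Inl I ! i))" if "length vs = length I"
    using that by (intro eq_matI) (auto simp: proj4_def)
  then show ?thesis by (simp add: coord_covec_def)
qed

lemma lin_covec_proj4: "lin_covec P (map proj4 vs) = lin_covec (map (\<lambda>(c, I). (c, map Inl I)) P) vs"
  by (induction P) (auto simp: lin_covec_Cons coord_covec_proj4)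

definition g2_list :: "(3 \<Rightarrow> real \<Rightarrow> real) \<Rightarrow> real \<Rightarrow> (real \<times> (4 + 3) list) list" where
  "g2_list A s = [(1, [Inr 1, Inr 2, Inr 3]),
     (- A 1 s, [Inr 1, Inl 0, Inl 1]), (- 1, [Inr 1, Inl 2, Inl 3]),
     (- A 2 s, [Inr 2, Inl 0, Inl 2]), (- 1, [Inr 2, Inl 3, Inl 1]),
     (- A 3 s, [Inr 3, Inl 0, Inl 3]), (- 1, [Inr 3, Inl 1, Inl 2])]"

lemma wedge_dt_pullback:
  assumes "\<alpha> (proj4 x) = lin_covec P"
  shows "(dt i \<^bold>\<and> pullback proj4 \<alpha>) x = lin_covec (map (\<lambda>(c, I). (c, Inr i # map Inl I)) P)"
proof -
  have "pullback proj4 \<alpha> x = lin_covec (map (\<lambda>(c, I). (c, map Inl I)) P)"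
    by (rule ext) (simp add: pullback_linear[OF linear_proj4] assms lin_covec_proj4)
  moreover have "dt i x = lin_covec [(1, [Inr i])]"
    by (rule ext) (simp add: dt_def coord_form_eq lin_covec_Cons)
  ultimately have "(dt i \<^bold>\<and> pullback proj4 \<alpha>) x =
      lin_covec (wedge_list [(1, [Inr i])] (map (\<lambda>(c, I). (c, map Inl I)) P))"
    by (intro wedge_lin_covec)
  then show ?thesis by (simp add: wedge_list_def o_def case_prod_unfold)
qed

lemma wedge_dt_dt_dt: "(dt 1 \<^bold>\<and> dt 2 \<^bold>\<and> dt 3) x = coord_covec [Inr 1, Inr 2, Inr 3]"
  by (subst wedge_coord_covec[of _ _ "[Inr 1]" _ "[Inr 2, Inr 3]"])
    (auto simp: dt_def coord_form_eq wedge_coord_covec[of _ _ "[Inr 2]" _ "[Inr 3]"])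

lemma G2_form_simple: "G2_form (simple_triple A) x = lin_covec (g2_list A (x $ Inl 0))"
proof
  fix vs
  have p: "proj4 x $ 0 = x $ Inl 0" by (simp add: proj4_def)
  show "G2_form (simple_triple A) x vs = lin_covec (g2_list A (x $ Inl 0)) vs"
    unfolding G2_form_def sum_3 wedge_dt_dt_dt wedge_dt_pullback[of _ x, OF simple_triple_def] idx3 spatial_simps
    by (simp add: g2_list_def lin_covec_Cons p)
qed

definition gram7 :: "(3 \<Rightarrow> real \<Rightarrow> real) \<Rightarrow> real \<Rightarrow> 4 + 3 \<Rightarrow> real" where
  "gram7 A s a = (case a of Inl b \<Rightarrow> gram4 A s b | Inr i \<Rightarrow> A i s / vol A s)"

lemma gram7_simps [simp]: "gram7 A s (Inl b) = gram4 A s b" "gram7 A s (Inr i) = A i s / vol A s"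
  by (simp_all add: gram7_def)

lemma gram7_pos: "(\<And>i. A i s > 0) \<Longrightarrow> gram7 A s a > 0"
  by (cases a) (auto simp: gram4_pos)

text \<open>The contraction of \<open>g2_list\<close> with \<open>u\<close>, spelled out so that the
  products below are products of literal lists.\<close>

definition g2_contract :: "(3 \<Rightarrow> real \<Rightarrow> real) \<Rightarrow> real \<Rightarrow> real^(4 + 3) \<Rightarrow> (real \<times> (4 + 3) list) list" where
  "g2_contract A s u = [
     (u $ Inr 1, [Inr 2, Inr 3]), (- u $ Inr 2, [Inr 1, Inr 3]), (u $ Inr 3, [Inr 1, Inr 2]),
     (- (A 1 s * u $ Inr 1), [Inl 0, Inl 1]), (A 1 s * u $ Inl 0, [Inr 1, Inl 1]), (- (A 1 s * u $ Inl 1), [Inr 1, Inl 0]),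
     (- u $ Inr 1, [Inl 2, Inl 3]), (u $ Inl 2, [Inr 1, Inl 3]), (- u $ Inl 3, [Inr 1, Inl 2]),
     (- (A 2 s * u $ Inr 2), [Inl 0, Inl 2]), (A 2 s * u $ Inl 0, [Inr 2, Inl 2]), (- (A 2 s * u $ Inl 2), [Inr 2, Inl 0]),
     (- u $ Inr 2, [Inl 3, Inl 1]), (u $ Inl 3, [Inr 2, Inl 1]), (- u $ Inl 1, [Inr 2, Inl 3]),
     (- (A 3 s * u $ Inr 3), [Inl 0, Inl 3]), (A 3 s * u $ Inl 0, [Inr 3, Inl 3]), (- (A 3 s * u $ Inl 3), [Inr 3, Inl 0]),
     (- u $ Inr 3, [Inl 1, Inl 2]), (u $ Inl 1, [Inr 3, Inl 2]), (- u $ Inl 2, [Inr 3, Inl 1])]"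

lemma contract_g2_list: "contract_list u (g2_list A s) = g2_contract A s u"
  by (simp add: contract_list_def g2_list_def g2_contract_def)

text \<open>This table and the next decide each comparison of indices by a single rewrite; the
  product evaluated with them has hundreds of terms.\<close>

lemma idx7_eq:
  "((Inl 0 :: 4 + 3) = Inl 1) = False" "((Inl 0 :: 4 + 3) = Inl 2) = False"
  "((Inl 0 :: 4 + 3) = Inl 3) = False" "((Inl 0 :: 4 + 3) = Inr 1) = False"
  "((Inl 0 :: 4 + 3) = Inr 2) = False" "((Inl 0 :: 4 + 3) = Inr 3) = False"
  "((Inl 1 :: 4 + 3) = Inl 0) = False" "((Inl 1 :: 4 + 3) = Inl 2) = False"
  "((Inl 1 :: 4 + 3) = Inl 3) = False" "((Inl 1 :: 4 + 3) = Inr 1) = False"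
  "((Inl 1 :: 4 + 3) = Inr 2) = False" "((Inl 1 :: 4 + 3) = Inr 3) = False"
  "((Inl 2 :: 4 + 3) = Inl 0) = False" "((Inl 2 :: 4 + 3) = Inl 1) = False"
  "((Inl 2 :: 4 + 3) = Inl 3) = False" "((Inl 2 :: 4 + 3) = Inr 1) = False"
  "((Inl 2 :: 4 + 3) = Inr 2) = False" "((Inl 2 :: 4 + 3) = Inr 3) = False"
  "((Inl 3 :: 4 + 3) = Inl 0) = False" "((Inl 3 :: 4 + 3) = Inl 1) = False"
  "((Inl 3 :: 4 + 3) = Inl 2) = False" "((Inl 3 :: 4 + 3) = Inr 1) = False"
  "((Inl 3 :: 4 + 3) = Inr 2) = False" "((Inl 3 :: 4 + 3) = Inr 3) = False"
  "((Inr 1 :: 4 + 3) = Inl 0) = False" "((Inr 1 :: 4 + 3) = Inl 1) = False"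
  "((Inr 1 :: 4 + 3) = Inl 2) = False" "((Inr 1 :: 4 + 3) = Inl 3) = False"
  "((Inr 1 :: 4 + 3) = Inr 2) = False" "((Inr 1 :: 4 + 3) = Inr 3) = False"
  "((Inr 2 :: 4 + 3) = Inl 0) = False" "((Inr 2 :: 4 + 3) = Inl 1) = False"
  "((Inr 2 :: 4 + 3) = Inl 2) = False" "((Inr 2 :: 4 + 3) = Inl 3) = False"
  "((Inr 2 :: 4 + 3) = Inr 1) = False" "((Inr 2 :: 4 + 3) = Inr 3) = False"
  "((Inr 3 :: 4 + 3) = Inl 0) = False" "((Inr 3 :: 4 + 3) = Inl 1) = False"
  "((Inr 3 :: 4 + 3) = Inl 2) = False" "((Inr 3 :: 4 + 3) = Inl 3) = False"
  "((Inr 3 :: 4 + 3) = Inr 1) = False" "((Inr 3 :: 4 + 3) = Inr 2) = False"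
  by simp_all

lemma pos7_less:
  "(pos7 (Inl 0) < pos7 (Inl 0)) = False" "(pos7 (Inl 0) < pos7 (Inl 1)) = True"
  "(pos7 (Inl 0) < pos7 (Inl 2)) = True" "(pos7 (Inl 0) < pos7 (Inl 3)) = True"
  "(pos7 (Inl 0) < pos7 (Inr 1)) = True" "(pos7 (Inl 0) < pos7 (Inr 2)) = True"
  "(pos7 (Inl 0) < pos7 (Inr 3)) = True" "(pos7 (Inl 1) < pos7 (Inl 0)) = False"
  "(pos7 (Inl 1) < pos7 (Inl 1)) = False" "(pos7 (Inl 1) < pos7 (Inl 2)) = True"
  "(pos7 (Inl 1) < pos7 (Inl 3)) = True" "(pos7 (Inl 1) < pos7 (Inr 1)) = True"
  "(pos7 (Inl 1) < pos7 (Inr 2)) = True" "(pos7 (Inl 1) < pos7 (Inr 3)) = True"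
  "(pos7 (Inl 2) < pos7 (Inl 0)) = False" "(pos7 (Inl 2) < pos7 (Inl 1)) = False"
  "(pos7 (Inl 2) < pos7 (Inl 2)) = False" "(pos7 (Inl 2) < pos7 (Inl 3)) = True"
  "(pos7 (Inl 2) < pos7 (Inr 1)) = True" "(pos7 (Inl 2) < pos7 (Inr 2)) = True"
  "(pos7 (Inl 2) < pos7 (Inr 3)) = True" "(pos7 (Inl 3) < pos7 (Inl 0)) = False"
  "(pos7 (Inl 3) < pos7 (Inl 1)) = False" "(pos7 (Inl 3) < pos7 (Inl 2)) = False"
  "(pos7 (Inl 3) < pos7 (Inl 3)) = False" "(pos7 (Inl 3) < pos7 (Inr 1)) = True"
  "(pos7 (Inl 3) < pos7 (Inr 2)) = True" "(pos7 (Inl 3) < pos7 (Inr 3)) = True"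
  "(pos7 (Inr 1) < pos7 (Inl 0)) = False" "(pos7 (Inr 1) < pos7 (Inl 1)) = False"
  "(pos7 (Inr 1) < pos7 (Inl 2)) = False" "(pos7 (Inr 1) < pos7 (Inl 3)) = False"
  "(pos7 (Inr 1) < pos7 (Inr 1)) = False" "(pos7 (Inr 1) < pos7 (Inr 2)) = True"
  "(pos7 (Inr 1) < pos7 (Inr 3)) = True" "(pos7 (Inr 2) < pos7 (Inl 0)) = False"
  "(pos7 (Inr 2) < pos7 (Inl 1)) = False" "(pos7 (Inr 2) < pos7 (Inl 2)) = False"
  "(pos7 (Inr 2) < pos7 (Inl 3)) = False" "(pos7 (Inr 2) < pos7 (Inr 1)) = False"
  "(pos7 (Inr 2) < pos7 (Inr 2)) = False" "(pos7 (Inr 2) < pos7 (Inr 3)) = True"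
  "(pos7 (Inr 3) < pos7 (Inl 0)) = False" "(pos7 (Inr 3) < pos7 (Inl 1)) = False"
  "(pos7 (Inr 3) < pos7 (Inl 2)) = False" "(pos7 (Inr 3) < pos7 (Inl 3)) = False"
  "(pos7 (Inr 3) < pos7 (Inr 1)) = False" "(pos7 (Inr 3) < pos7 (Inr 2)) = False"
  "(pos7 (Inr 3) < pos7 (Inr 3)) = False"
  by simp_all

text \<open>One factor of \<open>list_sign\<close>, computed by comparing keys one at a time without
  counting. Equal keys, which for an injective key mean a repeated index, give 0.\<close>

primrec insert_sign :: "('a \<Rightarrow> nat) \<Rightarrow> 'a \<Rightarrow> 'a list \<Rightarrow> real" where
  "insert_sign k a [] = 1"
| "insert_sign k a (b # I) =
    (if k b < k a then - insert_sign k a I else if k a < k b then insert_sign k a I else 0)"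

lemma list_sign_Cons:
  assumes "inj k" shows "list_sign k (a # I) = insert_sign k a I * list_sign k I"
proof -
  have "insert_sign k a I = (if a \<in> set I then 0 else (-1) ^ length (filter (\<lambda>b. k b < k a) I))"
    using injD[OF assms, of a] by (induction I) (auto simp: not_less_iff_gr_or_eq)
  then show ?thesis by simp
qed

lemma g2_bilinear:
  "(\<Sum>(c, K)\<leftarrow>wedge_list (g2_contract A s u)
      (filter (\<lambda>(c, I). distinct I) (wedge_list (g2_contract A s v) (g2_list A s))). c * list_sign pos7 K) =
    6 * (A 1 s * A 2 s * A 3 s * u $ Inl 0 * v $ Inl 0 +
      A 1 s * u $ Inl 1 * v $ Inl 1 + A 2 s * u $ Inl 2 * v $ Inl 2 + A 3 s * u $ Inl 3 * v $ Inl 3 +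
      A 1 s * u $ Inr 1 * v $ Inr 1 + A 2 s * u $ Inr 2 * v $ Inr 2 + A 3 s * u $ Inr 3 * v $ Inr 3)"
  apply (simp only: wedge_list_def g2_contract_def g2_list_def list.map concat.simps append.simps prod.case)
  \<comment> \<open>\<open>simp only\<close> drops \<open>if_weak_cong\<close>, without which both branches of the nested conditionals are expanded.\<close>
  apply (simp only: filter.simps prod.case distinct.simps list.set insert_iff empty_iff idx7_eq simp_thms if_True if_False cong: if_weak_cong)
  apply (simp only: list.map concat.simps append.simps prod.case)
  apply (simp only: sum_list.Cons sum_list.Nil list_sign_Cons[OF inj_pos7] list_sign.simps(1) insert_sign.simps pos7_less if_True if_False
    minus_zero mult_zero_left mult_zero_right mult_1_right add_0_left add_0_right minus_minus cong: if_weak_cong)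
  apply (simp add: algebra_simps)
  done

lemma diag_inner_7:
  "diag_inner G u v = G (Inl 0) * u $ Inl 0 * v $ Inl 0 + G (Inl 1) * u $ Inl 1 * v $ Inl 1 +
    G (Inl 2) * u $ Inl 2 * v $ Inl 2 + G (Inl 3) * u $ Inl 3 * v $ Inl 3 +
    G (Inr 1) * u $ Inr 1 * v $ Inr 1 + G (Inr 2) * u $ Inr 2 * v $ Inr 2 +
    G (Inr 3) * u $ Inr 3 * v $ (Inr 3 :: 4 + 3)"
  by (simp only: diag_inner_def sum_7)

text \<open>Each \<open>A i / V\<close> now occurs twice on the diagonal. As their product over
  \<open>i\<close> is 1, the density is again \<open>V\<close>.\<close>

lemma G2_metric_volume_simple:
  assumes A: "\<And>i. A i (x $ Inl 0) > 0"
  shows "G2_metric_volume (G2_form (simple_triple A)) x =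
    (diag_inner (gram7 A (x $ Inl 0)), \<lambda>vs. vol A (x $ Inl 0) * coord_covec idx7 vs)"
  unfolding G2_metric_volume_def
proof (rule metric_of_diag[OF idx7(2,3)])
  let ?s = "x $ Inl 0"
  let ?V = "vol A ?s" and ?A = "\<lambda>i. A i ?s" and ?\<phi> = "G2_form (simple_triple A)"
  have [simp]: "?A i \<noteq> 0" for i using A[of i] by simp
  have cube: "?V * (?V * ?V) = ?A 1 * ?A 2 * ?A 3"
    using vol_cube[of A ?s, OF A] by (simp add: power3_eq_cube)
  show "gram7 A ?s a > 0" for a using A by (rule gram7_pos)
  show "?V\<^sup>2 = (\<Prod>a\<in>UNIV. gram7 A ?s a)"
  proof -
    have "?A 1 * ?A 2 * ?A 3 / (?V * (?V * ?V)) = 1" unfolding cube by simp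
    moreover have "(\<Prod>a\<in>UNIV. gram7 A ?s a) = ?V\<^sup>2 * (?A 1 * ?A 2 * ?A 3 / (?V * (?V * ?V)))\<^sup>2"
      by (simp only: prod_7 gram7_simps gram4_simps) (simp add: power2_eq_square)
    ultimately show ?thesis by simp
  qed
  fix u v :: "real^(4 + 3)" and vs
  have c: "contraction w ?\<phi> x = lin_covec (g2_contract A ?s w)" for w
    using contraction_lin_covec[of ?\<phi> x, OF G2_form_simple, of w] by (simp add: contract_g2_list)
  let ?P = "filter (\<lambda>(c, I). distinct I) (wedge_list (g2_contract A ?s v) (g2_list A ?s))"
  have "(contraction v ?\<phi> \<^bold>\<and> ?\<phi>) x = lin_covec ?P"
    unfolding lin_covec_filter_distinct by (intro wedge_lin_covec c G2_form_simple)
  then have w: "(contraction u ?\<phi> \<^bold>\<and> contraction v ?\<phi> \<^bold>\<and> ?\<phi>) x =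
      lin_covec (wedge_list (g2_contract A ?s u) ?P)"
    by (intro wedge_lin_covec c)
  have len: "list_all (\<lambda>(c, K). length K = CARD(4 + 3)) (wedge_list (g2_contract A ?s u) ?P)"
  proof -
    have wl: "list_all (\<lambda>(c, K). length K = p + q) (wedge_list P Q)"
      if "list_all (\<lambda>(c, K). length K = p) P" "list_all (\<lambda>(c, K). length K = q) Q"
      for p q and P Q :: "(real \<times> (4 + 3) list) list"
      using that by (fastforce simp: wedge_list_def list_all_iff)
    have c2: "list_all (\<lambda>(c, K). length K = 2) (g2_contract A ?s w)" for w
      by (simp add: g2_contract_def)
    have g3: "list_all (\<lambda>(c, K). length K = 3) (g2_list A ?s)"
      by (simp add: g2_list_def)
    have "list_all (\<lambda>(c, K). length K = 2 + 3) ?P"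
      using wl[OF c2[of v] g3] by (auto simp: list_all_iff)
    from wl[OF c2[of u] this] show ?thesis by simp
  qed
  have "diag_inner (gram7 A ?s) u v * ?V =
      ?V\<^sup>2 * ?V * u $ Inl 0 * v $ Inl 0 + ?A 1 / ?V * ?V * u $ Inl 1 * v $ Inl 1 +
      ?A 2 / ?V * ?V * u $ Inl 2 * v $ Inl 2 + ?A 3 / ?V * ?V * u $ Inl 3 * v $ Inl 3 +
      ?A 1 / ?V * ?V * u $ Inr 1 * v $ Inr 1 + ?A 2 / ?V * ?V * u $ Inr 2 * v $ Inr 2 +
      ?A 3 / ?V * ?V * u $ Inr 3 * v $ Inr 3"
    by (simp only: diag_inner_7 gram7_simps gram4_simps ring_distribs mult_ac)
  also have "?V\<^sup>2 * ?V = ?A 1 * ?A 2 * ?A 3"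
    by (simp only: power2_eq_square mult.assoc cube)
  finally have d: "diag_inner (gram7 A ?s) u v * ?V =
      ?A 1 * ?A 2 * ?A 3 * u $ Inl 0 * v $ Inl 0 + ?A 1 * u $ Inl 1 * v $ Inl 1 +
      ?A 2 * u $ Inl 2 * v $ Inl 2 + ?A 3 * u $ Inl 3 * v $ Inl 3 +
      ?A 1 * u $ Inr 1 * v $ Inr 1 + ?A 2 * u $ Inr 2 * v $ Inr 2 + ?A 3 * u $ Inr 3 * v $ Inr 3"
    by simp
  show "1 / 6 * (contraction u ?\<phi> \<^bold>\<and> contraction v ?\<phi> \<^bold>\<and> ?\<phi>) x vs =
      diag_inner (gram7 A ?s) u v * (?V * coord_covec idx7 vs)"
    unfolding w lin_covec_top[OF inj_pos7 idx7 len] g2_bilinear mult.assoc[symmetric] d by simp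
qed

lemma G2_metric_simple: "(\<And>i. A i (x $ Inl 0) > 0) \<Longrightarrow>
    G2_metric (G2_form (simple_triple A)) x = diag_inner (gram7 A (x $ Inl 0))"
  and G2_volume_simple: "(\<And>i. A i (x $ Inl 0) > 0) \<Longrightarrow>
    G2_volume (G2_form (simple_triple A)) x = (\<lambda>vs. vol A (x $ Inl 0) * coord_covec idx7 vs)"
  by (simp_all add: G2_metric_def G2_volume_def G2_metric_volume_simple)

lemma coord_covec_diag:
  "coord_covec I (map (\<lambda>v. \<chi> a. l a * v $ a) vs) = (\<Prod>a\<leftarrow>I. l a) * coord_covec I vs"
proof (cases "length vs = length I")
  case True
  have *: "p i < length I" if "p permutes {..<length I}" "i < length I" for p i
    using permutes_in_image[OF that(1), of i] that(2) by simp
  have "(\<Prod>a\<leftarrow>I. l a) = (\<Prod>i<length I. l (I ! i))"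
    by (simp add: prod.list_conv_set_nth lessThan_atLeast0)
  then show ?thesis
    using True
    by (auto simp: coord_covec_leibniz * prod.distrib sum_distrib_left mult_ac intro!: sum.cong)
qed (simp add: coord_covec_length)

text \<open>The map scales \<open>x0\<close> by \<open>V\<close> and both \<open>x_i\<close> and
  \<open>t_i\<close> by \<open>r i = sqrt (A i / V)\<close>. Terms containing \<open>dx_0\<close>
  acquire the factor \<open>r i * V * r i = A i\<close>, the others
  \<open>r 1 * r 2 * r 3 = 1\<close>.\<close>

lemma G2_form_simple_equivalent:
  assumes A: "\<And>i. A i (x $ Inl 0) > 0"
  shows "\<exists>L. linear L \<and> bij L \<and>
    (\<forall>vs. G2_form (simple_triple A) x vs = G2_form standard_triple 0 (map L vs))"
proof -
  let ?s = "x $ Inl 0"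
  let ?V = "vol A ?s" and ?A = "\<lambda>i. A i ?s"
  define r where "r i = sqrt (?A i / ?V)" for i
  define l where "l a = (case a of Inl b \<Rightarrow> if b = 0 then ?V else if b = 1 then r 1 else if b = 2 then r 2 else r 3
    | Inr i \<Rightarrow> r i)" for a :: "4 + 3"
  define L where "L = (\<lambda>v :: real^(4 + 3). \<chi> a. l a * v $ a)"
  have nz [simp]: "?A i \<noteq> 0" for i using A[of i] by simp
  have r: "r i > 0" "r i * r i = ?A i / ?V" for i
    using A[of i] by (simp_all add: r_def less_imp_le)
  have l: "l a \<noteq> 0" for a
    using r(1)[of 1] r(1)[of 2] r(1)[of 3] r(1) less_imp_neq[OF r(1), symmetric]
    by (auto simp: l_def split: sum.split)
  have l_simps: "l (Inl 0) = ?V" "l (Inl 1) = r 1" "l (Inl 2) = r 2" "l (Inl 3) = r 3" "l (Inr i) = r i" for i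
    by (simp_all add: l_def)
  have r3: "r 1 * (r 2 * r 3) = 1"
  proof -
    have "?V * (?V * ?V) = ?A 1 * ?A 2 * ?A 3"
      using vol_cube[of A ?s, OF A] by (simp add: power3_eq_cube)
    then have "?A 1 / ?V * (?A 2 / ?V * (?A 3 / ?V)) = 1"
      by (simp add: field_simps)
    then have "sqrt (?A 1 / ?V * (?A 2 / ?V * (?A 3 / ?V))) = 1" by simp
    then show ?thesis by (simp only: r_def real_sqrt_mult)
  qed
  have q: "r i * (r i * (?V * c)) = ?A i * c" for i c
  proof -
    have "r i * (r i * (?V * c)) = r i * r i * ?V * c" by (simp only: mult.assoc)
    then show ?thesis by (simp only: r(2)) simp
  qed
  have "linear L"
    by (intro linearI) (auto simp: L_def vec_eq_iff algebra_simps)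
  moreover have "bij L"
  proof (rule bijI')
    show "L v = L w \<longleftrightarrow> v = w" for v w
      using l by (auto simp: L_def vec_eq_iff)
    show "\<exists>w. v = L w" for v
      by (rule exI[of _ "\<chi> a. v $ a / l a"])
        (use l in \<open>auto simp: L_def vec_eq_iff\<close>)
  qed
  moreover have "G2_form (simple_triple A) x vs = G2_form standard_triple 0 (map L vs)" for vs
    unfolding standard_triple_eq G2_form_simple g2_list_def L_def lin_covec_Cons coord_covec_diag
      list.map prod_list.Cons prod_list.Nil l_simps mult_1_right r3
    using r3 by (simp add: q mult_ac)
  ultimately show ?thesis by blast
qed

section \<open>Hodge star, codifferential and Laplacian of the form\<close>

lemma ext_deriv_zero: "ext_deriv (\<lambda>x vs. 0) = (\<lambda>x vs. 0)"
  by (auto simp: ext_deriv_def fun_eq_iff)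

lemma hodge_star_zero: "hodge_star g m (\<lambda>x vs. 0) = (\<lambda>x vs. 0)"
  by (auto simp: hodge_star_def fun_eq_iff Let_def)

lemma ext_deriv_G2_form_simple:
  assumes d: "\<And>i s. A i differentiable (at s)"
  shows "ext_deriv (G2_form (simple_triple A)) = (\<lambda>x vs. 0)"
proof
  fix x
  define C :: "((real \<Rightarrow> real) \<times> (4 + 3) list) list" where "C = [(\<lambda>s. 1, [Inr 1, Inr 2, Inr 3]),
     (\<lambda>s. - A 1 s, [Inr 1, Inl 0, Inl 1]), (\<lambda>s. - 1, [Inr 1, Inl 2, Inl 3]),
     (\<lambda>s. - A 2 s, [Inr 2, Inl 0, Inl 2]), (\<lambda>s. - 1, [Inr 2, Inl 3, Inl 1]),
     (\<lambda>s. - A 3 s, [Inr 3, Inl 0, Inl 3]), (\<lambda>s. - 1, [Inr 3, Inl 1, Inl 2])]"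
  have "ext_deriv (G2_form (simple_triple A)) x =
      lin_covec (map (\<lambda>(f, I). (deriv f (x $ Inl 0), Inl 0 # I)) C)"
  proof (rule ext_deriv_lin_covec)
    show "G2_form (simple_triple A) y = lin_covec (map (\<lambda>(f, I). (f (y $ Inl 0), I)) C)" for y
      by (simp add: G2_form_simple g2_list_def C_def)
    show "f differentiable (at (x $ Inl 0))" if "(f, I) \<in> set C" for f I
      using that d by (auto simp: C_def intro!: differentiable_minus)
  qed
  then show "ext_deriv (G2_form (simple_triple A)) x = (\<lambda>vs. 0)"
    by (simp add: C_def lin_covec_Cons coord_covec_not_distinct)
qed

text \<open>The coefficient functions and index lists of \<open>*\<phi>\<close>; those of \<open>dx\<^sub>j\<^sub>k\<^sub>t\<close> are \<open>- V / A\<^sub>i = - e\<^sup>-\<^sup>u\<close> with \<open>u = u\<^sub>i\<close>.\<close>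

definition star3 :: "(3 \<Rightarrow> real \<Rightarrow> real) \<Rightarrow> ((real \<Rightarrow> real) \<times> (4 + 3) list) list" where
  "star3 A = [(vol A, [Inl 0, Inl 1, Inl 2, Inl 3]),
     (\<lambda>s. - exp (- log_ratio A 1 s), [Inl 2, Inl 3, Inr 2, Inr 3]), (\<lambda>s. - vol A s, [Inl 0, Inl 1, Inr 2, Inr 3]),
     (\<lambda>s. - exp (- log_ratio A 2 s), [Inl 3, Inl 1, Inr 3, Inr 1]), (\<lambda>s. - vol A s, [Inl 0, Inl 2, Inr 3, Inr 1]),
     (\<lambda>s. - exp (- log_ratio A 3 s), [Inl 1, Inl 2, Inr 1, Inr 2]), (\<lambda>s. - vol A s, [Inl 0, Inl 3, Inr 1, Inr 2])]"

lemma hodge_star_G2_form_simple: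
  assumes A: "\<And>i s. A i s > 0"
  shows "hodge_star (G2_metric (G2_form (simple_triple A))) (G2_volume (G2_form (simple_triple A)))
      (G2_form (simple_triple A)) x = lin_covec (map (\<lambda>(f, I). (f (x $ Inl 0), I)) (star3 A))"
proof -
  let ?s = "x $ Inl 0"
  let ?V = "vol A ?s" and ?A = "\<lambda>i. A i ?s"
  \<comment> \<open>The complementary lists are ordered so that every \<open>I @ J\<close> is an
    even permutation of the coordinates.\<close>
  define T :: "(real \<times> (4 + 3) list \<times> (4 + 3) list) list" where
    "T = [(1, [Inr 1, Inr 2, Inr 3], [Inl 0, Inl 1, Inl 2, Inl 3]),
     (- ?A 1, [Inr 1, Inl 0, Inl 1], [Inl 2, Inl 3, Inr 2, Inr 3]), (- 1, [Inr 1, Inl 2, Inl 3], [Inl 0, Inl 1, Inr 2, Inr 3]),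
     (- ?A 2, [Inr 2, Inl 0, Inl 2], [Inl 3, Inl 1, Inr 3, Inr 1]), (- 1, [Inr 2, Inl 3, Inl 1], [Inl 0, Inl 2, Inr 3, Inr 1]),
     (- ?A 3, [Inr 3, Inl 0, Inl 3], [Inl 1, Inl 2, Inr 1, Inr 2]), (- 1, [Inr 3, Inl 1, Inl 2], [Inl 0, Inl 3, Inr 1, Inr 2])]"
  have nz [simp]: "?A i \<noteq> 0" for i using A[of i ?s] by simp
  have cube: "?V * (?V * ?V) = ?A 1 * (?A 2 * ?A 3)"
    using vol_cube[of A ?s, OF A] by (simp add: power3_eq_cube)
  have *: "?V / ?A 1 * (?V / ?A 2 * (?V / ?A 3)) = 1"
  proof -
    have "?V / ?A 1 * (?V / ?A 2 * (?V / ?A 3)) = ?V * (?V * ?V) / (?A 1 * (?A 2 * ?A 3))" by simp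
    then show ?thesis unfolding cube by simp
  qed
  have **: "a * (?V / a * (1 / ?V\<^sup>2 * (?V / a))) * ?V = ?V / a" if "a \<noteq> 0" for a
    using that by (simp add: power2_eq_square)
  have e: "exp (- log_ratio A i ?s) = ?V / ?A i" for i
    using exp_log_ratio[of A i ?s, OF A] by (simp add: exp_minus)
  have "hodge_star (G2_metric (G2_form (simple_triple A))) (G2_volume (G2_form (simple_triple A)))
      (G2_form (simple_triple A)) x = lin_covec (map (\<lambda>(c, I, J).
        (c * (\<Prod>a\<leftarrow>I. 1 / gram7 A ?s a) * ?V * list_sign pos7 (I @ J), J)) T)"
  proof (rule hodge_star_diag[OF inj_pos7 idx7])
    show "gram7 A ?s a > 0" for a using A by (rule gram7_pos)
    show "G2_form (simple_triple A) x = lin_covec (map (\<lambda>(c, I, J). (c, I)) T)"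
      by (simp add: T_def G2_form_simple g2_list_def)
    show "list_all (\<lambda>(c, I, J). distinct (I @ J) \<and> length (I @ J) = CARD(4 + 3)) T"
      by (simp add: T_def)
  qed (use A in \<open>auto simp: G2_metric_simple G2_volume_simple\<close>)
  also have "map (\<lambda>(c, I, J). (c * (\<Prod>a\<leftarrow>I. 1 / gram7 A ?s a) * ?V * list_sign pos7 (I @ J), J)) T =
      map (\<lambda>(f, I). (f ?s, I)) (star3 A)"
    unfolding T_def star3_def list.map prod.case prod_list.Cons prod_list.Nil gram7_simps gram4_simps
      append.simps list_sign_Cons[OF inj_pos7] list_sign.simps(1) insert_sign.simps pos7_less if_True if_False
      e mult_1_right
    using * **[of "?A 1"] **[of "?A 2"] **[of "?A 3"]
    by (simp add: mult_ac)
  finally show ?thesis .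
qed

lemma exp_log_ratio_differentiable:
  assumes A: "\<And>i s. A i s > 0" and d: "\<And>i s. A i differentiable (at s)"
  shows "((\<lambda>s. - exp (- log_ratio A i s)) has_real_derivative
    deriv (log_ratio A i) s * exp (- log_ratio A i s)) (at s)"
proof -
  have "(log_ratio A i has_real_derivative deriv (log_ratio A i) s) (at s)"
    using mean_log_differentiable(2)[OF A d] by (simp add: DERIV_deriv_iff_real_differentiable)
  then show ?thesis
    by (auto intro!: derivative_eq_intros)
qed

text \<open>The terms of \<open>star3\<close> with coefficient \<open>vol A\<close> already contain
  \<open>dx_0\<close> and are closed, so only the three exponentials contribute.\<close>

lemma ext_deriv_star_G2_form_simple:
  assumes A: "\<And>i s. A i s > 0" and d: "\<And>i s. A i differentiable (at s)"
    and \<psi>: "\<And>x. \<psi> x = lin_covec (map (\<lambda>(f, I). (f (x $ Inl 0), I)) (star3 A))"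
  shows "ext_deriv \<psi> x = lin_covec
    [(deriv (log_ratio A 1) (x $ Inl 0) * exp (- log_ratio A 1 (x $ Inl 0)), [Inl 0, Inl 2, Inl 3, Inr 2, Inr 3]),
     (deriv (log_ratio A 2) (x $ Inl 0) * exp (- log_ratio A 2 (x $ Inl 0)), [Inl 0, Inl 3, Inl 1, Inr 3, Inr 1]),
     (deriv (log_ratio A 3) (x $ Inl 0) * exp (- log_ratio A 3 (x $ Inl 0)), [Inl 0, Inl 1, Inl 2, Inr 1, Inr 2])]"
proof -
  note e = exp_log_ratio_differentiable[of A, OF A d]
  have v: "vol A differentiable (at s)" for s
    using mean_log_differentiable(3)[OF A d] .
  have "ext_deriv \<psi> x = lin_covec (map (\<lambda>(f, I). (deriv f (x $ Inl 0), Inl 0 # I)) (star3 A))"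
  proof (rule ext_deriv_lin_covec[OF \<psi>])
    show "f differentiable (at (x $ Inl 0))" if "(f, I) \<in> set (star3 A)" for f I
    proof -
      have *: "(\<lambda>s. - exp (- log_ratio A i s)) differentiable (at (x $ Inl 0))" for i
        using e real_differentiable_def by blast
      have "(\<lambda>s. exp (- log_ratio A i s)) differentiable (at (x $ Inl 0))" for i
        using differentiable_minus[OF *] by simp
      then show ?thesis
        using that v by (auto simp: star3_def intro!: differentiable_minus)
    qed
  qed
  then show ?thesis
    by (simp add: star3_def lin_covec_Cons coord_covec_not_distinct DERIV_imp_deriv[OF e])
qed

text \<open>The sign \<open>(-1) ^ (7 * 4 + 1)\<close> of the codifferential and the sign of each
  reordering are both -1, so \<open>flux\<close> appears with a plus sign.\<close>

lemma codiff_G2_form_simple: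
  assumes A: "\<And>i s. A i s > 0" and d: "\<And>i s. A i differentiable (at s)"
  shows "codiff (G2_metric (G2_form (simple_triple A))) (G2_volume (G2_form (simple_triple A))) 3
      (G2_form (simple_triple A)) x = lin_covec (map (\<lambda>(f, I). (f (x $ Inl 0), I))
    [(flux A 1, [Inr 1, Inl 1]), (flux A 2, [Inr 2, Inl 2]), (flux A 3, [Inr 3, Inl 3])])"
proof -
  let ?s = "x $ Inl 0"
  let ?V = "vol A ?s" and ?A = "\<lambda>i. A i ?s" and ?\<phi> = "G2_form (simple_triple A)"
  let ?u = "\<lambda>i. deriv (log_ratio A i) ?s"
  let ?star = "hodge_star (G2_metric ?\<phi>) (G2_volume ?\<phi>)"
  have nz [simp]: "?A i \<noteq> 0" for i using A[of i ?s] by simp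
  have cube: "?V * (?V * ?V) = ?A 1 * (?A 2 * ?A 3)"
    using vol_cube[of A ?s, OF A] by (simp add: power3_eq_cube)
  have e: "exp (- log_ratio A i ?s) = ?V / ?A i" for i
    using exp_log_ratio[of A i ?s, OF A] by (simp add: exp_minus)
  define T :: "(real \<times> (4 + 3) list \<times> (4 + 3) list) list" where
    "T = [(?u 1 * exp (- log_ratio A 1 ?s), [Inl 0, Inl 2, Inl 3, Inr 2, Inr 3], [Inr 1, Inl 1]),
     (?u 2 * exp (- log_ratio A 2 ?s), [Inl 0, Inl 3, Inl 1, Inr 3, Inr 1], [Inr 2, Inl 2]),
     (?u 3 * exp (- log_ratio A 3 ?s), [Inl 0, Inl 1, Inl 2, Inr 1, Inr 2], [Inr 3, Inl 3])]"
  have "?star (ext_deriv (?star ?\<phi>)) x = lin_covec (map (\<lambda>(c, I, J).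
        (c * (\<Prod>a\<leftarrow>I. 1 / gram7 A ?s a) * ?V * list_sign pos7 (I @ J), J)) T)"
  proof (rule hodge_star_diag[OF inj_pos7 idx7])
    show "gram7 A ?s a > 0" for a using A by (rule gram7_pos)
    show "ext_deriv (?star ?\<phi>) x = lin_covec (map (\<lambda>(c, I, J). (c, I)) T)"
      unfolding ext_deriv_star_G2_form_simple[OF A d hodge_star_G2_form_simple[OF A]]
      by (simp add: T_def)
    show "list_all (\<lambda>(c, I, J). distinct (I @ J) \<and> length (I @ J) = CARD(4 + 3)) T"
      by (simp add: T_def)
  qed (use A in \<open>auto simp: G2_metric_simple G2_volume_simple\<close>)
  also have "map (\<lambda>(c, I, J). (c * (\<Prod>a\<leftarrow>I. 1 / gram7 A ?s a) * ?V * list_sign pos7 (I @ J), J)) T =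
      map (\<lambda>(f, I). (- f ?s, I))
        [(flux A 1, [Inr 1, Inl 1]), (flux A 2, [Inr 2, Inl 2]), (flux A 3, [Inr 3, Inl 3])]"
  proof -
    \<comment> \<open>The left side is \<open>- p * V^4 / (a * b^2 * c^2)\<close>; two uses of
      \<open>V^3 = a * b * c\<close> turn it into the right side.\<close>
    have *: "p * (?V / a) * (1 / ?V\<^sup>2 * (1 / (b / ?V) * (1 / (c / ?V) * (1 / (b / ?V) * (1 / (c / ?V) * 1))))) * ?V * - 1 =
        - (p * a / ?V\<^sup>2)"
      if "?V * (?V * ?V) = a * (b * c)" "a \<noteq> 0" "b \<noteq> 0" "c \<noteq> 0" for p a b c
    proof -
      have "p * (?V / a) * (1 / ?V\<^sup>2 * (1 / (b / ?V) * (1 / (c / ?V) * (1 / (b / ?V) * (1 / (c / ?V) * 1))))) * ?V * - 1 =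
          - (p * a * ((?V * (?V * ?V)) / (a * (b * c)))\<^sup>2 / ?V\<^sup>2)"
        using that(2) by (simp add: power2_eq_square field_simps)
      then show ?thesis using that(2-4) by (simp add: that(1))
    qed
    have c: "?V * (?V * ?V) = ?A 2 * (?A 3 * ?A 1)" "?V * (?V * ?V) = ?A 3 * (?A 1 * ?A 2)"
      using cube by (simp_all add: mult_ac)
    note c1 = *[OF cube nz nz nz] and c2 = *[OF c(1) nz nz nz] and c3 = *[OF c(2) nz nz nz]
    have "list_sign pos7 ([Inl 0, Inl 2, Inl 3, Inr 2, Inr 3] @ [Inr 1, Inl 1]) = - 1"
      "list_sign pos7 ([Inl 0, Inl 3, Inl 1, Inr 3, Inr 1] @ [Inr 2, Inl 2]) = - 1"
      "list_sign pos7 ([Inl 0, Inl 1, Inl 2, Inr 1, Inr 2] @ [Inr 3, Inl 3]) = - 1"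
      by (simp_all only: append.simps list_sign_Cons[OF inj_pos7] list_sign.simps(1) insert_sign.simps
        pos7_less if_True if_False)
    then show ?thesis
      by (simp only: T_def list.map prod.case prod_list.Cons prod_list.Nil gram7_simps gram4_simps
        flux_def e c1 c2 c3)
  qed
  finally show ?thesis
    unfolding codiff_def by (simp add: lin_covec_Cons fun_eq_iff)
qed

definition laplacian_list :: "(3 \<Rightarrow> real \<Rightarrow> real) \<Rightarrow> real \<Rightarrow> (real \<times> (4 + 3) list) list" where
  "laplacian_list A s = [(deriv (flux A 1) s, [Inl 0, Inr 1, Inl 1]),
     (deriv (flux A 2) s, [Inl 0, Inr 2, Inl 2]), (deriv (flux A 3) s, [Inl 0, Inr 3, Inl 3])]"

text \<open>The form is closed, so only the exterior derivative of its codifferential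
  remains.\<close>

lemma hodge_laplacian_G2_form_simple:
  assumes A: "\<And>i s. A i s > 0" and d: "\<And>i s. A i differentiable (at s)"
    and f: "\<And>i s. flux A i differentiable (at s)"
  shows "hodge_laplacian (G2_metric (G2_form (simple_triple A))) (G2_volume (G2_form (simple_triple A))) 3
      (G2_form (simple_triple A)) x = lin_covec (laplacian_list A (x $ Inl 0))"
proof -
  let ?C = "[(flux A 1, [Inr 1, Inl 1]), (flux A 2, [Inr 2, Inl 2]), (flux A 3, [Inr 3, Inl 3])]"
  have "codiff g m 4 (\<lambda>x vs. 0) = (\<lambda>x vs. 0)" for g and m :: "(real^(4 + 3)) form"
    by (simp add: codiff_def hodge_star_zero ext_deriv_zero)
  moreover have "ext_deriv (codiff (G2_metric (G2_form (simple_triple A)))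
      (G2_volume (G2_form (simple_triple A))) 3 (G2_form (simple_triple A))) x =
    lin_covec (map (\<lambda>(f, I). (deriv f (x $ Inl 0), Inl 0 # I)) ?C)"
    by (rule ext_deriv_lin_covec[OF codiff_G2_form_simple[OF A d]]) (use f in auto)
  ultimately show ?thesis
    by (simp add: hodge_laplacian_def ext_deriv_G2_form_simple[OF d] laplacian_list_def)
qed

lemma torsion_free_standard_star:
  "ext_deriv (hodge_star (G2_metric (G2_form standard_triple)) (G2_volume (G2_form standard_triple))
     (G2_form standard_triple)) = (\<lambda>x vs. 0)"
proof
  fix x
  have "deriv (log_ratio (\<lambda>i s. 1) i) s = 0" for i s
    by (simp add: log_ratio_def[abs_def] mean_log_def)
  then show "ext_deriv (hodge_star (G2_metric (G2_form standard_triple)) (G2_volume (G2_form standard_triple))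
     (G2_form standard_triple)) x = (\<lambda>vs. 0)"
    unfolding standard_triple_eq
    by (subst ext_deriv_star_G2_form_simple[where A = "\<lambda>i s. 1"])
      (auto simp: hodge_star_G2_form_simple lin_covec_Cons)
qed

section \<open>Smooth functions\<close>

text \<open>Sets with enough points in every coordinate direction for derivatives within them to be unique.\<close>

definition ample :: "'a::euclidean_space set \<Rightarrow> bool" where
  "ample S \<longleftrightarrow> (\<forall>x\<in>S. \<forall>i\<in>Basis. \<forall>e>0. \<exists>d. 0 < \<bar>d\<bar> \<and> \<bar>d\<bar> < e \<and> x + d *\<^sub>R i \<in> S)"

lemma ample_open:
  assumes "open S" shows "ample S"
  unfolding ample_def
proof (intro ballI allI impI)
  fix x i :: 'a and e :: real
  assume x: "x \<in> S" and i: "i \<in> Basis" and e: "e > 0"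
  obtain r where r: "r > 0" "ball x r \<subseteq> S"
    using assms x by (auto simp: open_contains_ball)
  define d where "d = min e r / 2"
  have d: "0 < d" "d < e" "d < r" using e r by (auto simp: d_def)
  then have "x + d *\<^sub>R i \<in> ball x r" using i by (simp add: dist_norm)
  then show "\<exists>d. 0 < \<bar>d\<bar> \<and> \<bar>d\<bar> < e \<and> x + d *\<^sub>R i \<in> S"
    using d r by (intro exI[of _ d]) auto
qed

lemma ample_UNIV [simp]: "ample UNIV"
  by (rule ample_open) simp

lemma ample_halfspace: "ample ({0..} \<times> (UNIV :: 'a::euclidean_space set) :: (real \<times> 'a) set)"
  unfolding ample_def
proof (intro ballI allI impI)
  fix p i :: "real \<times> 'a" and e :: real
  assume p: "p \<in> {0..} \<times> UNIV" and i: "i \<in> Basis" and e: "e > 0"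
  have "0 \<le> fst i" using i by (auto simp: Basis_prod_def)
  then have "p + (e / 2) *\<^sub>R i \<in> {0..} \<times> UNIV"
    using p e by (cases p; cases i) auto
  then show "\<exists>d. 0 < \<bar>d\<bar> \<and> \<bar>d\<bar> < e \<and> p + d *\<^sub>R i \<in> {0..} \<times> UNIV"
    using e by (intro exI[of _ "e / 2"]) auto
qed

text \<open>\<open>frechet_derivative\<close> selects some derivative within \<open>S\<close>; on an
  ample set there is only one, so any computed derivative is the selected one.\<close>

lemma frechet_derivative_ample:
  assumes "ample S" "x \<in> S" "(f has_derivative D) (at x within S)"
  shows "frechet_derivative f (at x within S) = D"
proof (rule frechet_derivative_unique_within)
  show "(f has_derivative frechet_derivative f (at x within S)) (at x within S)"
    using assms(3) by (simp add: frechet_derivative_works[symmetric] differentiableI)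
qed (use assms in \<open>auto simp: ample_def\<close>)

lemma has_derivative_cong_on:
  assumes "\<And>y. y \<in> S \<Longrightarrow> f y = g y" "x \<in> S"
  shows "(f has_derivative D) (at x within S) \<longleftrightarrow> (g has_derivative D) (at x within S)"
  using assms has_derivative_transform[of x S g f D] has_derivative_transform[of x S f g D] by auto

lemma iter_deriv_cong:
  assumes "\<And>y. y \<in> S \<Longrightarrow> f y = g y" "x \<in> S"
  shows "iter_deriv S vs f x = iter_deriv S vs g x"
  using assms(2)
proof (induction vs arbitrary: x)
  case (Cons v vs)
  then show ?case
    by (simp add: frechet_derivative_def has_derivative_cong_on[of S "iter_deriv S vs f" "iter_deriv S vs g"])
qed (use assms in simp)

lemma smooth_on_cong:
  assumes "\<And>y. y \<in> S \<Longrightarrow> f y = g y"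
  shows "smooth_on S f \<longleftrightarrow> smooth_on S g"
proof -
  have "(iter_deriv S vs f has_derivative D) (at x within S) \<longleftrightarrow>
      (iter_deriv S vs g has_derivative D) (at x within S)" if "x \<in> S" for vs x D
    by (rule has_derivative_cong_on[OF iter_deriv_cong[OF assms] that])
  then show ?thesis
    unfolding smooth_on_def differentiable_def by simp
qed

lemma iter_deriv_append: "iter_deriv S (vs @ ws) f = iter_deriv S vs (iter_deriv S ws f)"
  by (induction vs) auto

lemma smooth_on_deriv:
  "smooth_on S f \<Longrightarrow> smooth_on S (\<lambda>x. frechet_derivative f (at x within S) v)"
  unfolding smooth_on_def
proof (intro allI ballI)
  fix vs x assume "\<forall>vs. \<forall>x\<in>S. iter_deriv S vs f differentiable (at x within S)" and x: "x \<in> S"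
  then have "iter_deriv S (vs @ [v]) f differentiable (at x within S)" by blast
  then show "iter_deriv S vs (\<lambda>x. frechet_derivative f (at x within S) v) differentiable (at x within S)"
    by (simp only: iter_deriv_append iter_deriv.simps)
qed

lemma smooth_on_has_derivative:
  assumes "smooth_on S f" "x \<in> S"
  shows "(f has_derivative frechet_derivative f (at x within S)) (at x within S)"
  using assms(1)[unfolded smooth_on_def, rule_format, OF assms(2), of "[]"]
  by (simp add: frechet_derivative_works)

lemma smooth_on_imp_continuous_on: "smooth_on S f \<Longrightarrow> continuous_on S f"
  unfolding continuous_on_eq_continuous_within
  by (intro ballI has_derivative_continuous[OF smooth_on_has_derivative])

text \<open>The iterated derivatives of \<open>f\<close> all stay in the class \<open>P\<close>,
  hence are differentiable. Smoothness proofs then need only a class closed under differentiation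
  and no formulas for higher derivatives.\<close>

lemma smooth_on_coinduct:
  fixes f :: "'a::euclidean_space \<Rightarrow> 'b::real_normed_vector"
  assumes S: "ample S" and f: "P f"
    and step: "\<And>g. P g \<Longrightarrow> \<exists>D. (\<forall>x\<in>S. (g has_derivative D x) (at x within S)) \<and> (\<forall>v. P (\<lambda>x. D x v))"
  shows "smooth_on S f"
proof -
  have *: "\<exists>g. P g \<and> (\<forall>x\<in>S. iter_deriv S vs f x = g x)" for vs
  proof (induction vs)
    case (Cons v vs)
    then obtain g where g: "P g" "\<forall>x\<in>S. iter_deriv S vs f x = g x" by blast
    obtain D where D: "\<And>x. x \<in> S \<Longrightarrow> (g has_derivative D x) (at x within S)" "\<And>v. P (\<lambda>x. D x v)"
      using step[OF g(1)] by blast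
    have "iter_deriv S (v # vs) f x = D x v" if "x \<in> S" for x
    proof -
      have "(iter_deriv S vs f has_derivative D x) (at x within S)"
        using has_derivative_cong_on[of S "iter_deriv S vs f" g x "D x"] g D(1) that by blast
      then show ?thesis by (simp add: frechet_derivative_ample[OF S that])
    qed
    then show ?case using D(2)[of v] by blast
  qed (use f in auto)
  show ?thesis
    unfolding smooth_on_def
  proof (intro allI ballI)
    fix vs x assume x: "x \<in> S"
    obtain g where g: "P g" "\<forall>x\<in>S. iter_deriv S vs f x = g x" using * by blast
    then obtain D where "(g has_derivative D) (at x within S)" using step[OF g(1)] x by blast
    then show "iter_deriv S vs f differentiable (at x within S)"
      using has_derivative_cong_on[of S "iter_deriv S vs f" g x D] g x unfolding differentiable_def by blast
  qed
qed

text \<open>The class consists of the smooth functions composed with this one affine map; the chain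
  rule stays inside because the map has constant derivative. Allowing \<open>S\<close> to be sent
  into any \<open>T\<close> lets smoothness on a closed half space be pulled back to an open
  set.\<close>

lemma smooth_on_compose_affine:
  fixes f :: "'b::real_normed_vector \<Rightarrow> 'c::real_normed_vector"
    and L :: "'a::euclidean_space \<Rightarrow> 'b"
  assumes S: "ample S" and f: "smooth_on T f" and L: "linear L" and ST: "\<And>x. x \<in> S \<Longrightarrow> L x + c \<in> T"
  shows "smooth_on S (\<lambda>x. f (L x + c))"
proof (rule smooth_on_coinduct[OF S, where P = "\<lambda>h. \<exists>f. smooth_on T f \<and> h = (\<lambda>x. f (L x + c))"])
  show "\<exists>g. smooth_on T g \<and> (\<lambda>x. f (L x + c)) = (\<lambda>x. g (L x + c))" using f by blast
  fix g assume "\<exists>f. smooth_on T f \<and> g = (\<lambda>x. f (L x + c))"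
  then obtain f where f: "smooth_on T f" "g = (\<lambda>x. f (L x + c))" by blast
  let ?D = "\<lambda>x v. frechet_derivative f (at (L x + c) within T) (L v)"
  have "((\<lambda>x. f (L x + c)) has_derivative ?D x) (at x within S)" if x: "x \<in> S" for x
  proof -
    have "((\<lambda>x. L x + c) has_derivative L) (at x within S)"
      using L by (auto intro!: derivative_eq_intros bounded_linear_imp_has_derivative simp: linear_conv_bounded_linear)
    moreover have "(f has_derivative frechet_derivative f (at (L x + c) within T))
        (at (L x + c) within (\<lambda>x. L x + c) ` S)"
      by (rule has_derivative_subset[OF smooth_on_has_derivative[OF f(1) ST[OF x]]]) (use ST in auto)
    ultimately show ?thesis
      by (rule has_derivative_in_compose)
  qed
  moreover have "\<exists>h. smooth_on T h \<and> (\<lambda>x. ?D x v) = (\<lambda>x. h (L x + c))" for v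
    by (intro exI[of _ "\<lambda>y. frechet_derivative f (at y within T) (L v)"] conjI smooth_on_deriv[OF f(1)] refl)
  ultimately show "\<exists>D. (\<forall>x\<in>S. (g has_derivative D x) (at x within S)) \<and>
      (\<forall>v. \<exists>f. smooth_on T f \<and> (\<lambda>x. D x v) = (\<lambda>x. f (L x + c)))"
    unfolding f(2) by (intro exI[of _ ?D] conjI ballI allI)
qed

text \<open>The least class that contains the smooth functions and is closed under the operations
  used here. Derivatives remain in it, so all closure properties follow from one
  coinduction.\<close>

inductive smooth_alg :: "'a::euclidean_space set \<Rightarrow> ('a \<Rightarrow> real) \<Rightarrow> bool" for S where
  base: "smooth_on S f \<Longrightarrow> smooth_alg S f"
| const: "smooth_alg S (\<lambda>x. c)"
| add: "smooth_alg S f \<Longrightarrow> smooth_alg S g \<Longrightarrow> smooth_alg S (\<lambda>x. f x + g x)"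
| mult: "smooth_alg S f \<Longrightarrow> smooth_alg S g \<Longrightarrow> smooth_alg S (\<lambda>x. f x * g x)"
| inverse: "smooth_alg S f \<Longrightarrow> (\<And>x. x \<in> S \<Longrightarrow> f x > 0) \<Longrightarrow> smooth_alg S (\<lambda>x. inverse (f x))"
| ln: "smooth_alg S f \<Longrightarrow> (\<And>x. x \<in> S \<Longrightarrow> f x > 0) \<Longrightarrow> smooth_alg S (\<lambda>x. ln (f x))"
| exp: "smooth_alg S f \<Longrightarrow> smooth_alg S (\<lambda>x. exp (f x))"

lemma smooth_alg_imp_smooth_on:
  assumes S: "ample S" and "smooth_alg S f"
  shows "smooth_on S f"
proof (rule smooth_on_coinduct[OF S, where P = "smooth_alg S"])
  fix g assume "smooth_alg S g"
  then show "\<exists>D. (\<forall>x\<in>S. (g has_derivative D x) (at x within S)) \<and> (\<forall>v. smooth_alg S (\<lambda>x. D x v))"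
  proof (induction rule: smooth_alg.induct)
    case (base f)
    then show ?case
      by (intro exI[of _ "\<lambda>x. frechet_derivative f (at x within S)"])
        (auto intro: smooth_on_has_derivative smooth_alg.base smooth_on_deriv)
  next
    case (const c)
    show ?case
      by (intro exI[of _ "\<lambda>x v. 0"]) (auto intro: smooth_alg.const)
  next
    case (add f g)
    then obtain D E where DE: "\<forall>x\<in>S. (f has_derivative D x) (at x within S)" "\<And>v. smooth_alg S (\<lambda>x. D x v)"
      "\<forall>x\<in>S. (g has_derivative E x) (at x within S)" "\<And>v. smooth_alg S (\<lambda>x. E x v)" by blast
    then have "\<forall>x\<in>S. ((\<lambda>x. f x + g x) has_derivative (\<lambda>v. D x v + E x v)) (at x within S)"
      by (auto intro: has_derivative_add)
    moreover have "smooth_alg S (\<lambda>x. D x v + E x v)" for v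
      by (rule smooth_alg.add[OF DE(2,4)])
    ultimately show ?case by (intro exI[of _ "\<lambda>x v. D x v + E x v"]) blast
  next
    case (mult f g)
    then obtain D E where DE: "\<forall>x\<in>S. (f has_derivative D x) (at x within S)" "\<And>v. smooth_alg S (\<lambda>x. D x v)"
      "\<forall>x\<in>S. (g has_derivative E x) (at x within S)" "\<And>v. smooth_alg S (\<lambda>x. E x v)" by blast
    then have "\<forall>x\<in>S. ((\<lambda>x. f x * g x) has_derivative (\<lambda>v. f x * E x v + D x v * g x)) (at x within S)"
      by (auto intro: has_derivative_mult)
    moreover have "smooth_alg S (\<lambda>x. f x * E x v + D x v * g x)" for v
      by (rule smooth_alg.add[OF smooth_alg.mult[OF mult.hyps(1) DE(4)] smooth_alg.mult[OF DE(2) mult.hyps(2)]])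
    ultimately show ?case by (intro exI[of _ "\<lambda>x v. f x * E x v + D x v * g x"]) blast
  next
    case (inverse f)
    then obtain D where D: "\<forall>x\<in>S. (f has_derivative D x) (at x within S)" "\<And>v. smooth_alg S (\<lambda>x. D x v)"
      by blast
    have "((\<lambda>x. inverse (f x)) has_derivative (\<lambda>v. -1 * (inverse (f x) * inverse (f x)) * D x v)) (at x within S)"
      if "x \<in> S" for x
    proof -
      have "f x \<noteq> 0" using inverse that by force
      from Deriv.has_derivative_inverse[where f = f and x = x, OF this, of "D x" S] D(1) that
      show ?thesis by (simp add: mult_ac)
    qed
    moreover have "smooth_alg S (\<lambda>x. -1 * (inverse (f x) * inverse (f x)) * D x v)" for v
      using inverse.hyps by (intro smooth_alg.mult smooth_alg.inverse smooth_alg.const D(2)) auto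
    ultimately show ?case by (intro exI[of _ "\<lambda>x v. -1 * (inverse (f x) * inverse (f x)) * D x v"]) blast
  next
    case (ln f)
    then obtain D where D: "\<forall>x\<in>S. (f has_derivative D x) (at x within S)" "\<And>v. smooth_alg S (\<lambda>x. D x v)"
      by blast
    have "((\<lambda>x. ln (f x)) has_derivative (\<lambda>v. inverse (f x) * D x v)) (at x within S)"
      if "x \<in> S" for x
      using has_derivative_ln[of f x "D x" S] D(1) that ln by (simp add: field_simps)
    moreover have "smooth_alg S (\<lambda>x. inverse (f x) * D x v)" for v
      using ln.hyps by (intro smooth_alg.mult smooth_alg.inverse D(2)) auto
    ultimately show ?case by (intro exI[of _ "\<lambda>x v. inverse (f x) * D x v"]) blast
  next
    case (exp f)
    then obtain D where D: "\<forall>x\<in>S. (f has_derivative D x) (at x within S)" "\<And>v. smooth_alg S (\<lambda>x. D x v)"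
      by blast
    have "((\<lambda>x. exp (f x)) has_derivative (\<lambda>v. exp (f x) * D x v)) (at x within S)"
      if "x \<in> S" for x
      using has_derivative_exp[of f "D x" x S] D(1) that by (simp add: mult_ac)
    moreover have "smooth_alg S (\<lambda>x. exp (f x) * D x v)" for v
      using exp.hyps by (intro smooth_alg.mult smooth_alg.exp D(2)) auto
    ultimately show ?case by (intro exI[of _ "\<lambda>x v. exp (f x) * D x v"]) blast
  qed
qed (fact assms)

lemma smooth_on_const: "ample S \<Longrightarrow> smooth_on S (\<lambda>x. c :: real)"
  and smooth_on_add: "ample S \<Longrightarrow> smooth_on S f \<Longrightarrow> smooth_on S g \<Longrightarrow> smooth_on S (\<lambda>x. f x + g x :: real)"
  and smooth_on_mult: "ample S \<Longrightarrow> smooth_on S f \<Longrightarrow> smooth_on S g \<Longrightarrow> smooth_on S (\<lambda>x. f x * g x :: real)"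
  and smooth_on_inverse: "ample S \<Longrightarrow> smooth_on S f \<Longrightarrow> (\<And>x. x \<in> S \<Longrightarrow> f x > 0) \<Longrightarrow>
    smooth_on S (\<lambda>x. inverse (f x) :: real)"
  and smooth_on_ln: "ample S \<Longrightarrow> smooth_on S f \<Longrightarrow> (\<And>x. x \<in> S \<Longrightarrow> f x > 0) \<Longrightarrow>
    smooth_on S (\<lambda>x. ln (f x) :: real)"
  and smooth_on_exp: "ample S \<Longrightarrow> smooth_on S f \<Longrightarrow> smooth_on S (\<lambda>x. exp (f x) :: real)"
  by (auto intro!: smooth_alg_imp_smooth_on intro: smooth_alg.intros)

lemma smooth_on_cmult: "ample S \<Longrightarrow> smooth_on S f \<Longrightarrow> smooth_on S (\<lambda>x. c * f x :: real)"
  by (intro smooth_on_mult smooth_on_const)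

lemma smooth_on_diff:
  assumes "ample S" "smooth_on S f" "smooth_on S g" shows "smooth_on S (\<lambda>x. f x - g x :: real)"
  using smooth_on_add[OF assms(1,2) smooth_on_cmult[OF assms(1,3), of "-1"]] by simp

lemma smooth_on_minus:
  assumes "ample S" "smooth_on S f" shows "smooth_on S (\<lambda>x. - f x :: real)"
  using smooth_on_cmult[OF assms, of "-1"] by simp

lemma smooth_on_divide:
  assumes "ample S" "smooth_on S f" "smooth_on S g" "\<And>x. x \<in> S \<Longrightarrow> g x > 0"
  shows "smooth_on S (\<lambda>x. f x / g x :: real)"
  using smooth_on_mult[OF assms(1,2) smooth_on_inverse[OF assms(1,3,4)]] by (simp add: field_simps)

lemma smooth_on_sum:
  assumes "ample S" "\<And>i. i \<in> I \<Longrightarrow> smooth_on S (f i)"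
  shows "smooth_on S (\<lambda>x. \<Sum>i\<in>I. f i x :: real)"
proof (cases "finite I")
  case True
  then show ?thesis
    using assms(2) by (induction I) (auto intro: smooth_on_const smooth_on_add assms(1))
qed (simp add: smooth_on_const assms(1))

lemma smooth_on_linear:
  fixes L :: "'a::euclidean_space \<Rightarrow> 'b::real_normed_vector"
  assumes S: "ample S" and L: "linear L"
  shows "smooth_on S (\<lambda>x. L x + c)"
proof (rule smooth_on_coinduct[OF S, where P = "\<lambda>h. \<exists>L c. linear L \<and> h = (\<lambda>x. L x + c)"])
  fix g :: "'a \<Rightarrow> 'b" assume "\<exists>L c. linear L \<and> g = (\<lambda>x. L x + c)"
  then obtain L c where L: "linear L" "g = (\<lambda>x. L x + c)" by blast
  have "(g has_derivative L) (at x within S)" for x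
    using L by (auto intro!: derivative_eq_intros bounded_linear_imp_has_derivative simp: linear_conv_bounded_linear)
  moreover have "\<exists>M d. linear M \<and> (\<lambda>x. L v) = (\<lambda>x :: 'a. M x + d)" for v
    by (rule exI[of _ "\<lambda>x. 0"], rule exI[of _ "L v"]) (auto intro: linearI)
  ultimately show "\<exists>D. (\<forall>x\<in>S. (g has_derivative D x) (at x within S)) \<and>
      (\<forall>v. \<exists>L c. linear L \<and> (\<lambda>x. D x v) = (\<lambda>x. L x + c))"
    by (intro exI[of _ "\<lambda>x. L"]) auto
qed (use L in auto)

lemma smooth_on_real_deriv:
  fixes g :: "real \<Rightarrow> real"
  assumes "smooth_on UNIV g"
  shows "(g has_real_derivative deriv g s) (at s)" "smooth_on UNIV (deriv g)"
proof -
  have D: "(g has_derivative frechet_derivative g (at s)) (at s)" for s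
    using smooth_on_has_derivative[OF assms, of s] by simp
  have D': "(g has_real_derivative frechet_derivative g (at s) 1) (at s)" for s
  proof -
    have "(*) (frechet_derivative g (at s) 1) = frechet_derivative g (at s)"
    proof
      fix h
      have "frechet_derivative g (at s) (h *\<^sub>R 1) = h *\<^sub>R frechet_derivative g (at s) 1"
        by (rule linear_scale[OF has_derivative_linear[OF D]])
      then show "frechet_derivative g (at s) 1 * h = frechet_derivative g (at s) h"
        by (simp only: real_scaleR_def mult_1_right) (rule mult.commute)
    qed
    then show ?thesis
      unfolding has_field_derivative_def by (simp only: D)
  qed
  then show "(g has_real_derivative deriv g s) (at s)"
    by (simp only: DERIV_imp_deriv[OF D'])
  have "deriv g = (\<lambda>s. frechet_derivative g (at s) 1)"
    by (intro ext DERIV_imp_deriv D')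
  then show "smooth_on UNIV (deriv g)"
    using smooth_on_deriv[OF assms, of 1] by simp
qed

lemma smooth_on_real_higher_deriv:
  fixes g :: "real \<Rightarrow> real"
  shows "smooth_on UNIV g \<Longrightarrow> smooth_on UNIV ((deriv ^^ n) g)"
  by (induction n) (auto intro: smooth_on_real_deriv)

text \<open>The coinduction class is enlarged by constant factors because the derivative in
  direction \<open>v\<close> is \<open>v\<close> times the ordinary derivative.\<close>

lemma smooth_on_realI:
  fixes P :: "(real \<Rightarrow> real) \<Rightarrow> bool"
  assumes "P f" and step: "\<And>g. P g \<Longrightarrow> \<exists>g'. P g' \<and> (\<forall>s. (g has_real_derivative g' s) (at s))"
  shows "smooth_on UNIV f"
proof (rule smooth_on_coinduct[where P = "\<lambda>h. \<exists>g c. P g \<and> h = (\<lambda>s. c * g s)"])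
  show "\<exists>g c. P g \<and> f = (\<lambda>s. c * g s)"
    by (rule exI[of _ f], rule exI[of _ 1]) (use assms in auto)
  fix h assume "\<exists>g c. P g \<and> h = (\<lambda>s. c * g s)"
  then obtain g c where g: "P g" "h = (\<lambda>s. c * g s)" by blast
  obtain g' where g': "P g'" "\<forall>s. (g has_real_derivative g' s) (at s)" using step[OF g(1)] by blast
  have *: "(h has_derivative (\<lambda>v. (c * v) * g' s)) (at s)" for s
  proof -
    have "(*) (c * g' s) = (\<lambda>v. (c * v) * g' s)" by (simp add: fun_eq_iff)
    then show ?thesis
      using DERIV_cmult[OF g'(2)[rule_format], of c s] by (simp only: g(2) has_field_derivative_def)
  qed
  show "\<exists>D. (\<forall>x\<in>UNIV. (h has_derivative D x) (at x)) \<and> (\<forall>v. \<exists>g c. P g \<and> (\<lambda>x. D x v) = (\<lambda>s. c * g s))"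
    using g'(1) * by (intro exI[of _ "\<lambda>s v. (c * v) * g' s"]) auto
qed simp

text \<open>Each direction enters only through its component along \<open>a\<close>; this reduces
  convergence of all partial derivatives to one variable.\<close>

lemma iter_deriv_coordinate:
  fixes g :: "real \<Rightarrow> real"
  assumes "smooth_on UNIV g"
  shows "iter_deriv UNIV vs (\<lambda>x :: real^'n. c * g (x $ a)) =
    (\<lambda>x. c * (\<Prod>v\<leftarrow>vs. v $ a) * (deriv ^^ length vs) g (x $ a))"
proof (induction vs)
  case (Cons v vs)
  let ?c = "c * (\<Prod>v\<leftarrow>vs. v $ a)" and ?g = "(deriv ^^ length vs) g"
  have "(?g has_derivative (\<lambda>h. deriv ?g s * h)) (at s)" for s
    using smooth_on_real_deriv(1)[OF smooth_on_real_higher_deriv[OF assms]] by (simp add: has_field_derivative_def)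
  then have "((\<lambda>x. ?g (x $ a)) has_derivative (\<lambda>h. deriv ?g (x $ a) * h $ a)) (at x)" for x :: "real^'n"
    by (rule has_derivative_compose[rotated]) (auto intro!: bounded_linear_imp_has_derivative bounded_linear_vec_nth)
  then have "((\<lambda>x. ?c * ?g (x $ a)) has_derivative (\<lambda>h. ?c * (deriv ?g (x $ a) * h $ a))) (at x)" for x :: "real^'n"
    by (rule has_derivative_mult_right)
  then have "frechet_derivative (\<lambda>x :: real^'n. ?c * ?g (x $ a)) (at x) = (\<lambda>h. ?c * (deriv ?g (x $ a) * h $ a))" for x
    by (rule frechet_derivative_at[symmetric])
  then show ?case
    using Cons by (simp add: mult_ac)
qed simp

section \<open>Periodic functions on the half plane\<close>

text \<open>Time 0 is left out: on an open set all derivatives are two-sided, and the limit concerns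
  large times only.\<close>

definition half_plane :: "(real \<times> real) set" where "half_plane = {0<..} \<times> UNIV"

lemma mem_half_plane [simp]: "(t, x) \<in> half_plane \<longleftrightarrow> t > 0"
  by (simp add: half_plane_def)

lemma open_half_plane: "open half_plane"
  unfolding half_plane_def by (intro open_Times) auto

lemma ample_half_plane [simp]: "ample half_plane"
  by (rule ample_open[OF open_half_plane])

definition dx :: "(real \<times> real \<Rightarrow> real) \<Rightarrow> real \<times> real \<Rightarrow> real" where
  "dx f p = deriv (\<lambda>y. f (fst p, y)) (snd p)"

definition dt' :: "(real \<times> real \<Rightarrow> real) \<Rightarrow> real \<times> real \<Rightarrow> real" where
  "dt' f p = deriv (\<lambda>s. f (s, snd p)) (fst p)"

lemma smooth_half_plane_has_derivative:
  assumes "smooth_on half_plane f" "p \<in> half_plane"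
  shows "(f has_derivative frechet_derivative f (at p within half_plane)) (at p)"
  using smooth_on_has_derivative[OF assms] at_within_open[OF assms(2) open_half_plane] by simp

lemma dx_frechet:
  assumes f: "smooth_on half_plane f" and p: "t > 0"
  shows "((\<lambda>y. f (t, y)) has_real_derivative frechet_derivative f (at (t, x) within half_plane) (0, 1)) (at x)"
proof -
  let ?F = "frechet_derivative f (at (t, x) within half_plane)"
  have F: "(f has_derivative ?F) (at (t, x))"
    using smooth_half_plane_has_derivative[OF f, of "(t, x)"] p by simp
  have "((\<lambda>y. (t, y)) has_derivative (\<lambda>h. (0, h))) (at x)"
    by (auto intro!: derivative_eq_intros)
  from has_derivative_compose[OF this F] have "((\<lambda>y. f (t, y)) has_derivative (\<lambda>h. ?F (0, h))) (at x)" .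
  moreover have "(\<lambda>h. ?F (0, h)) = (*) (?F (0, 1))"
  proof
    fix h
    have "?F (h *\<^sub>R (0, 1)) = h *\<^sub>R ?F (0, 1)" by (rule linear_scale[OF has_derivative_linear[OF F]])
    then show "?F (0, h) = ?F (0, 1) * h" by (simp add: mult.commute[of h])
  qed
  ultimately show ?thesis by (simp only: has_field_derivative_def)
qed

lemma dt_frechet:
  assumes f: "smooth_on half_plane f" and p: "t > 0"
  shows "((\<lambda>s. f (s, x)) has_real_derivative frechet_derivative f (at (t, x) within half_plane) (1, 0)) (at t)"
proof -
  let ?F = "frechet_derivative f (at (t, x) within half_plane)"
  have F: "(f has_derivative ?F) (at (t, x))"
    using smooth_half_plane_has_derivative[OF f, of "(t, x)"] p by simp
  have "((\<lambda>s. (s, x)) has_derivative (\<lambda>h. (h, 0))) (at t)"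
    by (auto intro!: derivative_eq_intros)
  from has_derivative_compose[OF this F] have "((\<lambda>s. f (s, x)) has_derivative (\<lambda>h. ?F (h, 0))) (at t)" .
  moreover have "(\<lambda>h. ?F (h, 0)) = (*) (?F (1, 0))"
  proof
    fix h
    have "?F (h *\<^sub>R (1, 0)) = h *\<^sub>R ?F (1, 0)" by (rule linear_scale[OF has_derivative_linear[OF F]])
    then show "?F (h, 0) = ?F (1, 0) * h" by (simp add: mult.commute[of h])
  qed
  ultimately show ?thesis by (simp only: has_field_derivative_def)
qed

lemma dx_has_derivative:
  assumes "smooth_on half_plane f" "t > 0"
  shows "((\<lambda>y. f (t, y)) has_real_derivative dx f (t, x)) (at x)"
  using dx_frechet[OF assms, of x] DERIV_imp_deriv[OF dx_frechet[OF assms, of x]] by (simp only: dx_def fst_conv snd_conv)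

lemma dt_has_derivative:
  assumes "smooth_on half_plane f" "t > 0"
  shows "((\<lambda>s. f (s, x)) has_real_derivative dt' f (t, x)) (at t)"
  using dt_frechet[OF assms, of x] DERIV_imp_deriv[OF dt_frechet[OF assms, of x]] by (simp only: dt'_def fst_conv snd_conv)

lemma dx_eqI: "((\<lambda>y. f (t, y)) has_real_derivative d) (at x) \<Longrightarrow> dx f (t, x) = d"
  by (simp add: dx_def DERIV_imp_deriv)

lemma dt_eqI: "((\<lambda>s. f (s, x)) has_real_derivative d) (at t) \<Longrightarrow> dt' f (t, x) = d"
  by (simp add: dt'_def DERIV_imp_deriv)

lemma smooth_dx: assumes "smooth_on half_plane f" shows "smooth_on half_plane (dx f)"
proof -
  have "dx f p = frechet_derivative f (at p within half_plane) (0, 1)" if "p \<in> half_plane" for p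
  proof -
    obtain t x where p: "p = (t, x)" by force
    then have "t > 0" using that by simp
    then show ?thesis unfolding p by (rule dx_eqI[OF dx_frechet[OF assms]])
  qed
  then show ?thesis
    using smooth_on_cong[of half_plane "dx f" "\<lambda>p. frechet_derivative f (at p within half_plane) (0, 1)"]
      smooth_on_deriv[OF assms, of "(0, 1)"] by simp
qed

lemma smooth_dt: assumes "smooth_on half_plane f" shows "smooth_on half_plane (dt' f)"
proof -
  have "dt' f p = frechet_derivative f (at p within half_plane) (1, 0)" if "p \<in> half_plane" for p
  proof -
    obtain t x where p: "p = (t, x)" by force
    then have "t > 0" using that by simp
    then show ?thesis unfolding p by (rule dt_eqI[OF dt_frechet[OF assms]])
  qed
  then show ?thesis
    using smooth_on_cong[of half_plane "dt' f" "\<lambda>p. frechet_derivative f (at p within half_plane) (1, 0)"]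
      smooth_on_deriv[OF assms, of "(1, 0)"] by simp
qed

lemma dx_cong: "(\<And>y. f (t, y) = g (t, y)) \<Longrightarrow> dx f (t, x) = dx g (t, x)"
  by (simp add: dx_def)

definition periodic :: "(real \<times> real \<Rightarrow> real) \<Rightarrow> bool" where
  "periodic f \<longleftrightarrow> (\<forall>t>0. \<forall>x. f (t, x + 2 * pi) = f (t, x))"

definition nice :: "(real \<times> real \<Rightarrow> real) \<Rightarrow> bool" where
  "nice f \<longleftrightarrow> smooth_on half_plane f \<and> periodic f"

lemma nice_smooth: "nice f \<Longrightarrow> smooth_on half_plane f"
  by (simp add: nice_def)

lemma nice_periodic: "nice f \<Longrightarrow> t > 0 \<Longrightarrow> f (t, x + 2 * pi) = f (t, x)"
  by (simp add: nice_def periodic_def)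

lemma nice_const [intro, simp]: "nice (\<lambda>p. c)"
  by (simp add: nice_def periodic_def smooth_on_const)

lemma nice_add [intro]: "nice f \<Longrightarrow> nice g \<Longrightarrow> nice (\<lambda>p. f p + g p)"
  and nice_diff [intro]: "nice f \<Longrightarrow> nice g \<Longrightarrow> nice (\<lambda>p. f p - g p)"
  and nice_mult [intro]: "nice f \<Longrightarrow> nice g \<Longrightarrow> nice (\<lambda>p. f p * g p)"
  and nice_minus [intro]: "nice f \<Longrightarrow> nice (\<lambda>p. - f p)"
  and nice_exp [intro]: "nice f \<Longrightarrow> nice (\<lambda>p. exp (f p))"
  by (simp_all add: nice_def periodic_def smooth_on_add smooth_on_diff smooth_on_mult smooth_on_minus smooth_on_exp)

lemma nice_ln: "nice f \<Longrightarrow> (\<And>p. p \<in> half_plane \<Longrightarrow> f p > 0) \<Longrightarrow> nice (\<lambda>p. ln (f p))"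
  and nice_inverse: "nice f \<Longrightarrow> (\<And>p. p \<in> half_plane \<Longrightarrow> f p > 0) \<Longrightarrow> nice (\<lambda>p. inverse (f p))"
  by (simp_all add: nice_def periodic_def smooth_on_ln smooth_on_inverse)

lemma nice_power2 [intro]: "nice f \<Longrightarrow> nice (\<lambda>p. (f p)\<^sup>2)"
  by (simp add: power2_eq_square nice_mult)

lemma nice_sum [intro]: "(\<And>i. i \<in> I \<Longrightarrow> nice (f i)) \<Longrightarrow> nice (\<lambda>p. \<Sum>i\<in>I. f i p)"
  by (auto simp: nice_def periodic_def intro!: smooth_on_sum)

lemma nice_dx [intro]:
  assumes f: "nice f" shows "nice (dx f)"
proof -
  have "dx f (t, x + 2 * pi) = dx f (t, x)" if t: "t > 0" for t x
  proof -
    have "((\<lambda>y. f (t, y + 2 * pi)) has_real_derivative dx f (t, x + 2 * pi)) (at x)"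
      using DERIV_shift[of "\<lambda>y. f (t, y)" "dx f (t, x + 2 * pi)" x "2 * pi"]
        dx_has_derivative[OF nice_smooth[OF f] t, of "x + 2 * pi"] by simp
    then show ?thesis
      using nice_periodic[OF f t] dx_eqI[of f t "dx f (t, x + 2 * pi)" x] by simp
  qed
  then show ?thesis
    using smooth_dx f by (simp add: nice_def periodic_def)
qed

lemma nice_dt [intro]:
  assumes f: "nice f" shows "nice (dt' f)"
proof -
  have "dt' f (t, x + 2 * pi) = dt' f (t, x)" if t: "t > 0" for t x
  proof (rule dt_eqI)
    show "((\<lambda>s. f (s, x + 2 * pi)) has_real_derivative dt' f (t, x)) (at t)"
      by (rule has_field_derivative_transform_within_open[OF dt_has_derivative[OF nice_smooth[OF f] t, of x], of "{0<..}"])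
        (use t nice_periodic[OF f] in auto)
  qed
  then show ?thesis
    using smooth_dt f by (simp add: nice_def periodic_def)
qed

lemma nice_cong:
  assumes "nice f" "\<And>p. p \<in> half_plane \<Longrightarrow> g p = f p" shows "nice g"
proof -
  have "smooth_on half_plane g"
    using smooth_on_cong[of half_plane g f] assms by (simp add: nice_def)
  then show ?thesis
    using assms by (simp add: nice_def periodic_def)
qed

lemma continuous_slice:
  fixes f :: "real \<times> real \<Rightarrow> real"
  assumes "smooth_on half_plane f" "t > 0" shows "continuous_on S (\<lambda>x. f (t, x))"
  using dx_has_derivative[OF assms] by (intro continuous_at_imp_continuous_on ballI DERIV_isCont)

lemma integrable_slice:
  fixes f :: "real \<times> real \<Rightarrow> real"
  shows "smooth_on half_plane f \<Longrightarrow> t > 0 \<Longrightarrow> (\<lambda>x. f (t, x)) integrable_on {a..b}"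
  by (intro integrable_continuous_interval continuous_slice)

lemma integral_dx:
  assumes "smooth_on half_plane f" "t > 0" "a \<le> b"
  shows "integral {a..b} (\<lambda>x. dx f (t, x)) = f (t, b) - f (t, a)"
  by (intro integral_unique fundamental_theorem_of_calculus assms(3))
    (use dx_has_derivative[OF assms(1,2)] in \<open>auto simp: has_real_derivative_iff_has_vector_derivative[symmetric]
      intro: has_field_derivative_at_within\<close>)

lemma integral_has_derivative_dt:
  assumes f: "smooth_on half_plane f" and t: "t > 0"
  shows "((\<lambda>s. integral {a..b} (\<lambda>x. f (s, x))) has_real_derivative integral {a..b} (\<lambda>x. dt' f (t, x))) (at t)"
proof -
  have "((\<lambda>s. integral (cbox a b) (\<lambda>x. f (s, x))) has_real_derivative
      integral (cbox a b) (\<lambda>x. dt' f (t, x))) (at t within {0<..})"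
  proof (rule leibniz_rule_field_derivative)
    show "((\<lambda>s. f (s, x)) has_real_derivative dt' f (s, x)) (at s within {0<..})"
      if "s \<in> {0<..}" "x \<in> cbox a b" for s x
      using dt_has_derivative[OF f, of s x] that by (auto intro: has_field_derivative_at_within)
    show "(\<lambda>x. f (s, x)) integrable_on cbox a b" if "s \<in> {0<..}" for s
      using integrable_slice[OF f, of s a b] that by simp
    have "continuous_on ({0<..} \<times> cbox a b) (dt' f)"
      by (rule continuous_on_subset[OF smooth_on_imp_continuous_on[OF smooth_dt[OF f]]])
        (auto simp: half_plane_def)
    then show "continuous_on ({0<..} \<times> cbox a b) (\<lambda>(s, x). dt' f (s, x))"
      by (simp add: case_prod_beta')
  qed (use t in auto)
  then show ?thesis
    using t at_within_open[of t "{0<..}"] by simp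
qed

text \<open>Write \<open>f (t, z)\<close> as \<open>f (t, a)\<close> plus the integral of
  \<open>dx f\<close> from \<open>a\<close> to \<open>z\<close>. The time derivative passes under
  the integral, and the fundamental theorem then gives the derivative in \<open>z\<close>. Taking
  \<open>a = x - 1\<close> makes \<open>x\<close> an interior point.\<close>

lemma dt_dx:
  assumes f: "smooth_on half_plane f" and t: "t > 0"
  shows "dx (dt' f) (t, x) = dt' (dx f) (t, x)"
proof -
  let ?a = "x - 1"
  note sdt = smooth_dt[OF f] and sdx = smooth_dx[OF f]
  have eq: "dt' f (t, z) = dt' f (t, ?a) + integral {?a..z} (\<lambda>y. dt' (dx f) (t, y))" if z: "?a \<le> z" for z
  proof (rule dt_eqI)
    have "((\<lambda>s. f (s, ?a) + integral {?a..z} (\<lambda>y. dx f (s, y))) has_real_derivative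
        dt' f (t, ?a) + integral {?a..z} (\<lambda>y. dt' (dx f) (t, y))) (at t)"
      by (intro DERIV_add dt_has_derivative[OF f t] integral_has_derivative_dt[OF sdx t])
    then show "((\<lambda>s. f (s, z)) has_real_derivative
        dt' f (t, ?a) + integral {?a..z} (\<lambda>y. dt' (dx f) (t, y))) (at t)"
      by (rule has_field_derivative_transform_within_open[where S = "{0<..}"])
        (use t integral_dx[OF f _ z] in simp_all)
  qed
  have "((\<lambda>z. integral {?a..z} (\<lambda>y. dt' (dx f) (t, y))) has_real_derivative dt' (dx f) (t, x)) (at x within {?a..x + 1})"
    by (rule integral_has_real_derivative[OF continuous_slice[OF smooth_dt[OF sdx] t]]) simp
  moreover have "at x within {?a..x + 1} = at x"
    by (rule at_within_interior) simp
  ultimately have I: "((\<lambda>z. integral {?a..z} (\<lambda>y. dt' (dx f) (t, y))) has_real_derivative dt' (dx f) (t, x)) (at x)"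
    by (simp only:)
  have "((\<lambda>z. dt' f (t, ?a) + integral {?a..z} (\<lambda>y. dt' (dx f) (t, y))) has_real_derivative 0 + dt' (dx f) (t, x)) (at x)"
    by (rule DERIV_add[OF DERIV_const I])
  then have "((\<lambda>z. dt' f (t, z)) has_real_derivative 0 + dt' (dx f) (t, x)) (at x)"
    by (rule has_field_derivative_transform_within_open[where S = "{?a<..}"])
      (simp_all add: eq[OF less_imp_le, symmetric])
  then show ?thesis by (intro dx_eqI) simp
qed

section \<open>Integrals over the circle and rules of differentiation\<close>

definition circle_integral :: "(real \<times> real \<Rightarrow> real) \<Rightarrow> real \<Rightarrow> real" where
  "circle_integral f t = integral {0..2 * pi} (\<lambda>x. f (t, x))"

lemma circle_integral_dx: "nice f \<Longrightarrow> t > 0 \<Longrightarrow> circle_integral (dx f) t = 0"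
  using nice_periodic[of f t 0] by (simp add: circle_integral_def integral_dx nice_smooth)

lemma circle_integral_has_derivative:
  "nice f \<Longrightarrow> t > 0 \<Longrightarrow> (circle_integral f has_real_derivative circle_integral (dt' f) t) (at t)"
  unfolding circle_integral_def by (intro integral_has_derivative_dt nice_smooth)

lemma circle_integral_add: "nice f \<Longrightarrow> nice g \<Longrightarrow> t > 0 \<Longrightarrow>
    circle_integral (\<lambda>p. f p + g p) t = circle_integral f t + circle_integral g t"
  and circle_integral_diff: "nice f \<Longrightarrow> nice g \<Longrightarrow> t > 0 \<Longrightarrow>
    circle_integral (\<lambda>p. f p - g p) t = circle_integral f t - circle_integral g t"
  and circle_integral_cmult: "circle_integral (\<lambda>p. c * f p) t = c * circle_integral f t"
  by (simp_all add: circle_integral_def integral_add integral_diff integrable_slice nice_smooth)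

lemma circle_integral_mono: "nice f \<Longrightarrow> nice g \<Longrightarrow> t > 0 \<Longrightarrow> (\<And>x. f (t, x) \<le> g (t, x)) \<Longrightarrow>
    circle_integral f t \<le> circle_integral g t"
  unfolding circle_integral_def by (intro integral_le integrable_slice nice_smooth)

lemma circle_integral_cong: "(\<And>x. f (t, x) = g (t, x)) \<Longrightarrow> circle_integral f t = circle_integral g t"
  by (simp add: circle_integral_def)

lemmas nice_rules = nice_const nice_add nice_diff nice_mult nice_minus nice_exp nice_power2 nice_sum nice_dx nice_dt

lemma dx_add: "nice f \<Longrightarrow> nice g \<Longrightarrow> t > 0 \<Longrightarrow> dx (\<lambda>p. f p + g p) (t, x) = dx f (t, x) + dx g (t, x)"
  and dx_mult: "nice f \<Longrightarrow> nice g \<Longrightarrow> t > 0 \<Longrightarrow>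
    dx (\<lambda>p. f p * g p) (t, x) = dx f (t, x) * g (t, x) + f (t, x) * dx g (t, x)"
  and dx_cmult: "nice f \<Longrightarrow> t > 0 \<Longrightarrow> dx (\<lambda>p. c * f p) (t, x) = c * dx f (t, x)"
  and dx_exp: "nice f \<Longrightarrow> t > 0 \<Longrightarrow> dx (\<lambda>p. exp (f p)) (t, x) = exp (f (t, x)) * dx f (t, x)"
  and dt_add: "nice f \<Longrightarrow> nice g \<Longrightarrow> t > 0 \<Longrightarrow> dt' (\<lambda>p. f p + g p) (t, x) = dt' f (t, x) + dt' g (t, x)"
  and dt_diff: "nice f \<Longrightarrow> nice g \<Longrightarrow> t > 0 \<Longrightarrow> dt' (\<lambda>p. f p - g p) (t, x) = dt' f (t, x) - dt' g (t, x)"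
  and dt_mult: "nice f \<Longrightarrow> nice g \<Longrightarrow> t > 0 \<Longrightarrow>
    dt' (\<lambda>p. f p * g p) (t, x) = dt' f (t, x) * g (t, x) + f (t, x) * dt' g (t, x)"
  and dt_cmult: "nice f \<Longrightarrow> t > 0 \<Longrightarrow> dt' (\<lambda>p. c * f p) (t, x) = c * dt' f (t, x)"
  and dt_exp: "nice f \<Longrightarrow> t > 0 \<Longrightarrow> dt' (\<lambda>p. exp (f p)) (t, x) = exp (f (t, x)) * dt' f (t, x)"
  by (rule dx_eqI dt_eqI, auto intro!: derivative_eq_intros dx_has_derivative dt_has_derivative nice_smooth)+

lemma dt_inverse: "nice f \<Longrightarrow> t > 0 \<Longrightarrow> f (t, x) > 0 \<Longrightarrow>
    dt' (\<lambda>p. inverse (f p)) (t, x) = - (dt' f (t, x) / (f (t, x))\<^sup>2)"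
  by (rule dt_eqI)
    (auto intro!: derivative_eq_intros dt_has_derivative nice_smooth simp: power2_eq_square field_simps)

lemma dt_ln: "nice f \<Longrightarrow> t > 0 \<Longrightarrow> f (t, x) > 0 \<Longrightarrow> dt' (\<lambda>p. ln (f p)) (t, x) = dt' f (t, x) / f (t, x)"
  by (rule dt_eqI) (auto intro!: derivative_eq_intros dt_has_derivative nice_smooth)

section \<open>Evolution equations in arc length\<close>

text \<open>The scalar problem, separated from the forms. \<open>A_mass\<close> expresses that each
  coefficient is 1 plus the derivative of a periodic function; it bounds the length and identifies
  the limit.\<close>

locale torus_flow =
  fixes A :: "3 \<Rightarrow> real \<times> real \<Rightarrow> real"
  assumes nice_A: "nice (A i)"
    and A_pos: "t > 0 \<Longrightarrow> A i (t, x) > 0"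
    and A_mass: "t > 0 \<Longrightarrow> circle_integral (A i) t = 2 * pi"
    and A_pde: "t > 0 \<Longrightarrow> dt' (A i) (t, x) = deriv (flux (\<lambda>i s. A i (t, s)) i) x"
begin

definition w :: "real \<times> real \<Rightarrow> real" where
  "w p = mean_log (\<lambda>i s. A i (fst p, s)) (snd p)"

definition V :: "real \<times> real \<Rightarrow> real" where "V p = exp (w p)"

definition u :: "3 \<Rightarrow> real \<times> real \<Rightarrow> real" where "u i p = ln (A i p) - w p"

definition D :: "(real \<times> real \<Rightarrow> real) \<Rightarrow> real \<times> real \<Rightarrow> real" where "D f p = dx f p * inverse (V p)"

text \<open>\<open>R k i\<close> collects the nonlinear terms of \<open>\<partial>\<^sub>t D\<^sup>k u\<^sub>i\<close>, and \<open>M\<close> integrates with respect to arc length.\<close>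

definition U :: "nat \<Rightarrow> 3 \<Rightarrow> real \<times> real \<Rightarrow> real" where "U k i = (D ^^ k) (u i)"

definition q :: "real \<times> real \<Rightarrow> real" where "q p = (\<Sum>i\<in>UNIV. (U 1 i p)\<^sup>2)"

primrec R :: "nat \<Rightarrow> 3 \<Rightarrow> real \<times> real \<Rightarrow> real" where
  "R 0 i = (\<lambda>p. (U 1 i p)\<^sup>2 - 1 / 3 * q p)"
| "R (Suc k) i = (\<lambda>p. D (R k i) p - 1 / 3 * q p * U (Suc k) i p)"

definition M :: "(real \<times> real \<Rightarrow> real) \<Rightarrow> real \<Rightarrow> real" where
  "M f t = circle_integral (\<lambda>p. V p * f p) t"

definition E :: "nat \<Rightarrow> real \<Rightarrow> real" where "E k t = (\<Sum>i\<in>UNIV. M (\<lambda>p. (U k i p)\<^sup>2) t)"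

lemma A_pos': "p \<in> half_plane \<Longrightarrow> A i p > 0"
  using A_pos by (cases p) auto

lemma w_eq: "w p = 1 / 3 * (ln (A 1 p) + ln (A 2 p) + ln (A 3 p))"
  by (simp add: w_def mean_log_def)

lemma nice_w: "nice w"
  unfolding w_eq[abs_def] by (intro nice_rules nice_ln nice_A A_pos')

lemma nice_V: "nice V"
  unfolding V_def[abs_def] by (intro nice_rules nice_w)

lemma V_pos [simp]: "V p > 0" "V p \<noteq> 0" "V p \<ge> 0"
  by (simp_all add: V_def)

lemma nice_u: "nice (u i)"
  unfolding u_def[abs_def] by (intro nice_rules nice_w nice_ln nice_A A_pos')

lemma nice_D: "nice f \<Longrightarrow> nice (D f)"
  unfolding D_def[abs_def] by (intro nice_rules nice_inverse nice_V) auto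

lemma U_0: "U 0 i = u i" and U_Suc: "U (Suc k) i = D (U k i)"
  by (simp_all add: U_def)

lemma nice_U: "nice (U k i)"
  by (induction k) (auto simp: U_0 U_Suc nice_u nice_D)

lemma nice_q: "nice q"
  unfolding q_def[abs_def] by (intro nice_rules nice_U)

lemma nice_R: "nice (R k i)"
proof (induction k)
  case 0
  show ?case unfolding R.simps by (intro nice_rules nice_U nice_q)
next
  case (Suc k)
  then show ?case unfolding R.simps by (intro nice_rules nice_U nice_q nice_D)
qed

lemmas nice_all = nice_rules nice_w nice_V nice_u nice_D nice_U nice_q nice_R

lemma V_D: "V p * D f p = dx f p"
  by (simp add: D_def)

lemma D_add: "nice f \<Longrightarrow> nice g \<Longrightarrow> t > 0 \<Longrightarrow> D (\<lambda>p. f p + g p) (t, x) = D f (t, x) + D g (t, x)"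
  and D_mult: "nice f \<Longrightarrow> nice g \<Longrightarrow> t > 0 \<Longrightarrow>
    D (\<lambda>p. f p * g p) (t, x) = D f (t, x) * g (t, x) + f (t, x) * D g (t, x)"
  and D_cmult: "nice f \<Longrightarrow> t > 0 \<Longrightarrow> D (\<lambda>p. c * f p) (t, x) = c * D f (t, x)"
  and D_exp: "nice f \<Longrightarrow> t > 0 \<Longrightarrow> D (\<lambda>p. exp (f p)) (t, x) = exp (f (t, x)) * D f (t, x)"
  by (simp_all only: D_def dx_add dx_mult dx_cmult dx_exp ring_distribs mult_ac)

lemma D_cong: "(\<And>y. f (t, y) = g (t, y)) \<Longrightarrow> D f (t, x) = D g (t, x)"
  by (simp only: D_def dx_cong[of f t g])

lemma D_sum:
  assumes "finite I" "\<And>i. i \<in> I \<Longrightarrow> nice (f i)" "t > 0"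
  shows "D (\<lambda>p. \<Sum>i\<in>I. f i p) (t, x) = (\<Sum>i\<in>I. D (f i) (t, x))"
  using assms(1,2)
proof (induction I)
  case empty
  have "dx (\<lambda>p. 0) (t, x) = 0" by (rule dx_eqI) simp
  then show ?case by (simp add: D_def)
next
  case (insert i I)
  then show ?case
    using D_add[of "f i" "\<lambda>p. \<Sum>i\<in>I. f i p" t x] assms(3) by (simp add: nice_sum)
qed

text \<open>For \<open>k = 0\<close> this is the choice of \<open>w\<close> as the mean of the
  logarithms, and \<open>D\<close> is linear.\<close>

lemma sum_U: "t > 0 \<Longrightarrow> (\<Sum>i\<in>UNIV. U k i (t, x)) = 0"
proof (induction k arbitrary: x)
  case 0
  show ?case by (simp add: U_0 u_def w_eq sum_3) (simp add: field_simps)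
next
  case (Suc k)
  have "(\<Sum>i\<in>UNIV. U (Suc k) i (t, x)) = D (\<lambda>p. \<Sum>i\<in>UNIV. U k i p) (t, x)"
    unfolding U_Suc by (rule D_sum[symmetric]) (use Suc.prems nice_U in auto)
  also have "\<dots> = D (\<lambda>p. 0) (t, x)"
    by (rule D_cong) (use Suc in simp)
  also have "\<dots> = 0"
    using dx_eqI[of "\<lambda>p. 0" t 0 x] by (simp add: D_def)
  finally show ?case .
qed

lemma A_eq: "t > 0 \<Longrightarrow> A i (t, x) = exp (u i (t, x)) * V (t, x)"
  by (simp add: u_def V_def A_pos flip: exp_add)

text \<open>In arc length the flux is \<open>exp u * D u\<close>. Its derivative in \<open>x\<close>
  is \<open>V * D (exp u * D u)\<close>, that is \<open>A\<close> times the right-hand side.\<close>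

lemma dt_ln_A:
  assumes t: "t > 0"
  shows "dt' (\<lambda>p. ln (A i p)) (t, x) = U 2 i (t, x) + (U 1 i (t, x))\<^sup>2"
proof -
  have "flux (\<lambda>i s. A i (t, s)) i y = exp (u i (t, y)) * U 1 i (t, y)" for y
  proof -
    have "deriv (log_ratio (\<lambda>i s. A i (t, s)) i) y = dx (u i) (t, y)"
      by (simp add: dx_def u_def w_def log_ratio_def[abs_def])
    moreover have "vol (\<lambda>i s. A i (t, s)) y = V (t, y)"
      by (simp add: vol_def V_def w_def)
    ultimately show ?thesis
      by (simp add: flux_def A_eq[OF t] U_def D_def power2_eq_square field_simps)
  qed
  then have "flux (\<lambda>i s. A i (t, s)) i = (\<lambda>y. exp (u i (t, y)) * U 1 i (t, y))"
    by (rule ext)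
  then have "deriv (flux (\<lambda>i s. A i (t, s)) i) x = dx (\<lambda>p. exp (u i p) * U 1 i p) (t, x)"
    by (simp only: dx_def fst_conv snd_conv)
  also have "\<dots> = V (t, x) * D (\<lambda>p. exp (u i p) * U 1 i p) (t, x)"
    by (simp only: V_D)
  also have "D (\<lambda>p. exp (u i p) * U 1 i p) (t, x) =
      exp (u i (t, x)) * D (u i) (t, x) * U 1 i (t, x) + exp (u i (t, x)) * D (U 1 i) (t, x)"
    by (simp only: D_mult[OF nice_exp[OF nice_u] nice_U t] D_exp[OF nice_u t])
  also have "V (t, x) * \<dots> = A i (t, x) * (U 2 i (t, x) + (U 1 i (t, x))\<^sup>2)"
    by (simp add: A_eq[OF t] U_def numeral_2_eq_2 power2_eq_square algebra_simps)
  finally have "dt' (A i) (t, x) = A i (t, x) * (U 2 i (t, x) + (U 1 i (t, x))\<^sup>2)"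
    using A_pde[OF t] by simp
  then show ?thesis
    using dt_ln[OF nice_A t A_pos[OF t], of i x] A_pos[OF t, of i x] by simp
qed

text \<open>In the mean over \<open>i\<close> the second derivatives cancel by \<open>sum_U\<close>,
  which leaves an equation without diffusion.\<close>

lemma dt_w:
  assumes t: "t > 0" shows "dt' w (t, x) = 1 / 3 * q (t, x)"
proof -
  have ln: "nice (\<lambda>p. ln (A i p))" for i
    by (intro nice_ln nice_A A_pos')
  have "dt' w (t, x) = 1 / 3 * (dt' (\<lambda>p. ln (A 1 p)) (t, x) + dt' (\<lambda>p. ln (A 2 p)) (t, x) + dt' (\<lambda>p. ln (A 3 p)) (t, x))"
    unfolding w_eq[abs_def] by (simp only: dt_cmult[OF nice_add[OF nice_add[OF ln ln] ln] t]
      dt_add[OF nice_add[OF ln ln] ln t] dt_add[OF ln ln t])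
  then show ?thesis
    using sum_U[OF t, of 2 x] by (simp add: dt_ln_A[OF t] q_def sum_3)
qed

lemma dt_V:
  assumes t: "t > 0" shows "dt' V (t, x) = V (t, x) * (1 / 3 * q (t, x))"
  unfolding V_def[abs_def] by (simp only: dt_exp[OF nice_w t] dt_w[OF t])

lemma dt_u:
  assumes t: "t > 0" shows "dt' (u i) (t, x) = U 2 i (t, x) + R 0 i (t, x)"
proof -
  have "nice (\<lambda>p. ln (A i p))"
    by (intro nice_ln nice_A A_pos')
  from dt_diff[OF this nice_w t] show ?thesis
    unfolding u_def[abs_def] by (simp add: dt_ln_A[OF t] dt_w[OF t])
qed

text \<open>As \<open>dx\<close> and \<open>dt'\<close> commute, the commutator of
  \<open>dt'\<close> with \<open>D\<close> comes from the growth of \<open>V\<close> alone.\<close>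

lemma dt_D:
  assumes f: "nice f" and t: "t > 0"
  shows "dt' (D f) (t, x) = D (dt' f) (t, x) - 1 / 3 * q (t, x) * D f (t, x)"
proof -
  have "nice (\<lambda>p. inverse (V p))" by (intro nice_inverse nice_V) simp
  from dt_mult[OF nice_dx[OF f] this t] have "dt' (D f) (t, x) =
      dt' (dx f) (t, x) * inverse (V (t, x)) + dx f (t, x) * dt' (\<lambda>p. inverse (V p)) (t, x)"
    by (simp only: D_def[abs_def])
  also have "dt' (\<lambda>p. inverse (V p)) (t, x) = - (1 / 3 * q (t, x) * inverse (V (t, x)))"
    unfolding dt_inverse[OF nice_V t V_pos(1)] dt_V[OF t] by (simp add: power2_eq_square field_simps)
  finally show ?thesis
    by (simp only: D_def[of "dt' f"] D_def[of f "(t, x)"] dt_dx[OF nice_smooth[OF f] t]) (simp add: algebra_simps)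
qed

lemma dt_U:
  assumes t: "t > 0" shows "dt' (U k i) (t, x) = U (k + 2) i (t, x) + R k i (t, x)"
proof (induction k arbitrary: x)
  case 0
  show ?case using dt_u[OF t] by (simp only: U_0 add_0)
next
  case (Suc k)
  have "dt' (U (Suc k) i) (t, x) = D (dt' (U k i)) (t, x) - 1 / 3 * q (t, x) * D (U k i) (t, x)"
    unfolding U_Suc by (rule dt_D[OF nice_U t])
  also have "D (dt' (U k i)) (t, x) = D (\<lambda>p. U (k + 2) i p + R k i p) (t, x)"
    by (rule D_cong) (rule Suc)
  also have "\<dots> = U (Suc k + 2) i (t, x) + D (R k i) (t, x)"
    by (simp only: D_add[OF nice_U nice_R t] U_Suc add_Suc)
  finally show ?case by (simp add: U_Suc)
qed

section \<open>Integration with respect to arc length\<close>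

lemma M_D: "nice f \<Longrightarrow> t > 0 \<Longrightarrow> M (D f) t = 0"
  unfolding M_def V_D using circle_integral_dx by simp

lemma M_add: "nice f \<Longrightarrow> nice g \<Longrightarrow> t > 0 \<Longrightarrow> M (\<lambda>p. f p + g p) t = M f t + M g t"
  and M_diff: "nice f \<Longrightarrow> nice g \<Longrightarrow> t > 0 \<Longrightarrow> M (\<lambda>p. f p - g p) t = M f t - M g t"
  using circle_integral_add[of "\<lambda>p. V p * f p" "\<lambda>p. V p * g p" t]
    circle_integral_diff[of "\<lambda>p. V p * f p" "\<lambda>p. V p * g p" t] nice_mult[OF nice_V]
  by (simp_all add: M_def algebra_simps)

lemma M_cmult: "M (\<lambda>p. c * f p) t = c * M f t"
  using circle_integral_cmult[of c "\<lambda>p. V p * f p" t] by (simp add: M_def mult_ac)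

lemma M_cong: "(\<And>x. f (t, x) = g (t, x)) \<Longrightarrow> M f t = M g t"
  unfolding M_def by (rule circle_integral_cong) simp

lemma M_sum: "finite I \<Longrightarrow> (\<And>i. i \<in> I \<Longrightarrow> nice (f i)) \<Longrightarrow> t > 0 \<Longrightarrow>
    M (\<lambda>p. \<Sum>i\<in>I. f i p) t = (\<Sum>i\<in>I. M (f i) t)"
proof (induction I rule: finite_induct)
  case empty
  show ?case using M_cmult[of 0] by simp
next
  case (insert i I)
  then show ?case
    using M_add[of "f i" "\<lambda>p. \<Sum>i\<in>I. f i p" t] by (simp add: nice_sum)
qed

lemma M_mono: "nice f \<Longrightarrow> nice g \<Longrightarrow> t > 0 \<Longrightarrow> (\<And>x. f (t, x) \<le> g (t, x)) \<Longrightarrow> M f t \<le> M g t"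
  unfolding M_def by (rule circle_integral_mono) (auto intro: nice_mult nice_V)

lemma M_nonneg: "nice f \<Longrightarrow> t > 0 \<Longrightarrow> (\<And>x. 0 \<le> f (t, x)) \<Longrightarrow> 0 \<le> M f t"
  using M_mono[of "\<lambda>p. 0" f t] M_cmult[of 0] by simp

lemma M_by_parts:
  assumes "nice f" "nice g" "t > 0"
  shows "M (\<lambda>p. f p * D g p) t = - M (\<lambda>p. D f p * g p) t"
proof -
  have "0 = M (D (\<lambda>p. f p * g p)) t"
    using assms by (intro M_D[symmetric] nice_mult)
  also have "\<dots> = M (\<lambda>p. D f p * g p + f p * D g p) t"
    by (rule M_cong) (simp add: D_mult assms)
  also have "\<dots> = M (\<lambda>p. D f p * g p) t + M (\<lambda>p. f p * D g p) t"
    using assms by (intro M_add nice_mult nice_D)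
  finally show ?thesis by simp
qed

text \<open>The additional term is the growth of the length element.\<close>

lemma M_has_derivative:
  assumes "nice f" "t > 0"
  shows "(M f has_real_derivative M (\<lambda>p. dt' f p + 1 / 3 * q p * f p) t) (at t)"
proof -
  have "(circle_integral (\<lambda>p. V p * f p) has_real_derivative circle_integral (dt' (\<lambda>p. V p * f p)) t) (at t)"
    using assms by (intro circle_integral_has_derivative nice_mult nice_V)
  moreover have "circle_integral (dt' (\<lambda>p. V p * f p)) t = M (\<lambda>p. dt' f p + 1 / 3 * q p * f p) t"
    unfolding M_def by (rule circle_integral_cong)
      (unfold dt_mult[OF nice_V assms] dt_V[OF assms(2)], simp add: algebra_simps)
  ultimately show ?thesis by (simp add: M_def[abs_def])
qed

end

section \<open>Energy estimates\<close>

text \<open>The common core of the Cauchy-Schwarz inequalities below; for \<open>c > 0\<close> the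
  optimal parameter is \<open>b / c\<close>.\<close>

lemma discriminant_le:
  fixes a b c :: real
  assumes nn: "\<And>l. 0 \<le> a - 2 * l * b + l\<^sup>2 * c" and c: "0 \<le> c"
  shows "b\<^sup>2 \<le> a * c"
proof (cases "c = 0")
  case True
  have "b = 0"
  proof (rule ccontr)
    assume "b \<noteq> 0"
    \<comment> \<open>With \<open>c = 0\<close> the expression is affine in \<open>l\<close>; this
      \<open>l\<close> is chosen to give it the value -1.\<close>
    then have "a - 2 * ((a + 1) / (2 * b)) * b = - 1" by (simp add: field_simps)
    then show False using nn[of "(a + 1) / (2 * b)"] True by simp
  qed
  then show ?thesis using True by simp
next
  case False
  with c have "c > 0" by simp
  have "0 \<le> a - 2 * (b / c) * b + (b / c)\<^sup>2 * c" by (rule nn)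
  also have "\<dots> = a - b\<^sup>2 / c" using False by (simp add: power2_eq_square field_simps)
  finally show ?thesis using \<open>c > 0\<close> by (simp add: field_simps)
qed

text \<open>Log-convexity makes the ratios \<open>e (Suc n) / e n\<close> increase with
  \<open>n\<close>. Raising \<open>p\<close> by one multiplies the left side by the ratio at
  \<open>p\<close> and the right side by the larger ratio at \<open>p + r\<close>.\<close>

lemma log_convex_product:
  fixes e :: "nat \<Rightarrow> real"
  assumes pos: "\<And>n. e n > 0" and lc: "\<And>n. (e (Suc n))\<^sup>2 \<le> e n * e (Suc (Suc n))"
  shows "e p * e r \<le> e 0 * e (p + r)"
proof (induction p)
  case (Suc p)
  have ratio: "e (Suc m) / e m \<le> e (Suc (m + n)) / e (m + n)" for m n
  proof (induction n)
    case (Suc n)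
    have "e (Suc (m + n)) / e (m + n) \<le> e (Suc (Suc (m + n))) / e (Suc (m + n))"
      using lc[of "m + n"] pos[of "m + n"] pos[of "Suc (m + n)"] by (simp add: divide_simps power2_eq_square mult_ac)
    with Suc show ?case by simp
  qed simp
  have "e (Suc p) * e r = e (Suc p) / e p * (e p * e r)"
    using pos[of p] by simp
  also have "\<dots> \<le> e (Suc p) / e p * (e 0 * e (p + r))"
    using pos[of p] pos[of "Suc p"] Suc by (intro mult_left_mono) auto
  also have "\<dots> \<le> e (Suc (p + r)) / e (p + r) * (e 0 * e (p + r))"
    using pos[of 0] pos[of "p + r"] ratio[of p r] by (intro mult_right_mono) auto
  also have "\<dots> = e 0 * e (Suc p + r)"
    using pos[of "p + r"] by simp
  finally show ?case .
qed simp

text \<open>The function \<open>e t * exp (c * t)\<close> does not increase. It is compared with its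
  value at \<open>T + 1\<close> because the hypotheses hold only strictly after
  \<open>T\<close>.\<close>

lemma exponential_decay:
  fixes e d :: "real \<Rightarrow> real"
  assumes der: "\<And>t. t > T \<Longrightarrow> (e has_real_derivative d t) (at t)"
    and le: "\<And>t. t > T \<Longrightarrow> d t \<le> - c * e t" and nn: "\<And>t. t > T \<Longrightarrow> 0 \<le> e t" and c: "c > 0"
  shows "(e \<longlongrightarrow> 0) at_top"
proof -
  let ?s = "T + 1"
  have mono: "e t * exp (c * t) \<le> e ?s * exp (c * ?s)" if "t \<ge> ?s" for t
  proof (rule DERIV_nonpos_imp_nonincreasing[OF that])
    fix x assume x: "?s \<le> x" "x \<le> t"
    have "((\<lambda>t. e t * exp (c * t)) has_real_derivative (d x + c * e x) * exp (c * x)) (at x)"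
      using der[of x] x by (auto intro!: derivative_eq_intros simp: algebra_simps)
    moreover have "(d x + c * e x) * exp (c * x) \<le> 0"
      using le[of x] x by (intro mult_nonpos_nonneg) auto
    ultimately show "\<exists>y. ((\<lambda>t. e t * exp (c * t)) has_real_derivative y) (at x) \<and> y \<le> 0" by blast
  qed
  have "e t \<le> e ?s * exp (c * ?s) * exp (- c * t)" if "t \<ge> ?s" for t
    using mono[OF that] by (simp add: exp_minus field_simps)
  moreover have "((\<lambda>t. e ?s * exp (c * ?s) * exp (- c * t)) \<longlongrightarrow> 0) at_top"
    using c by real_asymp
  ultimately show ?thesis
    using nn by (intro tendsto_sandwich[of "\<lambda>t. 0" e at_top "\<lambda>t. e ?s * exp (c * ?s) * exp (- c * t)"])
      (auto simp: eventually_at_top_linorder intro!: exI[of _ ?s])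
qed

lemma nice_periodic_int:
  assumes "nice f" "t > 0" shows "f (t, x + 2 * pi * of_int n) = f (t, x)"
proof -
  have *: "f (t, x + 2 * pi * real n) = f (t, x)" for n x
  proof (induction n)
    case (Suc n)
    have "f (t, x + 2 * pi * real (Suc n)) = f (t, (x + 2 * pi * real n) + 2 * pi)"
      by (simp add: algebra_simps)
    then show ?case using nice_periodic[OF assms, of "x + 2 * pi * real n"] Suc by simp
  qed simp
  show ?thesis
  proof (cases "n \<ge> 0")
    case True
    then show ?thesis using *[of x "nat n"] by simp
  next
    case False
    then show ?thesis using *[of "x + 2 * pi * of_int n" "nat (- n)"] by (simp add: algebra_simps)
  qed
qed

lemma nice_fundamental_domain:
  assumes "nice f" "t > 0" shows "\<exists>y\<in>{0..2 * pi}. f (t, y) = f (t, x)"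
proof -
  let ?n = "\<lfloor>x / (2 * pi)\<rfloor>"
  have "of_int ?n \<le> x / (2 * pi)" "x / (2 * pi) < of_int ?n + 1" by linarith+
  then have "2 * pi * of_int ?n \<le> x" "x < 2 * pi * of_int ?n + 2 * pi"
    using pos_le_divide_eq[of "2 * pi" "of_int ?n" x] pos_divide_less_eq[of "2 * pi" x "of_int ?n + 1"]
    by (simp_all add: algebra_simps)
  then have "x + 2 * pi * of_int (- ?n) \<in> {0..2 * pi}" by (simp add: algebra_simps)
  then show ?thesis using nice_periodic_int[OF assms, of x "- ?n"] by blast
qed

context torus_flow
begin

text \<open>The inequality of arithmetic and geometric means, obtained from
  \<open>1 + u \<le> exp u\<close> and the vanishing sum of the \<open>u i\<close>.\<close>

lemma V_le: "t > 0 \<Longrightarrow> V (t, x) \<le> 1 / 3 * (A 1 (t, x) + A 2 (t, x) + A 3 (t, x))"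
proof -
  assume t: "t > 0"
  have "(1 + u i (t, x)) * V (t, x) \<le> A i (t, x)" for i
    unfolding A_eq[OF t] by (intro mult_right_mono exp_ge_add_one_self) auto
  from this[of 1] this[of 2] this[of 3]
  have "(3 + (u 1 (t, x) + u 2 (t, x) + u 3 (t, x))) * V (t, x) \<le> A 1 (t, x) + A 2 (t, x) + A 3 (t, x)"
    by (simp add: algebra_simps)
  then show ?thesis
    using sum_U[OF t, of 0 x] by (simp add: U_0 sum_3)
qed

lemma M_1_le: assumes t: "t > 0" shows "M (\<lambda>p. 1) t \<le> 2 * pi"
proof -
  have "M (\<lambda>p. 1) t = circle_integral V t" by (simp add: M_def)
  also have "\<dots> \<le> circle_integral (\<lambda>p. 1 / 3 * (A 1 p + A 2 p + A 3 p)) t"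
    by (intro circle_integral_mono nice_rules nice_A nice_V t V_le)
  also have "\<dots> = 2 * pi"
    by (simp only: circle_integral_cmult circle_integral_add[OF nice_add[OF nice_A nice_A] nice_A t]
      circle_integral_add[OF nice_A nice_A t] A_mass[OF t]) simp
  finally show ?thesis .
qed

lemma M_1_pos: assumes t: "t > 0" shows "M (\<lambda>p. 1) t > 0"
proof -
  have "\<exists>z\<in>{0..2 * pi}. \<forall>x\<in>{0..2 * pi}. V (t, z) \<le> V (t, x)"
    by (rule continuous_attains_inf) (auto intro: continuous_slice nice_smooth nice_V t)
  then obtain z where z: "\<forall>x\<in>{0..2 * pi}. V (t, z) \<le> V (t, x)" by blast
  have "integral {0..2 * pi} (\<lambda>x. V (t, z)) \<le> integral {0..2 * pi} (\<lambda>x. V (t, x))"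
    using z by (intro integral_le integrable_slice[OF nice_smooth[OF nice_V] t]) auto
  moreover have "integral {0..2 * pi} (\<lambda>x. V (t, z)) = 2 * pi * V (t, z)" by simp
  moreover have "0 < 2 * pi * V (t, z)" by simp
  ultimately have "0 < integral {0..2 * pi} (\<lambda>x. V (t, x))" by linarith
  then show ?thesis by (simp add: M_def circle_integral_def)
qed

text \<open>The increment of \<open>f\<close> is the integral of \<open>V * D f\<close>, to which
  Cauchy-Schwarz with weight \<open>V\<close> applies; the arc between the points is no longer than
  the whole circle. Periodicity moves both points into one period.\<close>

lemma oscillation_le:
  assumes f: "nice f" and t: "t > 0"
  shows "(f (t, x) - f (t, y))\<^sup>2 \<le> 2 * pi * M (\<lambda>p. (D f p)\<^sup>2) t"
proof -
  let ?W = "\<lambda>p. V p * (D f p)\<^sup>2"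
  have nW: "nice ?W" by (intro nice_all f)
  note int = integrable_slice[OF nice_smooth t]
  have main: "(f (t, b) - f (t, a))\<^sup>2 \<le> 2 * pi * M (\<lambda>p. (D f p)\<^sup>2) t"
    if ab: "0 \<le> a" "a \<le> b" "b \<le> 2 * pi" for a b
  proof -
    let ?I = "\<lambda>g. integral {a..b} (\<lambda>x. g (t, x))"
    have sub: "0 \<le> ?I g \<and> ?I g \<le> integral {0..2 * pi} (\<lambda>x. g (t, x))"
      if "nice g" "\<And>x. 0 \<le> g (t, x)" for g
      using that ab by (auto intro!: integral_nonneg integral_subset_le int)
    have "(f (t, b) - f (t, a))\<^sup>2 \<le> ?I ?W * ?I V"
    proof (rule discriminant_le)
      fix l
      have "0 \<le> ?I (\<lambda>p. V p * (D f p - l)\<^sup>2)"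
        by (intro integral_nonneg int nice_all f) auto
      also have "\<dots> = ?I (\<lambda>p. ?W p + ((- 2 * l) * dx f p + l\<^sup>2 * V p))"
        by (intro integral_cong) (simp add: V_D[symmetric] power2_eq_square algebra_simps)
      also have "\<dots> = ?I ?W + ?I (\<lambda>p. (- 2 * l) * dx f p + l\<^sup>2 * V p)"
        by (intro integral_add int nice_all f)
      also have "?I (\<lambda>p. (- 2 * l) * dx f p + l\<^sup>2 * V p) = ?I (\<lambda>p. (- 2 * l) * dx f p) + ?I (\<lambda>p. l\<^sup>2 * V p)"
        by (intro integral_add int nice_all f)
      also have "?I (\<lambda>p. (- 2 * l) * dx f p) = (- 2 * l) * (f (t, b) - f (t, a))"
        using integral_dx[OF nice_smooth[OF f] t ab(2)] by simp
      finally show "0 \<le> ?I ?W - 2 * l * (f (t, b) - f (t, a)) + l\<^sup>2 * ?I V"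
        by (simp add: algebra_simps)
    qed (use sub[OF nice_V] in auto)
    also have "\<dots> \<le> M (\<lambda>p. (D f p)\<^sup>2) t * M (\<lambda>p. 1) t"
      using sub[OF nice_V] sub[OF nW] by (intro mult_mono) (auto simp: M_def circle_integral_def)
    also have "\<dots> \<le> M (\<lambda>p. (D f p)\<^sup>2) t * (2 * pi)"
      by (intro mult_left_mono M_1_le M_nonneg nice_all f t) auto
    finally show ?thesis by (simp add: mult_ac)
  qed
  obtain a b where a: "a \<in> {0..2 * pi}" "f (t, a) = f (t, x)" and b: "b \<in> {0..2 * pi}" "f (t, b) = f (t, y)"
    using nice_fundamental_domain[OF f t] by metis
  show ?thesis
  proof (cases "a \<le> b")
    case True
    then show ?thesis using main[of a b] a b by (simp add: power2_commute)
  next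
    case False
    then show ?thesis using main[of b a] a b by simp
  qed
qed

text \<open>Rolle's theorem over one period. Supremum bounds are therefore available from the first
  derivative on.\<close>

lemma U_zero:
  assumes t: "t > 0" shows "\<exists>z. U (Suc a) i (t, z) = 0"
proof -
  note der = dx_has_derivative[OF nice_smooth[OF nice_U[of a i]] t]
  have "\<exists>z. z > 0 \<and> z < 2 * pi \<and> ((\<lambda>y. U a i (t, y)) has_real_derivative 0) (at z)"
  proof (rule Rolle)
    show "U a i (t, 0) = U a i (t, 2 * pi)"
      using nice_periodic[OF nice_U[of a i] t, of 0] by simp
    show "continuous_on {0..2 * pi} (\<lambda>y. U a i (t, y))"
      by (intro continuous_slice nice_smooth nice_U t)
    show "(\<lambda>y. U a i (t, y)) differentiable (at x)" for x
      using der real_differentiable_def by blast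
  qed simp
  then obtain z where "((\<lambda>y. U a i (t, y)) has_real_derivative 0) (at z)" by blast
  then have "dx (U a i) (t, z) = 0" by (rule dx_eqI)
  then show ?thesis by (intro exI[of _ z]) (simp add: U_Suc D_def)
qed

lemma M_U_nonneg: "t > 0 \<Longrightarrow> 0 \<le> M (\<lambda>p. (U k i p)\<^sup>2) t"
  by (intro M_nonneg nice_all) auto

lemma M_U_le_E: "t > 0 \<Longrightarrow> M (\<lambda>p. (U k i p)\<^sup>2) t \<le> E k t"
  unfolding E_def using M_U_nonneg by (intro member_le_sum) auto

lemma E_nonneg: "t > 0 \<Longrightarrow> 0 \<le> E k t"
  unfolding E_def by (intro sum_nonneg M_U_nonneg)

lemma U_sup: assumes t: "t > 0" shows "(U (Suc a) i (t, x))\<^sup>2 \<le> 2 * pi * M (\<lambda>p. (U (Suc (Suc a)) i p)\<^sup>2) t"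
proof -
  obtain z where "U (Suc a) i (t, z) = 0" using U_zero[OF t] by blast
  then show ?thesis
    using oscillation_le[OF nice_U[of "Suc a" i] t, of x z] by (simp add: U_Suc)
qed

lemma U_sup_E: assumes t: "t > 0" shows "(U (Suc a) i (t, x))\<^sup>2 \<le> 2 * pi * E (Suc (Suc a)) t"
proof -
  have "2 * pi * M (\<lambda>p. (U (Suc (Suc a)) i p)\<^sup>2) t \<le> 2 * pi * E (Suc (Suc a)) t"
    by (intro mult_left_mono M_U_le_E t) simp
  with U_sup[OF t, of a i x] show ?thesis by linarith
qed

lemma M_mult_le:
  assumes f: "nice f" and g: "nice g" and t: "t > 0" and b: "\<And>x. (f (t, x))\<^sup>2 \<le> c"
  shows "M (\<lambda>p. (f p * g p)\<^sup>2) t \<le> c * M (\<lambda>p. (g p)\<^sup>2) t"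
proof -
  have "M (\<lambda>p. (f p * g p)\<^sup>2) t \<le> M (\<lambda>p. c * (g p)\<^sup>2) t"
    by (intro M_mono nice_all f g t) (simp add: power_mult_distrib b mult_right_mono)
  then show ?thesis by (simp only: M_cmult)
qed

text \<open>The supremum bound \<open>U_sup\<close> integrated over a circle of length at most
  \<open>2 * pi\<close>; hence the constant is the square of \<open>2 * pi\<close>.\<close>

lemma poincare: assumes t: "t > 0" shows "E (Suc k) t \<le> 4 * pi\<^sup>2 * E (Suc (Suc k)) t"
proof -
  have "M (\<lambda>p. (U (Suc k) i p)\<^sup>2) t \<le> 4 * pi\<^sup>2 * M (\<lambda>p. (U (Suc (Suc k)) i p)\<^sup>2) t" for i
  proof -
    let ?c = "2 * pi * M (\<lambda>p. (U (Suc (Suc k)) i p)\<^sup>2) t"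
    have "M (\<lambda>p. (U (Suc k) i p * 1)\<^sup>2) t \<le> ?c * M (\<lambda>p. 1\<^sup>2) t"
      by (intro M_mult_le nice_all t U_sup)
    also have "\<dots> \<le> ?c * (2 * pi)"
      using M_1_le[OF t] M_U_nonneg[OF t] by (intro mult_left_mono) auto
    finally show ?thesis by (simp add: power2_eq_square mult_ac)
  qed
  then show ?thesis
    unfolding E_def sum_distrib_left by (intro sum_mono)
qed

lemma M_cauchy_schwarz:
  assumes f: "\<And>i :: 3. nice (f i)" and g: "\<And>i. nice (g i)" and t: "t > 0"
  shows "(\<Sum>i\<in>UNIV. M (\<lambda>p. f i p * g i p) t)\<^sup>2 \<le>
    (\<Sum>i\<in>UNIV. M (\<lambda>p. (f i p)\<^sup>2) t) * (\<Sum>i\<in>UNIV. M (\<lambda>p. (g i p)\<^sup>2) t)"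
proof (rule discriminant_le)
  fix l
  have "0 \<le> (\<Sum>i\<in>UNIV. M (\<lambda>p. (f i p - l * g i p)\<^sup>2) t)"
    by (intro sum_nonneg M_nonneg nice_all f g t) auto
  also have "\<dots> = (\<Sum>i\<in>UNIV. M (\<lambda>p. (f i p)\<^sup>2) t - 2 * l * M (\<lambda>p. f i p * g i p) t + l\<^sup>2 * M (\<lambda>p. (g i p)\<^sup>2) t)"
  proof (rule sum.cong[OF refl])
    fix i :: 3
    have "M (\<lambda>p. (f i p - l * g i p)\<^sup>2) t =
        M (\<lambda>p. ((f i p)\<^sup>2 - 2 * l * (f i p * g i p)) + l\<^sup>2 * (g i p)\<^sup>2) t"
      by (rule M_cong) (simp add: power2_eq_square algebra_simps)
    also have "\<dots> = M (\<lambda>p. (f i p)\<^sup>2 - 2 * l * (f i p * g i p)) t + M (\<lambda>p. l\<^sup>2 * (g i p)\<^sup>2) t"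
      by (intro M_add nice_all f g t)
    also have "M (\<lambda>p. (f i p)\<^sup>2 - 2 * l * (f i p * g i p)) t =
        M (\<lambda>p. (f i p)\<^sup>2) t - M (\<lambda>p. 2 * l * (f i p * g i p)) t"
      by (intro M_diff nice_all f g t)
    finally show "M (\<lambda>p. (f i p - l * g i p)\<^sup>2) t = M (\<lambda>p. (f i p)\<^sup>2) t -
        2 * l * M (\<lambda>p. f i p * g i p) t + l\<^sup>2 * M (\<lambda>p. (g i p)\<^sup>2) t"
      by (simp only: M_cmult)
  qed
  finally show "0 \<le> (\<Sum>i\<in>UNIV. M (\<lambda>p. (f i p)\<^sup>2) t) - 2 * l * (\<Sum>i\<in>UNIV. M (\<lambda>p. f i p * g i p) t)
      + l\<^sup>2 * (\<Sum>i\<in>UNIV. M (\<lambda>p. (g i p)\<^sup>2) t)"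
    by (simp add: sum.distrib sum_subtractf sum_distrib_left)
qed (intro sum_nonneg M_nonneg nice_all g t, auto)

text \<open>Integration by parts writes \<open>E (Suc k)\<close> as a pairing of \<open>U k\<close>
  with \<open>U (Suc (Suc k))\<close>, to which Cauchy-Schwarz applies.\<close>

lemma E_log_convex: assumes t: "t > 0" shows "(E (Suc k) t)\<^sup>2 \<le> E k t * E (Suc (Suc k)) t"
proof -
  have "M (\<lambda>p. (U (Suc k) i p)\<^sup>2) t = - M (\<lambda>p. U k i p * U (Suc (Suc k)) i p) t" for i
    using M_by_parts[OF nice_U[of k i] nice_U[of "Suc k" i] t] by (simp add: U_Suc power2_eq_square)
  then have "E (Suc k) t = - (\<Sum>i\<in>UNIV. M (\<lambda>p. U k i p * U (Suc (Suc k)) i p) t)"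
    by (simp add: E_def sum_negf)
  then show ?thesis
    using M_cauchy_schwarz[of "U k" "U (Suc (Suc k))" t, OF nice_U nice_U t] by (simp add: E_def)
qed

text \<open>\<open>log_convex_product\<close> requires positive terms. If some
  \<open>E (Suc n) t\<close> vanishes, log-convexity carries the zero upwards and the Poincare
  inequality carries it downwards, so both sides are 0.\<close>

lemma E_product: assumes t: "t > 0" shows "E (Suc p) t * E (Suc r) t \<le> E 1 t * E (Suc (p + r)) t"
proof (cases "\<exists>n. E (Suc n) t = 0")
  case True
  then obtain n where n: "E (Suc n) t = 0" by blast
  have up: "E (Suc (n + m)) t = 0" for m
  proof (induction m)
    case (Suc m)
    then show ?case using E_log_convex[OF t, of "Suc (n + m)"] by simp
  qed (use n in simp)
  have down: "E (Suc k) t = 0" if "E (Suc (k + j)) t = 0" for j k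
    using that
  proof (induction j)
    case (Suc j)
    then show ?case using poincare[OF t, of "k + j"] E_nonneg[OF t, of "Suc (k + j)"] by simp
  qed simp
  have "E (Suc k) t = 0" for k
    using down[of k n] up[of k] by (simp add: add.commute)
  then show ?thesis by simp
next
  case False
  then have pos: "E (Suc n) t > 0" for n
    using E_nonneg[OF t, of "Suc n"] by (metis order_le_less)
  have "E (Suc p) t * E (Suc r) t \<le> E (Suc 0) t * E (Suc (p + r)) t"
    by (rule log_convex_product[of "\<lambda>n. E (Suc n) t"]) (use pos E_log_convex[OF t] in auto)
  then show ?thesis by simp
qed

text \<open>Quadratic and cubic expressions in which every factor is differentiated; the index is the total
  number of derivatives.\<close>

inductive qc :: "nat \<Rightarrow> (real \<times> real \<Rightarrow> real) \<Rightarrow> bool" where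
  quad: "qc (Suc a + Suc b) (\<lambda>p. U (Suc a) i p * U (Suc b) j p)"
| cubic: "qc (Suc a + Suc b + Suc c) (\<lambda>p. U (Suc a) i p * (U (Suc b) j p * U (Suc c) l p))"
| add: "qc n f \<Longrightarrow> qc n g \<Longrightarrow> qc n (\<lambda>p. f p + g p)"
| cmult: "qc n f \<Longrightarrow> qc n (\<lambda>p. c * f p)"
| transfer: "qc n f \<Longrightarrow> (\<And>p. p \<in> half_plane \<Longrightarrow> g p = f p) \<Longrightarrow> qc n g"

lemma qc_nice: "qc n f \<Longrightarrow> nice f"
proof (induction rule: qc.induct)
  case (transfer n f g)
  then show ?case using nice_cong by blast
qed (intro nice_all; assumption)+

lemma qc_D: "qc n f \<Longrightarrow> qc (Suc n) (D f)"
proof (induction rule: qc.induct)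
  case (quad a b i j)
  have *: "D (\<lambda>p. U (Suc a) i p * U (Suc b) j p) p =
      U (Suc (Suc a)) i p * U (Suc b) j p + U (Suc a) i p * U (Suc (Suc b)) j p" if "p \<in> half_plane" for p
  proof (cases p)
    case (Pair t x)
    then show ?thesis using that D_mult[OF nice_U[of "Suc a" i] nice_U[of "Suc b" j], of t x] by (simp add: U_Suc)
  qed
  show ?case
    by (rule qc.transfer[OF qc.add *]) (use qc.quad[of "Suc a" b i j] qc.quad[of a "Suc b" i j] in simp_all)
next
  case (cubic a b c i j l)
  have *: "D (\<lambda>p. U (Suc a) i p * (U (Suc b) j p * U (Suc c) l p)) p =
      U (Suc (Suc a)) i p * (U (Suc b) j p * U (Suc c) l p) +
      (U (Suc a) i p * (U (Suc (Suc b)) j p * U (Suc c) l p) +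
       U (Suc a) i p * (U (Suc b) j p * U (Suc (Suc c)) l p))" if "p \<in> half_plane" for p
  proof (cases p)
    case (Pair t x)
    then show ?thesis
      using that D_mult[OF nice_U[of "Suc a" i] nice_mult[OF nice_U[of "Suc b" j] nice_U[of "Suc c" l]], of t x]
        D_mult[OF nice_U[of "Suc b" j] nice_U[of "Suc c" l], of t x]
      by (simp add: U_Suc algebra_simps)
  qed
  show ?case
    by (rule qc.transfer[OF qc.add[OF _ qc.add] *])
      (use qc.cubic[of "Suc a" b c i j l] qc.cubic[of a "Suc b" c i j l] qc.cubic[of a b "Suc c" i j l] in simp_all)
next
  case (add n f g)
  have "D (\<lambda>p. f p + g p) p = D f p + D g p" if "p \<in> half_plane" for p
    using that D_add[OF qc_nice[OF add.hyps(1)] qc_nice[OF add.hyps(2)]] by (cases p) simp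
  then show ?case using qc.transfer[OF qc.add[OF add.IH]] by blast
next
  case (cmult n f c)
  have "D (\<lambda>p. c * f p) p = c * D f p" if "p \<in> half_plane" for p
    using that D_cmult[OF qc_nice[OF cmult.hyps]] by (cases p) simp
  then show ?case using qc.transfer[OF qc.cmult[OF cmult.IH]] by blast
next
  case (transfer n f g)
  have "D g p = D f p" if "p \<in> half_plane" for p
  proof (cases p)
    case (Pair t x)
    then show ?thesis using that transfer.hyps(2) D_cong[of g t f x] by simp
  qed
  then show ?case using qc.transfer[OF transfer.IH] by blast
qed

lemma qc_q_U: "qc (Suc k + 2) (\<lambda>p. q p * U (Suc k) i p)"
proof (rule qc.transfer)
  let ?T = "\<lambda>j p. U (Suc 0) j p * (U (Suc 0) j p * U (Suc k) i p)"
  have T: "qc (Suc k + 2) (?T j)" for j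
    using qc.cubic[of 0 0 k j j i] by simp
  show "qc (Suc k + 2) (\<lambda>p. ?T 1 p + (?T 2 p + ?T 3 p))"
    by (intro qc.add T)
qed (simp add: q_def sum_3 power2_eq_square algebra_simps)

text \<open>\<open>R 0\<close> is quadratic of order 2. Each step applies \<open>D\<close>, which
  raises the order by one, and adds \<open>q * U\<close>, which has the matching order.\<close>

lemma qc_R: "qc (k + 2) (R k i)"
proof (induction k)
  case 0
  let ?T = "\<lambda>j p. U (Suc 0) j p * U (Suc 0) j p"
  have T: "qc 2 (?T j)" for j
    using qc.quad[of 0 0 j j] by (simp add: numeral_2_eq_2)
  have "qc 2 (R 0 i)"
  proof (rule qc.transfer)
    show "qc 2 (\<lambda>p. ?T i p + (- 1 / 3) * (?T 1 p + (?T 2 p + ?T 3 p)))"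
      by (intro qc.add qc.cmult T)
  qed (simp add: q_def sum_3 power2_eq_square algebra_simps)
  then show ?case by (simp only: add_0)
next
  case (Suc k)
  have "qc (Suc k + 2) (\<lambda>p. D (R k i) p + (- 1 / 3) * (q p * U (Suc k) i p))"
    using qc_D[OF Suc] by (intro qc.add qc.cmult qc_q_U) simp
  then show ?case by (rule qc.transfer) simp
qed

text \<open>All factors but one are bounded in supremum at the cost of one derivative each, and
  \<open>E_product\<close> collects the derivatives on one energy. The total order then comes out as
  exactly \<open>n\<close>, with \<open>E 1\<close> left over from a quadratic term and its square
  from a cubic one.\<close>

lemma qc_bound:
  assumes "qc n f"
  shows "\<exists>C\<ge>0. \<forall>t>0. M (\<lambda>p. (f p)\<^sup>2) t \<le> C * (E 1 t + (E 1 t)\<^sup>2) * E n t"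
  using assms
proof (induction rule: qc.induct)
  case (quad a b i j)
  show ?case
  proof (intro exI[of _ "2 * pi"] conjI allI impI)
    fix t :: real assume t: "t > 0"
    note nn = E_nonneg[OF t]
    have "M (\<lambda>p. (U (Suc a) i p * U (Suc b) j p)\<^sup>2) t \<le> 2 * pi * E (Suc (Suc a)) t * M (\<lambda>p. (U (Suc b) j p)\<^sup>2) t"
      by (intro M_mult_le nice_all t U_sup_E)
    also have "\<dots> \<le> 2 * pi * E (Suc (Suc a)) t * E (Suc b) t"
      using nn by (intro mult_left_mono M_U_le_E t) auto
    also have "\<dots> \<le> 2 * pi * (E 1 t * E (Suc a + Suc b) t)"
      using E_product[OF t, of "Suc a" b] by (simp add: mult.assoc)
    also have "\<dots> \<le> 2 * pi * ((E 1 t + (E 1 t)\<^sup>2) * E (Suc a + Suc b) t)"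
      using nn by (intro mult_left_mono mult_right_mono) auto
    finally show "M (\<lambda>p. (U (Suc a) i p * U (Suc b) j p)\<^sup>2) t \<le>
        2 * pi * (E 1 t + (E 1 t)\<^sup>2) * E (Suc a + Suc b) t" by (simp only: mult.assoc)
  qed simp
next
  case (cubic a b c i j l)
  show ?case
  proof (intro exI[of _ "4 * pi\<^sup>2"] conjI allI impI)
    fix t :: real assume t: "t > 0"
    note nn = E_nonneg[OF t]
    have "M (\<lambda>p. (U (Suc a) i p * (U (Suc b) j p * U (Suc c) l p))\<^sup>2) t \<le>
        2 * pi * E (Suc (Suc a)) t * M (\<lambda>p. (U (Suc b) j p * U (Suc c) l p)\<^sup>2) t"
      by (intro M_mult_le nice_all t U_sup_E)
    also have "\<dots> \<le> 2 * pi * E (Suc (Suc a)) t * (2 * pi * E (Suc (Suc b)) t * M (\<lambda>p. (U (Suc c) l p)\<^sup>2) t)"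
      using nn by (intro mult_left_mono M_mult_le nice_all t U_sup_E) auto
    also have "\<dots> \<le> 2 * pi * E (Suc (Suc a)) t * (2 * pi * E (Suc (Suc b)) t * E (Suc c) t)"
      using nn by (intro mult_left_mono M_U_le_E t) auto
    also have "\<dots> = 4 * pi\<^sup>2 * (E (Suc (Suc a)) t * E (Suc (Suc b)) t) * E (Suc c) t"
      by (simp add: power2_eq_square)
    also have "\<dots> \<le> 4 * pi\<^sup>2 * (E 1 t * E (Suc (Suc a + Suc b)) t) * E (Suc c) t"
      using nn E_product[OF t, of "Suc a" "Suc b"] by (intro mult_right_mono mult_left_mono) auto
    also have "\<dots> = 4 * pi\<^sup>2 * E 1 t * (E (Suc (Suc a + Suc b)) t * E (Suc c) t)"
      by (simp only: mult.assoc)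
    also have "\<dots> \<le> 4 * pi\<^sup>2 * E 1 t * (E 1 t * E (Suc (Suc a + Suc b + c)) t)"
      using nn by (intro mult_left_mono E_product[OF t]) auto
    also have "\<dots> = 4 * pi\<^sup>2 * ((E 1 t)\<^sup>2 * E (Suc a + Suc b + Suc c) t)"
      by (simp add: power2_eq_square)
    also have "\<dots> \<le> 4 * pi\<^sup>2 * ((E 1 t + (E 1 t)\<^sup>2) * E (Suc a + Suc b + Suc c) t)"
      using nn by (intro mult_left_mono mult_right_mono) auto
    finally show "M (\<lambda>p. (U (Suc a) i p * (U (Suc b) j p * U (Suc c) l p))\<^sup>2) t \<le>
        4 * pi\<^sup>2 * (E 1 t + (E 1 t)\<^sup>2) * E (Suc a + Suc b + Suc c) t" by (simp only: mult.assoc)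
  qed simp
next
  case (add n f g)
  then obtain C1 C2 where C: "C1 \<ge> 0" "\<forall>t>0. M (\<lambda>p. (f p)\<^sup>2) t \<le> C1 * (E 1 t + (E 1 t)\<^sup>2) * E n t"
    "C2 \<ge> 0" "\<forall>t>0. M (\<lambda>p. (g p)\<^sup>2) t \<le> C2 * (E 1 t + (E 1 t)\<^sup>2) * E n t" by blast
  note nf = qc_nice[OF add.hyps(1)] and ng = qc_nice[OF add.hyps(2)]
  show ?case
  proof (intro exI[of _ "2 * C1 + 2 * C2"] conjI allI impI)
    fix t :: real assume t: "t > 0"
    have "M (\<lambda>p. (f p + g p)\<^sup>2) t \<le> M (\<lambda>p. 2 * (f p)\<^sup>2 + 2 * (g p)\<^sup>2) t"
    proof (intro M_mono nice_all nf ng t)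
      fix x
      have "0 \<le> (f (t, x) - g (t, x))\<^sup>2" by simp
      then show "(f (t, x) + g (t, x))\<^sup>2 \<le> 2 * (f (t, x))\<^sup>2 + 2 * (g (t, x))\<^sup>2"
        by (simp add: power2_eq_square algebra_simps)
    qed
    also have "\<dots> = M (\<lambda>p. 2 * (f p)\<^sup>2) t + M (\<lambda>p. 2 * (g p)\<^sup>2) t"
      by (intro M_add nice_all nf ng t)
    also have "\<dots> = 2 * M (\<lambda>p. (f p)\<^sup>2) t + 2 * M (\<lambda>p. (g p)\<^sup>2) t"
      by (simp only: M_cmult)
    finally show "M (\<lambda>p. (f p + g p)\<^sup>2) t \<le> (2 * C1 + 2 * C2) * (E 1 t + (E 1 t)\<^sup>2) * E n t"
      using C(2,4) t by (fastforce simp: algebra_simps)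
  qed (use C in simp)
next
  case (cmult n f c)
  then obtain C where C: "C \<ge> 0" "\<forall>t>0. M (\<lambda>p. (f p)\<^sup>2) t \<le> C * (E 1 t + (E 1 t)\<^sup>2) * E n t" by blast
  show ?case
  proof (intro exI[of _ "c\<^sup>2 * C"] conjI allI impI)
    fix t :: real assume t: "t > 0"
    have "c\<^sup>2 * M (\<lambda>p. (f p)\<^sup>2) t \<le> c\<^sup>2 * (C * (E 1 t + (E 1 t)\<^sup>2) * E n t)"
      using C(2) t by (intro mult_left_mono) auto
    then show "M (\<lambda>p. (c * f p)\<^sup>2) t \<le> c\<^sup>2 * C * (E 1 t + (E 1 t)\<^sup>2) * E n t"
      by (simp only: power_mult_distrib M_cmult mult.assoc)
  qed (use C in simp)
next
  case (transfer n f g)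
  have "M (\<lambda>p. (g p)\<^sup>2) t = M (\<lambda>p. (f p)\<^sup>2) t" if "t > 0" for t
    by (rule M_cong) (use transfer.hyps that in simp)
  with transfer.IH show ?case by simp
qed

end

section \<open>Decay\<close>

definition vanishes :: "(real \<times> real \<Rightarrow> real) \<Rightarrow> bool" where
  "vanishes f \<longleftrightarrow> (\<forall>e>0. \<forall>\<^sub>F t in at_top. \<forall>x. \<bar>f (t, x)\<bar> < e)"

lemma vanishes_add:
  assumes "vanishes f" "vanishes g" shows "vanishes (\<lambda>p. f p + g p)"
  unfolding vanishes_def
proof (intro allI impI)
  fix e :: real assume "e > 0"
  then have "\<forall>\<^sub>F t in at_top. \<forall>x. \<bar>f (t, x)\<bar> < e / 2" "\<forall>\<^sub>F t in at_top. \<forall>x. \<bar>g (t, x)\<bar> < e / 2"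
    using assms half_gt_zero[of e] unfolding vanishes_def by blast+
  then show "\<forall>\<^sub>F t in at_top. \<forall>x. \<bar>f (t, x) + g (t, x)\<bar> < e"
  proof eventually_elim
    case (elim t)
    show ?case
    proof
      fix x
      show "\<bar>f (t, x) + g (t, x)\<bar> < e"
        using elim(1)[rule_format, of x] elim(2)[rule_format, of x] by linarith
    qed
  qed
qed

lemma vanishes_mult_bounded:
  assumes "vanishes f" "\<forall>\<^sub>F t in at_top. \<forall>x. \<bar>g (t, x)\<bar> \<le> b" shows "vanishes (\<lambda>p. g p * f p)"
  unfolding vanishes_def
proof (intro allI impI)
  fix e :: real assume e: "e > 0"
  \<comment> \<open>At least 1, so that \<open>e / c\<close> makes sense as a positive
    threshold.\<close>
  define c where "c = max b 1"
  have c: "c > 0" "b \<le> c" by (auto simp: c_def)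
  then have "\<forall>\<^sub>F t in at_top. \<forall>x. \<bar>f (t, x)\<bar> < e / c"
    using assms(1) e by (auto simp: vanishes_def)
  with assms(2) show "\<forall>\<^sub>F t in at_top. \<forall>x. \<bar>g (t, x) * f (t, x)\<bar> < e"
  proof eventually_elim
    case (elim t)
    show ?case
    proof
      fix x
      have "\<bar>g (t, x) * f (t, x)\<bar> = \<bar>g (t, x)\<bar> * \<bar>f (t, x)\<bar>" by (rule abs_mult)
      also have "\<dots> \<le> c * \<bar>f (t, x)\<bar>"
        using elim(1)[rule_format, of x] c by (intro mult_right_mono) auto
      also have "\<dots> < c * (e / c)"
        using elim(2)[rule_format, of x] c by (intro mult_strict_left_mono) auto
      finally show "\<bar>g (t, x) * f (t, x)\<bar> < e" using c by simp
    qed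
  qed
qed

lemma vanishes_eventually_le: "vanishes f \<Longrightarrow> \<forall>\<^sub>F t in at_top. \<forall>x. \<bar>f (t, x)\<bar> \<le> 1"
  unfolding vanishes_def by (drule spec[of _ 1]) (auto elim!: eventually_mono intro: less_imp_le)

lemma vanishes_cong:
  assumes "vanishes f" "\<And>t x. t > 0 \<Longrightarrow> g (t, x) = f (t, x)" shows "vanishes g"
  unfolding vanishes_def
proof (intro allI impI)
  fix e :: real assume "e > 0"
  then have "\<forall>\<^sub>F t in at_top. \<forall>x. \<bar>f (t, x)\<bar> < e" using assms(1) by (simp add: vanishes_def)
  with eventually_gt_at_top[of 0] show "\<forall>\<^sub>F t in at_top. \<forall>x. \<bar>g (t, x)\<bar> < e"
    by eventually_elim (simp add: assms(2))
qed

lemma vanishes_of_bound: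
  assumes le: "\<And>t x. t > 0 \<Longrightarrow> \<bar>f (t, x)\<bar> \<le> b t" and b: "(b \<longlongrightarrow> 0) at_top"
  shows "vanishes f"
  unfolding vanishes_def
proof (intro allI impI)
  fix e :: real assume "e > 0"
  then have "\<forall>\<^sub>F t in at_top. b t < e" using order_tendstoD(2)[OF b] by blast
  with eventually_gt_at_top[of 0] show "\<forall>\<^sub>F t in at_top. \<forall>x. \<bar>f (t, x)\<bar> < e"
  proof eventually_elim
    case (elim t)
    then show ?case using le[of t] by (meson le_less_trans)
  qed
qed

context torus_flow
begin

definition dE :: "nat \<Rightarrow> real \<Rightarrow> real" where
  "dE k t = (\<Sum>i\<in>UNIV. 2 * M (\<lambda>p. U k i p * U (k + 2) i p) t + 2 * M (\<lambda>p. U k i p * R k i p) t +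
     1 / 3 * M (\<lambda>p. q p * (U k i p)\<^sup>2) t)"

lemma E_has_derivative:
  assumes t: "t > 0" shows "(E k has_real_derivative dE k t) (at t)"
proof -
  have "(M (\<lambda>p. (U k i p)\<^sup>2) has_real_derivative
      2 * M (\<lambda>p. U k i p * U (k + 2) i p) t + 2 * M (\<lambda>p. U k i p * R k i p) t +
      1 / 3 * M (\<lambda>p. q p * (U k i p)\<^sup>2) t) (at t)" for i
  proof -
    have "M (\<lambda>p. dt' (\<lambda>p. (U k i p)\<^sup>2) p + 1 / 3 * q p * (U k i p)\<^sup>2) t =
        M (\<lambda>p. 2 * (U k i p * U (k + 2) i p) + 2 * (U k i p * R k i p) + 1 / 3 * (q p * (U k i p)\<^sup>2)) t"
      by (rule M_cong) (unfold power2_eq_square dt_mult[OF nice_U nice_U t] dt_U[OF t], simp add: algebra_simps)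
    also have "\<dots> = M (\<lambda>p. 2 * (U k i p * U (k + 2) i p) + 2 * (U k i p * R k i p)) t +
        M (\<lambda>p. 1 / 3 * (q p * (U k i p)\<^sup>2)) t"
      by (intro M_add nice_all t)
    also have "M (\<lambda>p. 2 * (U k i p * U (k + 2) i p) + 2 * (U k i p * R k i p)) t =
        M (\<lambda>p. 2 * (U k i p * U (k + 2) i p)) t + M (\<lambda>p. 2 * (U k i p * R k i p)) t"
      by (intro M_add nice_all t)
    finally show ?thesis
      using M_has_derivative[OF nice_power2[OF nice_U[of k i]] t] by (simp only: M_cmult)
  qed
  then show ?thesis
    unfolding E_def[abs_def] dE_def by (intro DERIV_sum) simp
qed

text \<open>Integration by parts moves the outer derivative of \<open>R (Suc m)\<close> onto
  \<open>U\<close>. The terms with \<open>q\<close> carry the coefficient \<open>- 2 / 3\<close>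
  from \<open>R\<close> and \<open>1 / 3\<close> from the length element; their sum is nonpositive
  and is dropped.\<close>

lemma dE_Suc_le:
  assumes t: "t > 0"
  shows "dE (Suc m) t \<le> - 2 * E (Suc (Suc m)) t - 2 * (\<Sum>i\<in>UNIV. M (\<lambda>p. U (Suc (Suc m)) i p * R m i p) t)"
proof -
  let ?k = "Suc m"
  have "2 * M (\<lambda>p. U ?k i p * U (?k + 2) i p) t + 2 * M (\<lambda>p. U ?k i p * R ?k i p) t +
      1 / 3 * M (\<lambda>p. q p * (U ?k i p)\<^sup>2) t \<le>
    - 2 * M (\<lambda>p. (U (Suc ?k) i p)\<^sup>2) t - 2 * M (\<lambda>p. U (Suc ?k) i p * R m i p) t" for i
  proof -
    have 1: "M (\<lambda>p. U ?k i p * U (?k + 2) i p) t = - M (\<lambda>p. (U (Suc ?k) i p)\<^sup>2) t"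
      using M_by_parts[OF nice_U[of ?k i] nice_U[of "Suc ?k" i] t] by (simp add: U_Suc power2_eq_square)
    have "M (\<lambda>p. U ?k i p * R ?k i p) t = M (\<lambda>p. U ?k i p * D (R m i) p - 1 / 3 * (q p * (U ?k i p)\<^sup>2)) t"
      by (rule M_cong) (simp add: power2_eq_square algebra_simps)
    also have "\<dots> = M (\<lambda>p. U ?k i p * D (R m i) p) t - M (\<lambda>p. 1 / 3 * (q p * (U ?k i p)\<^sup>2)) t"
      by (intro M_diff nice_all t)
    also have "M (\<lambda>p. U ?k i p * D (R m i) p) t = - M (\<lambda>p. U (Suc ?k) i p * R m i p) t"
      using M_by_parts[OF nice_U[of ?k i] nice_R[of m i] t] by (simp only: U_Suc)
    finally have 2: "M (\<lambda>p. U ?k i p * R ?k i p) t =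
        - M (\<lambda>p. U (Suc ?k) i p * R m i p) t - 1 / 3 * M (\<lambda>p. q p * (U ?k i p)\<^sup>2) t"
      by (simp only: M_cmult)
    have "0 \<le> M (\<lambda>p. q p * (U ?k i p)\<^sup>2) t"
      by (intro M_nonneg nice_all t) (simp add: q_def sum_nonneg)
    then show ?thesis unfolding 1 2 by simp
  qed
  then have "dE ?k t \<le> (\<Sum>i\<in>UNIV. - 2 * M (\<lambda>p. (U (Suc ?k) i p)\<^sup>2) t - 2 * M (\<lambda>p. U (Suc ?k) i p * R m i p) t)"
    unfolding dE_def by (intro sum_mono)
  then show ?thesis
    by (simp add: E_def sum_subtractf sum_negf sum_distrib_left)
qed

lemma dE_1_le: assumes t: "t > 0" shows "dE 1 t \<le> - 2 * E 2 t"
proof -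
  \<comment> \<open>The integrand is a third of the derivative of the cube of
    \<open>U 1 i\<close>.\<close>
  have c: "M (\<lambda>p. U 2 i p * (U 1 i p)\<^sup>2) t = 0" for i
  proof -
    let ?c = "\<lambda>p. U 1 i p * (U 1 i p * U 1 i p)"
    have "0 = M (D ?c) t"
      by (intro M_D[symmetric] nice_all t)
    also have "\<dots> = M (\<lambda>p. 3 * (U 2 i p * (U 1 i p)\<^sup>2)) t"
      by (rule M_cong) (unfold D_mult[OF nice_U nice_mult[OF nice_U nice_U] t] D_mult[OF nice_U nice_U t],
        simp add: U_Suc numeral_2_eq_2 power2_eq_square algebra_simps)
    finally show ?thesis by (simp only: M_cmult)
  qed
  have "(\<Sum>i\<in>UNIV. M (\<lambda>p. U 2 i p * R 0 i p) t) = (\<Sum>i\<in>UNIV. - 1 / 3 * M (\<lambda>p. U 2 i p * q p) t)"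
  proof (rule sum.cong[OF refl])
    fix i
    have "M (\<lambda>p. U 2 i p * R 0 i p) t = M (\<lambda>p. U 2 i p * (U 1 i p)\<^sup>2 - 1 / 3 * (U 2 i p * q p)) t"
      by (rule M_cong) (simp add: algebra_simps)
    also have "\<dots> = M (\<lambda>p. U 2 i p * (U 1 i p)\<^sup>2) t - M (\<lambda>p. 1 / 3 * (U 2 i p * q p)) t"
      by (intro M_diff nice_all t)
    finally show "M (\<lambda>p. U 2 i p * R 0 i p) t = - 1 / 3 * M (\<lambda>p. U 2 i p * q p) t"
      by (simp only: c M_cmult)
  qed
  also have "\<dots> = - 1 / 3 * M (\<lambda>p. \<Sum>i\<in>UNIV. U 2 i p * q p) t"
    by (subst M_sum) (auto simp: sum_distrib_left intro: nice_all t)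
  \<comment> \<open>As \<open>q\<close> does not depend on \<open>i\<close>, the sum acts on
    \<open>U 2\<close> alone.\<close>
  also have "M (\<lambda>p. \<Sum>i\<in>UNIV. U 2 i p * q p) t = M (\<lambda>p. 0 * q p) t"
    by (rule M_cong) (simp only: sum_distrib_right[symmetric] sum_U[OF t])
  also have "\<dots> = 0" by (simp only: M_cmult)
  finally show ?thesis
    using dE_Suc_le[OF t, of 0] by (simp add: numeral_2_eq_2)
qed

lemma E_1_tendsto: "(E 1 \<longlongrightarrow> 0) at_top"
\<comment> \<open>The rate is the factor 2 of \<open>dE_1_le\<close> divided by the Poincare
  constant \<open>4 * pi^2\<close>.\<close>
proof (rule exponential_decay[where T = 0 and d = "dE 1" and c = "1 / (2 * pi\<^sup>2)"])
  fix t :: real assume t: "t > 0"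
  show "dE 1 t \<le> - (1 / (2 * pi\<^sup>2)) * E 1 t"
  proof -
    have "1 / (2 * pi\<^sup>2) * E 1 t \<le> 1 / (2 * pi\<^sup>2) * (4 * pi\<^sup>2 * E 2 t)"
      using poincare[OF t, of 0] by (intro mult_left_mono) (simp_all add: numeral_2_eq_2)
    also have "\<dots> = 2 * E 2 t" by simp
    finally show ?thesis using dE_1_le[OF t] by linarith
  qed
qed (use E_has_derivative E_nonneg in auto)

text \<open>Expanding the square of \<open>U + R\<close> bounds the mixed term by
  \<open>E (Suc k)\<close> plus the squared norm of \<open>R\<close>, where
  \<open>k = Suc (Suc m)\<close>. For large times the latter is at most half of
  \<open>E (Suc k)\<close>. Of the dissipation \<open>2 * E (Suc k)\<close> there remains
  \<open>1 / 2 * E (Suc k)\<close>, which the Poincare inequality bounds below by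
  \<open>1 / (8 * pi^2) * E k\<close>.\<close>

lemma E_Suc_Suc_tendsto: "(E (Suc (Suc m)) \<longlongrightarrow> 0) at_top"
proof -
  let ?k = "Suc (Suc m)"
  have "\<exists>C\<ge>0. \<forall>t>0. M (\<lambda>p. (R (Suc m) i p)\<^sup>2) t \<le> C * (E 1 t + (E 1 t)\<^sup>2) * E (Suc ?k) t" for i
    using qc_bound[OF qc_R[of "Suc m" i]] by simp
  then obtain C where C: "\<And>i. C i \<ge> 0"
    "\<And>i t. t > 0 \<Longrightarrow> M (\<lambda>p. (R (Suc m) i p)\<^sup>2) t \<le> C i * (E 1 t + (E 1 t)\<^sup>2) * E (Suc ?k) t"
    by metis
  define K where "K = (\<Sum>i\<in>UNIV. C i)"
  have "((\<lambda>t. K * (E 1 t + (E 1 t)\<^sup>2)) \<longlongrightarrow> K * (0 + 0\<^sup>2)) at_top"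
    by (intro tendsto_intros E_1_tendsto)
  then have "\<forall>\<^sub>F t in at_top. K * (E 1 t + (E 1 t)\<^sup>2) < 1 / 2"
    by (intro order_tendstoD(2)) auto
  then obtain T where T: "\<And>t. t \<ge> T \<Longrightarrow> K * (E 1 t + (E 1 t)\<^sup>2) < 1 / 2"
    by (auto simp: eventually_at_top_linorder)
  show ?thesis
  proof (rule exponential_decay[where T = "max T 0" and d = "dE ?k" and c = "1 / (8 * pi\<^sup>2)"])
    fix t :: real assume "t > max T 0"
    then have t: "t > 0" and tT: "t \<ge> T" by auto
    show "(E ?k has_real_derivative dE ?k t) (at t)" by (rule E_has_derivative[OF t])
    show "0 \<le> E ?k t" by (rule E_nonneg[OF t])
    have "0 \<le> (\<Sum>i\<in>UNIV. M (\<lambda>p. (U (Suc ?k) i p + R (Suc m) i p)\<^sup>2) t)"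
      by (intro sum_nonneg M_nonneg nice_all t) auto
    also have "\<dots> = (\<Sum>i\<in>UNIV. M (\<lambda>p. (U (Suc ?k) i p)\<^sup>2) t + 2 * M (\<lambda>p. U (Suc ?k) i p * R (Suc m) i p) t +
        M (\<lambda>p. (R (Suc m) i p)\<^sup>2) t)"
    proof (rule sum.cong[OF refl])
      fix i :: 3
      let ?U = "U (Suc ?k) i" and ?R = "R (Suc m) i"
      have "M (\<lambda>p. (?U p + ?R p)\<^sup>2) t = M (\<lambda>p. (?U p)\<^sup>2 + 2 * (?U p * ?R p) + (?R p)\<^sup>2) t"
        by (rule M_cong) (simp add: power2_sum)
      also have "\<dots> = M (\<lambda>p. (?U p)\<^sup>2 + 2 * (?U p * ?R p)) t + M (\<lambda>p. (?R p)\<^sup>2) t"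
        by (intro M_add nice_all t)
      also have "M (\<lambda>p. (?U p)\<^sup>2 + 2 * (?U p * ?R p)) t = M (\<lambda>p. (?U p)\<^sup>2) t + M (\<lambda>p. 2 * (?U p * ?R p)) t"
        by (intro M_add nice_all t)
      finally show "M (\<lambda>p. (?U p + ?R p)\<^sup>2) t = M (\<lambda>p. (?U p)\<^sup>2) t + 2 * M (\<lambda>p. ?U p * ?R p) t + M (\<lambda>p. (?R p)\<^sup>2) t"
        by (simp only: M_cmult)
    qed
    also have "\<dots> = E (Suc ?k) t + 2 * (\<Sum>i\<in>UNIV. M (\<lambda>p. U (Suc ?k) i p * R (Suc m) i p) t) +
        (\<Sum>i\<in>UNIV. M (\<lambda>p. (R (Suc m) i p)\<^sup>2) t)"
      by (simp only: sum.distrib E_def sum_distrib_left)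
    also have "(\<Sum>i\<in>UNIV. M (\<lambda>p. (R (Suc m) i p)\<^sup>2) t) \<le> (\<Sum>i\<in>UNIV. C i * (E 1 t + (E 1 t)\<^sup>2) * E (Suc ?k) t)"
      by (intro sum_mono C t)
    also have "\<dots> = K * (E 1 t + (E 1 t)\<^sup>2) * E (Suc ?k) t"
      by (simp only: K_def sum_distrib_right)
    also have "\<dots> \<le> 1 / 2 * E (Suc ?k) t"
      using T[OF tT] E_nonneg[OF t] by (intro mult_right_mono) auto
    finally have "dE ?k t \<le> - (1 / 2) * E (Suc ?k) t"
      using dE_Suc_le[OF t, of "Suc m"] by simp
    also have "\<dots> \<le> - (1 / (8 * pi\<^sup>2)) * E ?k t"
      using poincare[OF t, of "Suc m"] by (simp add: field_simps)
    finally show "dE ?k t \<le> - (1 / (8 * pi\<^sup>2)) * E ?k t" .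
  qed simp
qed

lemma E_tendsto: "(E (Suc k) \<longlongrightarrow> 0) at_top"
  using E_1_tendsto E_Suc_Suc_tendsto by (cases k) auto

section \<open>Uniform decay of all derivatives\<close>

lemma vanishes_U: "vanishes (U (Suc a) i)"
proof (rule vanishes_of_bound)
  show "\<bar>U (Suc a) i (t, x)\<bar> \<le> sqrt (2 * pi * E (Suc (Suc a)) t)" if "t > 0" for t x
    using U_sup_E[OF that, of a i x] by (metis real_sqrt_abs real_sqrt_le_mono)
  have "((\<lambda>t. sqrt (2 * pi * E (Suc (Suc a)) t)) \<longlongrightarrow> sqrt (2 * pi * 0)) at_top"
    by (intro tendsto_intros E_tendsto)
  then show "((\<lambda>t. sqrt (2 * pi * E (Suc (Suc a)) t)) \<longlongrightarrow> 0) at_top" by simp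
qed

text \<open>Expressions that decay uniformly together with all their derivatives: in contrast to
  \<open>vanishes\<close>, this class is closed under \<open>D\<close>.\<close>

inductive van :: "(real \<times> real \<Rightarrow> real) \<Rightarrow> bool" where
  base: "van (U (Suc a) i)"
| add: "van f \<Longrightarrow> van g \<Longrightarrow> van (\<lambda>p. f p + g p)"
| mult: "van f \<Longrightarrow> van g \<Longrightarrow> van (\<lambda>p. f p * g p)"
| transfer: "van f \<Longrightarrow> (\<And>p. p \<in> half_plane \<Longrightarrow> g p = f p) \<Longrightarrow> van g"

lemma van_nice: "van f \<Longrightarrow> nice f"
proof (induction rule: van.induct)
  case (transfer f g)
  then show ?case using nice_cong by blast
qed (intro nice_all; assumption)+

lemma van_vanishes: "van f \<Longrightarrow> vanishes f"
proof (induction rule: van.induct)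
  case (transfer f g)
  then show ?case using vanishes_cong[of f g] by simp
qed (auto intro: vanishes_U vanishes_add vanishes_mult_bounded vanishes_eventually_le)

lemma van_D: "van f \<Longrightarrow> van (D f)"
proof (induction rule: van.induct)
  case (base a i)
  show ?case using van.base[of "Suc a" i] by (simp add: U_Suc)
next
  case (add f g)
  have "D (\<lambda>p. f p + g p) p = D f p + D g p" if "p \<in> half_plane" for p
    using that D_add[OF van_nice[OF add.hyps(1)] van_nice[OF add.hyps(2)]] by (cases p) simp
  then show ?case using van.transfer[OF van.add[OF add.IH]] by blast
next
  case (mult f g)
  have "D (\<lambda>p. f p * g p) p = D f p * g p + f p * D g p" if "p \<in> half_plane" for p
    using that D_mult[OF van_nice[OF mult.hyps(1)] van_nice[OF mult.hyps(2)]] by (cases p) simp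
  then show ?case
    using van.transfer[OF van.add[OF van.mult[OF mult.IH(1) mult.hyps(2)] van.mult[OF mult.hyps(1) mult.IH(2)]]] by blast
next
  case (transfer f g)
  have "D g p = D f p" if "p \<in> half_plane" for p
  proof (cases p)
    case (Pair t x)
    then show ?thesis using that transfer.hyps(2) D_cong[of g t f x] by simp
  qed
  then show ?case using van.transfer[OF transfer.IH] by blast
qed

text \<open>The complete Bell polynomials in \<open>U 1 i\<close>, \<open>U 2 i\<close> and so on:
  applying \<open>D\<close> to \<open>exp (u i)\<close> \<open>n\<close> times gives
  \<open>exp (u i) * P n i\<close>.\<close>

primrec P :: "nat \<Rightarrow> 3 \<Rightarrow> real \<times> real \<Rightarrow> real" where
  "P 0 i = (\<lambda>p. 1)"
| "P (Suc n) i = (\<lambda>p. D (P n i) p + U 1 i p * P n i p)"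

lemma nice_P: "nice (P n i)"
  by (induction n) (auto intro!: nice_add nice_mult nice_D nice_U)

lemma van_P: "van (P (Suc n) i)"
proof (induction n)
  case 0
  have "D (\<lambda>p. 1) p = 0" for p
    using dx_eqI[of "\<lambda>p. 1" "fst p" 0 "snd p"] by (simp add: D_def)
  then have "P (Suc 0) i = U (Suc 0) i" by simp
  then show ?case using van.base[of 0 i] by (simp only:)
next
  case (Suc n)
  have "van (\<lambda>p. D (P (Suc n) i) p + U (Suc 0) i p * P (Suc n) i p)"
    by (intro van.add van.mult van.base van_D Suc)
  then show ?case by (simp only: P.simps(2)[of "Suc n"] One_nat_def)
qed

lemma D_exp_P:
  assumes t: "t > 0"
  shows "D (\<lambda>p. exp (u i p) * P n i p) (t, x) = exp (u i (t, x)) * P (Suc n) i (t, x)"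
proof -
  have "D (u i) (t, x) = U 1 i (t, x)" by (simp add: U_def)
  then show ?thesis
    by (unfold D_mult[OF nice_exp[OF nice_u] nice_P t] D_exp[OF nice_u t], simp add: algebra_simps)
qed

text \<open>With respect to arc length \<open>exp (u i)\<close> has integral \<open>2 * pi\<close>.
  Since \<open>u i\<close> oscillates by at most the right-hand side, its exponential at any one
  point times the length agrees with \<open>2 * pi\<close> up to a controlled factor; the claim is
  the logarithm of this.\<close>

lemma exp_u_bound:
  assumes t: "t > 0"
  shows "\<bar>u i (t, x) + ln (M (\<lambda>p. 1) t / (2 * pi))\<bar> \<le> sqrt (2 * pi * E 1 t)"
proof -
  let ?L = "M (\<lambda>p. 1) t" and ?d = "sqrt (2 * pi * E 1 t)" and ?c = "u i (t, x)"
  have L: "?L > 0" by (rule M_1_pos[OF t])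
  have osc: "\<bar>u i (t, y) - ?c\<bar> \<le> ?d" for y
  proof -
    have "(u i (t, y) - ?c)\<^sup>2 \<le> 2 * pi * M (\<lambda>p. (U 1 i p)\<^sup>2) t"
      using oscillation_le[OF nice_u[of i] t, of y x] by (simp add: U_def)
    also have "\<dots> \<le> 2 * pi * E 1 t"
      by (intro mult_left_mono M_U_le_E t) simp
    finally show ?thesis by (metis real_sqrt_abs real_sqrt_le_mono)
  qed
  have mass: "M (\<lambda>p. exp (u i p)) t = 2 * pi"
    using A_mass[OF t, of i] circle_integral_cong[of "\<lambda>p. V p * exp (u i p)" t "A i"]
    by (simp add: M_def A_eq[OF t] mult.commute)
  have "M (\<lambda>p. exp (u i p)) t \<le> M (\<lambda>p. exp (?c + ?d) * 1) t"
  proof (intro M_mono nice_all t)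
    fix y show "exp (u i (t, y)) \<le> exp (?c + ?d) * 1" using osc[of y] by simp
  qed
  then have up: "2 * pi \<le> exp (?c + ?d) * ?L" by (simp only: mass M_cmult)
  have "M (\<lambda>p. exp (?c - ?d) * 1) t \<le> M (\<lambda>p. exp (u i p)) t"
  proof (intro M_mono nice_all t)
    fix y show "exp (?c - ?d) * 1 \<le> exp (u i (t, y))" using osc[of y] by simp
  qed
  then have lo: "exp (?c - ?d) * ?L \<le> 2 * pi" by (simp only: mass M_cmult)
  have e: "exp (?c + s) * ?L / (2 * pi) = exp (?c + s + ln (?L / (2 * pi)))" for s
    using L by (simp add: exp_add)
  have "1 \<le> exp (?c + ?d) * ?L / (2 * pi)"
    using up by simp
  then have "1 \<le> exp (?c + ?d + ln (?L / (2 * pi)))" by (simp only: e)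
  moreover have "exp (?c + (- ?d)) * ?L / (2 * pi) \<le> 1"
    using lo by simp
  then have "exp (?c + (- ?d) + ln (?L / (2 * pi))) \<le> 1" by (simp only: e)
  ultimately show ?thesis by simp
qed

theorem rescaled_converges:
  "vanishes (\<lambda>p. (M (\<lambda>p. 1) (fst p) / (2 * pi)) ^ Suc n * (exp (u i p) * P n i p) - (if n = 0 then 1 else 0))"
proof -
  let ?L = "\<lambda>p :: real \<times> real. M (\<lambda>p. 1) (fst p) / (2 * pi)"
  have ratio: "exp (u i p) * ?L p = exp (u i p + ln (?L p))" if "p \<in> half_plane" for p
    using M_1_pos[of "fst p"] that by (cases p) (simp add: exp_add)
  have d: "((\<lambda>t. sqrt (2 * pi * E 1 t)) \<longlongrightarrow> 0) at_top"
  proof -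
    have "((\<lambda>t. sqrt (2 * pi * E 1 t)) \<longlongrightarrow> sqrt (2 * pi * 0)) at_top"
      by (intro tendsto_intros E_1_tendsto)
    then show ?thesis by simp
  qed
  have 0: "vanishes (\<lambda>p. exp (u i p) * ?L p - 1)"
  proof (rule vanishes_of_bound)
    fix t x :: real assume t: "t > 0"
    let ?z = "u i (t, x) + ln (?L (t, x))" and ?d = "sqrt (2 * pi * E 1 t)"
    have z: "\<bar>?z\<bar> \<le> ?d" using exp_u_bound[OF t] by simp
    have "exp ?z - 1 \<le> exp ?d - 1" using z by simp
    \<comment> \<open>One bound serves both signs because
      \<open>1 - exp (- d) \<le> d \<le> exp d - 1\<close>.\<close>
    moreover have "1 - exp ?z \<le> exp ?d - 1"
    proof -
      have "exp (- ?d) \<le> exp ?z" using z by simp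
      moreover have "1 - ?d \<le> exp (- ?d)" "1 + ?d \<le> exp ?d"
        using exp_ge_add_one_self[of "- ?d"] exp_ge_add_one_self[of ?d] by simp_all
      ultimately show ?thesis by linarith
    qed
    moreover have "exp (u i (t, x)) * ?L (t, x) = exp ?z"
      by (rule ratio) (simp add: t)
    ultimately show "\<bar>exp (u i (t, x)) * ?L (t, x) - 1\<bar> \<le> exp ?d - 1"
      by linarith
  next
    have "((\<lambda>t. exp (sqrt (2 * pi * E 1 t)) - 1) \<longlongrightarrow> exp 0 - 1) at_top"
      by (intro tendsto_intros d)
    then show "((\<lambda>t. exp (sqrt (2 * pi * E 1 t)) - 1) \<longlongrightarrow> 0) at_top" by simp
  qed
  show ?thesis
  proof (cases n)
    case 0
    then show ?thesis using \<open>vanishes (\<lambda>p. exp (u i p) * ?L p - 1)\<close> by (simp add: mult.commute)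
  next
    case (Suc m)
    \<comment> \<open>The length is at most \<open>2 * pi\<close>, so powers of the scale factor
      stay bounded and the decay of \<open>P n i\<close> decides.\<close>
    have "\<forall>\<^sub>F t in at_top. \<forall>x. \<bar>?L (t, x) ^ n * (exp (u i (t, x)) * ?L (t, x))\<bar> \<le> 2"
      using vanishes_eventually_le[OF 0] eventually_gt_at_top[of 0]
    proof eventually_elim
      case (elim t)
      show ?case
      proof
        fix x
        have L: "0 \<le> ?L (t, x)" "?L (t, x) \<le> 1"
          using M_1_le[OF elim(2)] M_1_pos[OF elim(2)] by simp_all
        have "\<bar>exp (u i (t, x)) * ?L (t, x)\<bar> \<le> 2"
          using elim(1)[rule_format, of x] by linarith
        moreover have "\<bar>?L (t, x) ^ n\<bar> \<le> 1"
          using L by (simp add: power_le_one)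
        ultimately have "\<bar>?L (t, x) ^ n\<bar> * \<bar>exp (u i (t, x)) * ?L (t, x)\<bar> \<le> 1 * 2"
          by (intro mult_mono) auto
        then show "\<bar>?L (t, x) ^ n * (exp (u i (t, x)) * ?L (t, x))\<bar> \<le> 2"
          by (simp only: abs_mult)
      qed
    qed
    from vanishes_mult_bounded[OF van_vanishes[OF van_P[of m i]] this]
    show ?thesis using Suc by (simp add: mult_ac)
  qed
qed

end

section \<open>Reparametrization of the circle\<close>

lemma antiderivative_exists:
  fixes g :: "real \<Rightarrow> real"
  assumes g: "continuous_on UNIV g"
  shows "\<exists>h. \<forall>x. (h has_real_derivative g x) (at x)"
proof -
  define h where "h x = integral {0..x} g - integral {x..0} g" for x
  note int = integrable_continuous_interval[OF continuous_on_subset[OF g]]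
  have "(h has_real_derivative g x) (at x)" for x
  proof -
    \<comment> \<open>To the left of both 0 and \<open>x\<close>: near \<open>x\<close> the function
      \<open>h\<close> is then, up to a constant, a single integral starting at
      \<open>c\<close>.\<close>
    define c where "c = min x 0 - 1"
    have eq: "h y = h c + integral {c..y} g" if "c \<le> y" for y
    proof (cases "y \<ge> 0")
      case True
      have "integral {c..0} g + integral {0..y} g = integral {c..y} g"
        by (rule Henstock_Kurzweil_Integration.integral_combine) (use True in \<open>auto simp: c_def intro!: int\<close>)
      moreover have "h c = - integral {c..0} g" by (simp add: h_def c_def)
      moreover have "h y = integral {0..y} g" using True by (cases "y = 0") (auto simp: h_def)
      ultimately show ?thesis by simp
    next
      case False
      have "integral {c..y} g + integral {y..0} g = integral {c..0} g"
        by (rule Henstock_Kurzweil_Integration.integral_combine) (use False that in \<open>auto intro!: int\<close>)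
      moreover have "h c = - integral {c..0} g" by (simp add: h_def c_def)
      moreover have "h y = - integral {y..0} g" using False by (simp add: h_def)
      ultimately show ?thesis by simp
    qed
    have "((\<lambda>y. integral {c..y} g) has_real_derivative g x) (at x within {c..x + 1})"
      by (rule integral_has_real_derivative) (auto simp: c_def intro: continuous_on_subset[OF g])
    moreover have "at x within {c..x + 1} = at x"
      by (rule at_within_interior) (simp add: c_def)
    ultimately have I: "((\<lambda>y. integral {c..y} g) has_real_derivative g x) (at x)" by (simp only:)
    have "((\<lambda>y. h c + integral {c..y} g) has_real_derivative 0 + g x) (at x)"
      by (rule DERIV_add[OF DERIV_const I])
    then have "(h has_real_derivative 0 + g x) (at x)"
      by (rule has_field_derivative_transform_within_open[where S = "{c<..}"])
        (simp_all add: eq[OF less_imp_le] c_def)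
    then show ?thesis by simp
  qed
  then show ?thesis by blast
qed

lemma shift_2pi_int:
  fixes f :: "real \<Rightarrow> real"
  assumes "\<And>x. f (x + 2 * pi) = f x + 2 * pi"
  shows "f (x + 2 * pi * of_int n) = f x + 2 * pi * of_int n"
proof -
  have *: "f (x + 2 * pi * real n) = f x + 2 * pi * real n" for n x
  proof (induction n)
    case (Suc n)
    have "f (x + 2 * pi * real (Suc n)) = f ((x + 2 * pi * real n) + 2 * pi)"
      by (simp add: algebra_simps)
    then show ?case using assms[of "x + 2 * pi * real n"] Suc by (simp add: algebra_simps)
  qed simp
  show ?thesis
  proof (cases "n \<ge> 0")
    case True
    then show ?thesis using *[of x "nat n"] by simp
  next
    case False
    then show ?thesis using *[of "x + 2 * pi * of_int n" "nat (- n)"] by (simp add: algebra_simps)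
  qed
qed

text \<open>\<open>h\<close> is an antiderivative of \<open>g\<close> and \<open>f\<close> its
  inverse; the total integral \<open>2 * pi\<close> makes both commute with the shift by a period.
  The last clause covers all \<open>m\<close> at once because
  \<open>(m \<circ> f)' = (m' / g) \<circ> f\<close> has the same shape, and the identity for
  \<open>m\<close> yields smoothness of \<open>f\<close>.\<close>

lemma circle_reparametrization:
  fixes g :: "real \<Rightarrow> real"
  assumes g: "smooth_on UNIV g" and pos: "\<And>x. g x > 0" and per: "\<And>x. g (x + 2 * pi) = g x"
    and int: "integral {0..2 * pi} g = 2 * pi"
  shows "\<exists>f h. smooth_on UNIV f \<and> smooth_on UNIV h \<and>
    (\<forall>y. (f has_real_derivative inverse (g (f y))) (at y)) \<and>
    (\<forall>y. f (y + 2 * pi) = f y + 2 * pi) \<and> (\<forall>x. h (x + 2 * pi) = h x + 2 * pi) \<and>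
    (\<forall>x. f (h x) = x) \<and> (\<forall>y. h (f y) = y) \<and>
    (\<forall>m :: real \<Rightarrow> real. smooth_on UNIV m \<longrightarrow> smooth_on UNIV (\<lambda>y. m (f y)))"
proof -
  obtain h where h: "\<And>x. (h has_real_derivative g x) (at x)"
    using antiderivative_exists[OF smooth_on_imp_continuous_on[OF g]] by blast
  have cont: "isCont h x" for x using DERIV_isCont[OF h] .
  have shift: "h (x + 2 * pi) = h x + 2 * pi" for x
  proof -
    have "((\<lambda>x. h (x + 2 * pi) - h x) has_real_derivative 0) (at x)" for x
    proof -
      have "((\<lambda>x. h (x + 2 * pi)) has_real_derivative g (x + 2 * pi)) (at x)"
        using DERIV_shift[of h "g (x + 2 * pi)" x "2 * pi"] h by simp
      from DERIV_diff[OF this h[of x]] show ?thesis by (simp add: per)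
    qed
    then have "h (x + 2 * pi) - h x = h (0 + 2 * pi) - h 0"
      using DERIV_isconst_all[of "\<lambda>x. h (x + 2 * pi) - h x" x 0] by simp
    moreover have "integral {0..2 * pi} g = h (2 * pi) - h 0"
      by (intro integral_unique fundamental_theorem_of_calculus)
        (use h in \<open>auto simp: has_real_derivative_iff_has_vector_derivative[symmetric] intro: has_field_derivative_at_within\<close>)
    ultimately show ?thesis using int by simp
  qed
  have mono: "strict_mono h"
    by (rule strict_monoI, rule DERIV_pos_imp_increasing) (use h pos in blast)+
  \<comment> \<open>Over \<open>n\<close> periods \<open>h\<close> moves by
    \<open>2 * pi * n\<close>, so it passes every bound in both directions and the intermediate
    value theorem applies.\<close>
  have surj: "\<exists>x. h x = y" for y
  proof -
    obtain k :: nat where "\<bar>y - h 0\<bar> / (2 * pi) \<le> real k" using real_arch_simple by blast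
    then obtain n :: int where n: "\<bar>y - h 0\<bar> / (2 * pi) \<le> of_int n" "0 \<le> n"
      by (metis of_int_of_nat_eq of_nat_0_le_iff)
    have n0: "0 \<le> of_int n * (2 * pi)"
      using n(2) by simp
    have b: "\<bar>y - h 0\<bar> \<le> of_int n * (2 * pi)"
      using n(1) pos_divide_le_eq[of "2 * pi" "\<bar>y - h 0\<bar>" "of_int n"] by simp
    have "\<exists>x\<ge>- (of_int n * (2 * pi)). x \<le> of_int n * (2 * pi) \<and> h x = y"
    proof (rule IVT)
      show "h (- (of_int n * (2 * pi))) \<le> y"
        using shift_2pi_int[of h 0 "- n", OF shift] b by (simp add: mult_ac)
      show "y \<le> h (of_int n * (2 * pi))"
        using shift_2pi_int[of h 0 n, OF shift] b by (simp add: mult_ac)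
      show "- (of_int n * (2 * pi)) \<le> of_int n * (2 * pi)" using n0 by linarith
    qed (use cont in auto)
    then show ?thesis by blast
  qed
  define f where "f = Hilbert_Choice.inv h"
  have inj: "inj h" using mono by (rule strict_mono_imp_inj_on)
  have fh: "f (h x) = x" for x unfolding f_def by (rule inv_f_f[OF inj])
  have hf: "h (f y) = y" for y
    using surj[of y] unfolding f_def by (metis f_inv_into_f rangeI)
  have contf: "isCont f y" for y
  proof -
    have "isCont f (h (f y))"
      by (rule isCont_inverse_function[of 1]) (use fh cont in auto)
    then show ?thesis by (simp add: hf)
  qed
  have f: "(f has_real_derivative inverse (g (f y))) (at y)" for y
  proof (rule DERIV_inverse_function[where f = h and a = "y - 1" and b = "y + 1"])
    show "(h has_real_derivative g (f y)) (at (f y))" by (rule h)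
    show "g (f y) \<noteq> 0" using pos[of "f y"] by simp
  qed (use hf contf in auto)
  have fshift: "f (y + 2 * pi) = f y + 2 * pi" for y
    by (metis fh hf shift)
  have smh: "smooth_on UNIV h"
  proof (rule smooth_on_realI[where P = "\<lambda>k. k = h \<or> smooth_on UNIV k"])
    fix k assume "k = h \<or> smooth_on UNIV k"
    then show "\<exists>k'. (k' = h \<or> smooth_on UNIV k') \<and> (\<forall>s. (k has_real_derivative k' s) (at s))"
    proof
      assume "k = h" then show ?thesis using g h by blast
    next
      assume "smooth_on UNIV k" then show ?thesis using smooth_on_real_deriv by blast
    qed
  qed simp
  have smc: "smooth_on UNIV (\<lambda>y. m (f y))" if "smooth_on UNIV m" for m :: "real \<Rightarrow> real"
  proof (rule smooth_on_realI[where P = "\<lambda>k. \<exists>m. smooth_on UNIV (m :: real \<Rightarrow> real) \<and> k = (\<lambda>y. m (f y))"])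
    show "\<exists>n. smooth_on UNIV n \<and> (\<lambda>y. m (f y)) = (\<lambda>y. n (f y))"
      using that by blast
    fix k assume "\<exists>m. smooth_on UNIV (m :: real \<Rightarrow> real) \<and> k = (\<lambda>y. m (f y))"
    then obtain m where m: "smooth_on UNIV m" "k = (\<lambda>y. m (f y))" by blast
    have "(k has_real_derivative deriv m (f y) * inverse (g (f y))) (at y)" for y
      unfolding m(2) by (rule DERIV_chain2[OF smooth_on_real_deriv(1)[OF m(1)] f])
    moreover have "smooth_on UNIV (\<lambda>x. deriv m x * inverse (g x))"
      by (intro smooth_on_mult smooth_on_inverse smooth_on_real_deriv m g pos) auto
    ultimately show "\<exists>k'. (\<exists>m. smooth_on UNIV m \<and> k' = (\<lambda>y. m (f y))) \<and> (\<forall>s. (k has_real_derivative k' s) (at s))"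
      by (intro exI[of _ "\<lambda>y. deriv m (f y) * inverse (g (f y))"] conjI allI
        exI[of _ "\<lambda>x. deriv m x * inverse (g x)"]) simp_all
  qed
  have "smooth_on UNIV f"
    using smc[of "\<lambda>x. x"] smooth_on_linear[of UNIV "\<lambda>x :: real. x" 0] by (simp add: linear_iff)
  then show ?thesis using smc smh f fshift shift fh hf by blast
qed

section \<open>Reparametrizations of the first circle factor of the 7-torus\<close>

definition reparam :: "(real \<Rightarrow> real) \<Rightarrow> real^(4 + 3) \<Rightarrow> real^(4 + 3)" where
  "reparam f x = (\<chi> i. if i = Inl 0 then f (x $ Inl 0) else x $ i)"

lemma reparametrizes_reparam: "reparametrizes_x0 (reparam f)"
  unfolding reparametrizes_x0_def reparam_def by blast

text \<open>A function of one coordinate times a fixed vector, plus a linear map: this shape is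
  stable under differentiation and serves as the coinduction class for smoothness.\<close>

lemma reparam_eq: "reparam f x = f (x $ Inl 0) *\<^sub>R axis (Inl 0) 1 + (\<chi> i. if i = Inl 0 then 0 else x $ i)"
  by (auto simp: reparam_def vec_eq_iff axis_def)

lemma linear_drop_x0: "linear (\<lambda>x :: real^(4 + 3). \<chi> i. if i = Inl 0 then 0 else x $ i)"
  by (auto intro!: linearI simp: vec_eq_iff)

lemma has_derivative_coordinate:
  fixes f :: "real \<Rightarrow> real" and x :: "real^'n"
  assumes "(f has_real_derivative d) (at (x $ a))"
  shows "((\<lambda>x. f (x $ a)) has_derivative (\<lambda>v. d * v $ a)) (at x)"
  using assms unfolding has_field_derivative_def
  by (rule has_derivative_compose[rotated]) (auto intro!: bounded_linear_imp_has_derivative bounded_linear_vec_nth)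

lemma has_derivative_linear_plus:
  fixes L :: "'a::euclidean_space \<Rightarrow> 'b::real_normed_vector"
  assumes f: "(f has_derivative f') (at x)" and L: "linear L"
  shows "((\<lambda>x. f x + (L x + c)) has_derivative (\<lambda>v. f' v + L v)) (at x)"
proof -
  have "(L has_derivative L) (at x)"
    using L by (intro bounded_linear_imp_has_derivative) (simp add: linear_conv_bounded_linear)
  from has_derivative_add[OF f has_derivative_add[OF this has_derivative_const[of c]]] show ?thesis by simp
qed

lemma has_derivative_reparam:
  assumes "(f has_real_derivative d) (at (x $ Inl 0))"
  shows "(reparam f has_derivative (\<lambda>v. \<chi> i. (if i = Inl 0 then d else 1) * v $ i)) (at x)"
proof -
  have "((\<lambda>x. f (x $ Inl 0) *\<^sub>R axis (Inl 0) 1 + ((\<chi> i. if i = Inl 0 then 0 else x $ i) + 0)) has_derivative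
     (\<lambda>v. (d * v $ Inl 0) *\<^sub>R axis (Inl 0) 1 + (\<chi> i. if i = Inl 0 then 0 else v $ i))) (at x)"
    by (intro has_derivative_linear_plus linear_drop_x0 has_derivative_scaleR_left has_derivative_coordinate assms)
  moreover have "(\<lambda>v. (d * v $ Inl 0) *\<^sub>R axis (Inl 0) 1 + (\<chi> i. if i = Inl 0 then 0 else v $ i)) =
      (\<lambda>v :: real^(4 + 3). \<chi> i. (if i = Inl 0 then d else 1) * v $ i)"
    by (auto simp: vec_eq_iff axis_def)
  ultimately show ?thesis
    by (simp add: reparam_eq[abs_def])
qed

lemma smooth_on_reparam:
  assumes f: "smooth_on UNIV f" shows "smooth_on UNIV (reparam f)"
proof (rule smooth_on_coinduct[OF ample_UNIV, where P = "\<lambda>F. \<exists>g b L c. smooth_on UNIV (g :: real \<Rightarrow> real) \<and> linear L \<and>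
    F = (\<lambda>x. g (x $ Inl 0) *\<^sub>R b + (L x + c))"])
  have "reparam f = (\<lambda>x. f (x $ Inl 0) *\<^sub>R axis (Inl 0) 1 + ((\<chi> i. if i = Inl 0 then 0 else x $ i) + 0))"
    by (simp add: reparam_eq fun_eq_iff)
  then show "\<exists>g b L c. smooth_on UNIV (g :: real \<Rightarrow> real) \<and> linear L \<and>
      reparam f = (\<lambda>x. g (x $ Inl 0) *\<^sub>R b + (L x + c))"
    using f linear_drop_x0 by blast
  fix F :: "real^(4 + 3) \<Rightarrow> real^(4 + 3)"
  assume "\<exists>g b L c. smooth_on UNIV (g :: real \<Rightarrow> real) \<and> linear L \<and> F = (\<lambda>x. g (x $ Inl 0) *\<^sub>R b + (L x + c))"
  then obtain g :: "real \<Rightarrow> real" and b L c where g: "smooth_on UNIV g" and L: "linear L"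
    and F: "F = (\<lambda>x. g (x $ Inl 0) *\<^sub>R b + (L x + c))" by blast
  let ?D = "\<lambda>x v. (deriv g (x $ Inl 0) * v $ Inl 0) *\<^sub>R b + L v"
  have "(F has_derivative ?D x) (at x)" for x
    unfolding F by (intro has_derivative_linear_plus L has_derivative_scaleR_left has_derivative_coordinate
      smooth_on_real_deriv g)
  moreover have "\<exists>g b L c. smooth_on UNIV (g :: real \<Rightarrow> real) \<and> linear L \<and>
      (\<lambda>x. ?D x v) = (\<lambda>x. g (x $ Inl 0) *\<^sub>R b + (L x + c))" for v
    by (rule exI[of _ "deriv g"], rule exI[of _ "v $ Inl 0 *\<^sub>R b"], rule exI[of _ "\<lambda>x. 0"], rule exI[of _ "L v"])
      (auto intro: smooth_on_real_deriv g linearI)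
  ultimately show "\<exists>D. (\<forall>x\<in>UNIV. (F has_derivative D x) (at x)) \<and>
     (\<forall>v. \<exists>g b L c. smooth_on UNIV (g :: real \<Rightarrow> real) \<and> linear L \<and>
      (\<lambda>x. D x v) = (\<lambda>x. g (x $ Inl 0) *\<^sub>R b + (L x + c)))"
    by (intro exI[of _ ?D] conjI ballI allI)
qed

lemma smooth_torus_map_reparam:
  assumes f: "smooth_on UNIV f" and shift: "\<And>y. f (y + 2 * pi) = f y + 2 * pi"
  shows "smooth_torus_map (reparam f)"
  unfolding smooth_torus_map_def
proof (intro conjI allI ballI smooth_on_reparam f)
  fix x l :: "real^(4 + 3)" assume l: "l \<in> period_lattice"
  then obtain n :: int where n: "l $ Inl 0 = 2 * pi * of_int n" by (auto simp: period_lattice_def)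
  have "(reparam f (x + l) - reparam f x) $ i = l $ i" for i
    using shift_2pi_int[of f "x $ Inl 0" n, OF shift] by (simp add: reparam_def n)
  then have "reparam f (x + l) - reparam f x = l" by (simp add: vec_eq_iff)
  with l show "reparam f (x + l) - reparam f x \<in> period_lattice" by simp
qed

lemma torus_diffeomorphism_reparam:
  assumes "smooth_on UNIV f" "smooth_on UNIV h" "\<And>y. f (y + 2 * pi) = f y + 2 * pi"
    "\<And>y. h (y + 2 * pi) = h y + 2 * pi" "\<And>x. f (h x) = x" "\<And>y. h (f y) = y"
  shows "torus_diffeomorphism (reparam f)"
  unfolding torus_diffeomorphism_def
proof (intro conjI exI[of _ "reparam h"] allI smooth_torus_map_reparam assms(1-4))
  have z: "0 \<in> (period_lattice :: (real^(4 + 3)) set)" by (auto simp: period_lattice_def intro!: exI[of _ 0])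
  have "reparam h (reparam f x) = x" "reparam f (reparam h x) = x" for x
    using assms(5,6) by (auto simp: reparam_def vec_eq_iff)
  then show "reparam h (reparam f x) - x \<in> period_lattice" "reparam f (reparam h x) - x \<in> period_lattice" for x
    using z by simp_all
qed

text \<open>Only terms containing \<open>dx_0\<close> change, so the pullback is again of simple
  form and the coefficients transform as densities.\<close>

lemma pullback_reparam_G2_form:
  assumes f: "\<And>y. (f has_real_derivative f' y) (at y)"
  shows "pullback (reparam f) (G2_form (simple_triple A)) = G2_form (simple_triple (\<lambda>i y. A i (f y) * f' y))"
proof (intro ext)
  fix x :: "real^(4 + 3)" and ws
  let ?l = "\<lambda>i :: 4 + 3. if i = Inl 0 then f' (x $ Inl 0) else 1"
  have D: "frechet_derivative (reparam f) (at x) = (\<lambda>v. \<chi> i. ?l i * v $ i)"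
    by (rule frechet_derivative_at[symmetric, OF has_derivative_reparam[OF f]])
  have "reparam f x $ Inl 0 = f (x $ Inl 0)" by (simp add: reparam_def)
  then show "pullback (reparam f) (G2_form (simple_triple A)) x ws =
      G2_form (simple_triple (\<lambda>i y. A i (f y) * f' y)) x ws"
    unfolding pullback_def D G2_form_simple g2_list_def lin_covec_Cons coord_covec_diag
    by (simp add: mult_ac)
qed

section \<open>The Laplacian flow\<close>

definition admissible :: "(3 \<Rightarrow> real \<Rightarrow> real) \<Rightarrow> bool" where
  "admissible B \<longleftrightarrow> (\<forall>i. smooth_on UNIV (B i)) \<and> (\<forall>i s. B i s > 0) \<and> (\<forall>i s. B i (s + 2 * pi) = B i s)"

lemma admissibleD:
  assumes "admissible B"
  shows "smooth_on UNIV (B i)" "B i s > 0" "B i (s + 2 * pi) = B i s" "B i differentiable (at s)"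
  using assms smooth_on_real_deriv(1)[of "B i" s] unfolding admissible_def real_differentiable_def by blast+

lemma admissible_smooth:
  assumes B: "admissible B"
  shows "smooth_on UNIV (vol B)" "smooth_on UNIV (flux B i)"
proof -
  note b = admissibleD[OF B]
  have ln: "smooth_on UNIV (\<lambda>s. ln (B i s))" for i
    by (rule smooth_on_ln) (use b in auto)
  have "smooth_on UNIV (\<lambda>s. 1 / 3 * (ln (B 1 s) + ln (B 2 s) + ln (B 3 s)))"
    by (intro smooth_on_cmult smooth_on_add ln ample_UNIV)
  then have m: "smooth_on UNIV (mean_log B)" by (simp add: mean_log_def[abs_def])
  show v: "smooth_on UNIV (vol B)"
    unfolding vol_def[abs_def] by (intro smooth_on_exp m ample_UNIV)
  have "smooth_on UNIV (log_ratio B i)"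
    unfolding log_ratio_def[abs_def] by (intro smooth_on_diff ln m ample_UNIV)
  then show "smooth_on UNIV (flux B i)"
    unfolding flux_def[abs_def] power2_eq_square
    by (intro smooth_on_divide smooth_on_mult smooth_on_real_deriv v b ample_UNIV) auto
qed

lemma alternating_lin_covec:
  assumes "list_all (\<lambda>(c, I). length I = k) P" shows "alternating k (lin_covec P)"
  using assms
proof (induction P)
  case Nil
  show ?case by (simp add: alternating_def linear_zero)
next
  case (Cons r P)
  obtain c I where r: "r = (c, I)" by force
  then have I: "alternating k (coord_covec I)" and P: "alternating k (lin_covec P)"
    using Cons alternating_coord_covec[of I] by auto
  show ?case
    unfolding alternating_def r lin_covec_Cons
  proof (intro conjI allI impI)
    fix vs :: "(real^'a) list" and i assume "length vs = k \<and> i < k"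
    then have "linear (\<lambda>v. coord_covec I (vs[i := v]))" "linear (\<lambda>v. lin_covec P (vs[i := v]))"
      using I P by (auto simp: alternating_def)
    then show "linear (\<lambda>v. c * coord_covec I (vs[i := v]) + lin_covec P (vs[i := v]))"
      by (auto simp: linear_iff algebra_simps)
  qed (use I P in \<open>auto simp: alternating_def\<close>)
qed

text \<open>The terms with constant coefficients, common to all simple triples.\<close>

definition g2_coeff :: "(real^(4 + 3)) list \<Rightarrow> real" where
  "g2_coeff vs = coord_covec [Inr 1, Inr 2, Inr 3] vs - coord_covec [Inr 1, Inl 2, Inl 3] vs -
     coord_covec [Inr 2, Inl 3, Inl 1] vs - coord_covec [Inr 3, Inl 1, Inl 2] vs"

lemma G2_form_simple_sum:
  "G2_form (simple_triple B) x vs = g2_coeff vs -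
    (\<Sum>i\<in>UNIV. coord_covec [Inr i, Inl 0, Inl (spatial i)] vs * B i (x $ Inl 0))"
  by (simp add: G2_form_simple g2_list_def lin_covec_Cons g2_coeff_def sum_3)

lemma closed_G2_structure_simple:
  assumes B: "admissible B"
  shows "closed_G2_structure (G2_form (simple_triple B))"
proof -
  note b = admissibleD[OF B]
  have "torus_form 3 (G2_form (simple_triple B))"
    unfolding torus_form_def
  proof (intro conjI allI)
    show "alternating 3 (G2_form (simple_triple B) x)" for x
      unfolding G2_form_simple by (rule alternating_lin_covec) (simp add: g2_list_def)
    show "G2_form (simple_triple B) (x + axis i (2 * pi)) = G2_form (simple_triple B) x" for x i
      using b(3) by (cases "i = Inl 0") (auto simp: fun_eq_iff G2_form_simple_sum axis_def)
    show "smooth_on UNIV (\<lambda>x. G2_form (simple_triple B) x vs)" for vs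
    proof -
      have "smooth_on UNIV (\<lambda>x :: real^(4 + 3). B i (x $ Inl 0 + 0))" for i
        by (rule smooth_on_compose_affine[OF ample_UNIV b(1)]) (auto intro: linearI)
      then have "smooth_on UNIV (\<lambda>x :: real^(4 + 3). B i (x $ Inl 0))" for i by simp
      then show ?thesis
        unfolding G2_form_simple_sum
        by (intro smooth_on_diff smooth_on_const smooth_on_sum smooth_on_cmult ample_UNIV)
    qed
  qed
  then show ?thesis
    unfolding closed_G2_structure_def G2_structure_def
    using G2_form_simple_equivalent[of B] ext_deriv_G2_form_simple[of B] b by blast
qed

lemma cohomogeneity_one_simple: "cohomogeneity_one (G2_form (simple_triple B))"
  unfolding cohomogeneity_one_def
proof (intro allI impI ext)
  fix c x :: "real^(4 + 3)" and vs assume "c $ Inl 0 = 0"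
  moreover have "frechet_derivative (\<lambda>x. x + c) (at x) = (\<lambda>v. v)"
    by (rule frechet_derivative_at[symmetric]) (auto intro!: derivative_eq_intros)
  ultimately show "pullback (\<lambda>x. x + c) (G2_form (simple_triple B)) x vs = G2_form (simple_triple B) x vs"
    by (simp add: pullback_def G2_form_simple)
qed

lemma admissible_one: "admissible (\<lambda>i s. 1)"
  by (simp add: admissible_def smooth_on_const)

lemma torsion_free_standard: "torsion_free_G2_structure (G2_form standard_triple)"
  unfolding torsion_free_G2_structure_def
  using torsion_free_standard_star closed_G2_structure_simple[OF admissible_one]
  by (simp add: standard_triple_eq)

text \<open>The coefficient of \<open>dx\<^sub>0 \<and> dx\<^sub>i\<close> in \<open>\<omega>\<^sub>i\<close>.\<close>

definition simple_coeff :: "(real \<Rightarrow> triple) \<Rightarrow> 3 \<Rightarrow> real \<times> real \<Rightarrow> real" where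
  "simple_coeff \<omega> i p = \<omega> (fst p) i (axis 0 (snd p)) [axis 0 1, axis (spatial i) 1]"

lemma coord_covec_simple_coeff:
  "coord_covec [0, spatial i] [axis 0 1, axis (spatial i) 1] = 1"
  "coord_covec [spatial (i + 1), spatial (i + 2)] [axis 0 1, axis (spatial i) 1] = 0"
proof -
  have "spatial i \<noteq> 0" "spatial (i + 1) \<noteq> 0" "spatial (i + 2) \<noteq> 0"
    by (simp_all add: spatial_def)
  then show "coord_covec [0, spatial i] [axis 0 1, axis (spatial i) 1] = 1"
    "coord_covec [spatial (i + 1), spatial (i + 2)] [axis 0 1, axis (spatial i) 1] = 0"
    using coord_covec_axes[of "[0, spatial i]"] by (simp_all add: coord_covec_Cons_vec lessThan_Suc axis_def)
qed

text \<open>Evaluation on two axes recovers the coefficient \<open>1 + \<phi>''\<close>. It is the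
  derivative of \<open>s + \<phi>'\<close>, which increases by \<open>2 * pi\<close> over a period;
  this gives the integral.\<close>

lemma simple_type_eq:
  assumes "simple_type (\<omega> t)"
  shows "\<omega> t = simple_triple (\<lambda>i s. simple_coeff \<omega> i (t, s))"
    and "admissible (\<lambda>i s. simple_coeff \<omega> i (t, s))"
    and "integral {0..2 * pi} (\<lambda>s. simple_coeff \<omega> i (t, s)) = 2 * pi"
proof -
  obtain \<phi> :: "3 \<Rightarrow> real \<Rightarrow> real" where sm: "\<And>i. smooth_on UNIV (\<phi> i)"
    and per: "\<And>i s. \<phi> i (s + 2 * pi) = \<phi> i s" and pos: "\<And>i s. 1 + deriv (deriv (\<phi> i)) s > 0"
    and eq: "\<And>i. \<omega> t i = (\<lambda>x vs.
           (1 + deriv (deriv (\<phi> i)) (x $ 0)) * (coord_form 0 \<^bold>\<and> coord_form (spatial i)) x vs +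
           (coord_form (spatial (i + 1)) \<^bold>\<and> coord_form (spatial (i + 2))) x vs)"
    using assms unfolding simple_type_def by blast
  define B where "B i s = 1 + deriv (deriv (\<phi> i)) s" for i s
  have \<omega>: "\<omega> t = simple_triple B"
    by (rule ext) (simp add: eq simple_triple_eq B_def)
  have coeff: "simple_coeff \<omega> i (t, s) = B i s" for i s
    unfolding simple_coeff_def fst_conv snd_conv \<omega> simple_triple_def lin_covec_Cons coord_covec_simple_coeff
    by (simp add: axis_def)
  note s1 = smooth_on_real_deriv[OF sm]
  note s2 = smooth_on_real_deriv[OF s1(2)]
  have dper: "deriv (\<phi> i) (s + 2 * pi) = deriv (\<phi> i) s" for i s
  proof -
    have "((\<lambda>s. \<phi> i (s + 2 * pi)) has_real_derivative deriv (\<phi> i) (s + 2 * pi)) (at s)"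
      using DERIV_shift[of "\<phi> i" "deriv (\<phi> i) (s + 2 * pi)" s "2 * pi"] s1(1) by simp
    from DERIV_imp_deriv[OF this] show ?thesis by (simp add: per)
  qed
  have ddper: "deriv (deriv (\<phi> i)) (s + 2 * pi) = deriv (deriv (\<phi> i)) s" for i s
  proof -
    have "((\<lambda>s. deriv (\<phi> i) (s + 2 * pi)) has_real_derivative deriv (deriv (\<phi> i)) (s + 2 * pi)) (at s)"
      using DERIV_shift[of "deriv (\<phi> i)" "deriv (deriv (\<phi> i)) (s + 2 * pi)" s "2 * pi"] s2(1) by simp
    from DERIV_imp_deriv[OF this] show ?thesis by (simp add: dper)
  qed
  have "smooth_on UNIV (B i)" for i
    unfolding B_def[abs_def] by (intro smooth_on_add smooth_on_const s2(2) ample_UNIV)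
  then have adm: "admissible B"
    using pos ddper by (simp add: admissible_def B_def)
  have "integral {0..2 * pi} (B i) = (2 * pi + deriv (\<phi> i) (2 * pi)) - (0 + deriv (\<phi> i) 0)"
  proof (intro integral_unique fundamental_theorem_of_calculus)
    fix s
    have "((\<lambda>s. s + deriv (\<phi> i) s) has_real_derivative B i s) (at s)"
      unfolding B_def by (intro DERIV_add DERIV_ident s2(1))
    then show "((\<lambda>s. s + deriv (\<phi> i) s) has_vector_derivative B i s) (at s within {0..2 * pi})"
      by (auto simp: has_real_derivative_iff_has_vector_derivative[symmetric] intro: has_field_derivative_at_within)
  qed simp
  then have int: "integral {0..2 * pi} (B i) = 2 * pi"
    using dper[of i 0] by simp
  show "\<omega> t = simple_triple (\<lambda>i s. simple_coeff \<omega> i (t, s))" "admissible (\<lambda>i s. simple_coeff \<omega> i (t, s))"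
    "integral {0..2 * pi} (\<lambda>s. simple_coeff \<omega> i (t, s)) = 2 * pi"
    using adm int unfolding coeff \<omega> by simp_all
qed

text \<open>General linear \<open>L\<close> and \<open>K\<close> cover both later uses: the open
  half plane, and the space-time of the 7-torus, where only one space coordinate enters.\<close>

lemma simple_coeff_smooth:
  assumes fam: "smooth_family (\<lambda>t. \<omega> t i)" and S: "ample S" and L: "linear L" "linear K"
    and nn: "\<And>x. x \<in> S \<Longrightarrow> L x \<ge> 0"
  shows "smooth_on S (\<lambda>x. simple_coeff \<omega> i (L x, K x))"
proof -
  let ?f = "\<lambda>(t, x). \<omega> t i x [axis 0 1, axis (spatial i) 1]"
  have lin: "linear (\<lambda>x. (L x, axis 0 (K x)) :: real \<times> (real^4))"
    using L by (auto simp: linear_iff axis_def vec_eq_iff)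
  have "smooth_on S (\<lambda>x. ?f ((L x, axis 0 (K x)) + 0))"
    by (rule smooth_on_compose_affine[OF S _ lin, of "{0..} \<times> UNIV"])
      (use fam nn in \<open>auto simp: smooth_family_def\<close>)
  then show ?thesis by (simp add: simple_coeff_def)
qed

text \<open>The coefficient is the form evaluated at fixed vectors, so evaluating the flow equation
  at these vectors gives the scalar equation, one-sided at time 0.\<close>

lemma has_real_derivative_simple_coeff:
  assumes flow: "hypersymplectic_flow \<omega>" and simple: "\<forall>t\<ge>0. simple_type (\<omega> t)" and t: "t \<ge> 0"
  shows "((\<lambda>r. simple_coeff \<omega> i (r, s)) has_real_derivative
    deriv (flux (\<lambda>i s. simple_coeff \<omega> i (t, s)) i) s) (at t within {0..})"
proof -
  let ?B = "\<lambda>i s. simple_coeff \<omega> i (t, s)"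
  note eq = simple_type_eq[of \<omega> t, OF simple[rule_format, OF t]]
  note b = admissibleD[OF eq(2)]
  have fl: "flux ?B i differentiable (at s)" for i s
    using smooth_on_real_deriv(1)[OF admissible_smooth(2)[OF eq(2)]] real_differentiable_def by blast
  have "ext_deriv (hs_torsion (\<omega> t) i) (axis 0 s) [axis 0 1, axis (spatial i) 1] = deriv (flux ?B i) s"
    unfolding arg_cong[OF eq(1), of hs_torsion] ext_deriv_hs_torsion_simple[of ?B i, OF b(2,4) fl] lin_covec_Cons coord_covec_simple_coeff
    by (simp add: axis_def)
  moreover have "((\<lambda>r. \<omega> r i (axis 0 s) [axis 0 1, axis (spatial i) 1]) has_real_derivative
      ext_deriv (hs_torsion (\<omega> t) i) (axis 0 s) [axis 0 1, axis (spatial i) 1]) (at t within {0..})"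
    using flow t unfolding hypersymplectic_flow_def by blast
  ultimately show ?thesis
    by (simp only: simple_coeff_def fst_conv snd_conv)
qed

lemma torus_flow_simple_coeff:
  assumes flow: "hypersymplectic_flow \<omega>" and simple: "\<forall>t\<ge>0. simple_type (\<omega> t)"
  shows "torus_flow (simple_coeff \<omega>)"
proof
  fix i :: 3 and t x :: real
  have "smooth_on half_plane (\<lambda>p. simple_coeff \<omega> i (fst p, snd p))"
  proof (rule simple_coeff_smooth[OF _ ample_half_plane linear_fst linear_snd])
    show "smooth_family (\<lambda>t. \<omega> t i)" using flow by (simp add: hypersymplectic_flow_def)
    show "0 \<le> fst p" if "p \<in> half_plane" for p using that by (auto simp: half_plane_def)
  qed
  then have "smooth_on half_plane (simple_coeff \<omega> i)" by simp
  moreover have "simple_coeff \<omega> i (t, x + 2 * pi) = simple_coeff \<omega> i (t, x)" if "t > 0" for t x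
    using admissibleD(3)[OF simple_type_eq(2)[of \<omega> t], of i x] simple that by simp
  ultimately show "nice (simple_coeff \<omega> i)"
    by (simp add: nice_def periodic_def)
  assume t: "t > 0"
  then have st: "simple_type (\<omega> t)" using simple by simp
  show "simple_coeff \<omega> i (t, x) > 0"
    by (rule admissibleD(2)[OF simple_type_eq(2)[of \<omega> t, OF st]])
  show "circle_integral (simple_coeff \<omega> i) t = 2 * pi"
    unfolding circle_integral_def by (rule simple_type_eq(3)[of \<omega> t, OF st])
  have "at t within {0..} = at t"
    using t by (intro at_within_interior) simp
  then show "dt' (simple_coeff \<omega> i) (t, x) = deriv (flux (\<lambda>i s. simple_coeff \<omega> i (t, s)) i) x"
    using has_real_derivative_simple_coeff[OF flow simple, of t i x] t by (intro dt_eqI) simp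
qed

lemma G2_laplacian_flow_simple:
  assumes flow: "hypersymplectic_flow \<omega>" and simple: "\<forall>t\<ge>0. simple_type (\<omega> t)"
  shows "G2_laplacian_flow (\<lambda>t. G2_form (\<omega> t))"
proof -
  define a where "a = simple_coeff \<omega>"
  have eq: "\<omega> t = simple_triple (\<lambda>i s. a i (t, s))" "admissible (\<lambda>i s. a i (t, s))" if "t \<ge> 0" for t
    using simple_type_eq(1,2)[of \<omega> t] simple that by (auto simp: a_def)
  let ?c = "\<lambda>i vs. coord_covec [Inr i, Inl 0, Inl (spatial i)] vs"
  have form: "G2_form (\<omega> t) x vs = g2_coeff vs - (\<Sum>i\<in>UNIV. ?c i vs * a i (t, x $ Inl 0))"
    if "t \<ge> 0" for t x vs
    unfolding arg_cong[OF eq(1)[OF that], of G2_form] by (rule G2_form_simple_sum)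
  have "smooth_family (\<lambda>t. G2_form (\<omega> t))"
    unfolding smooth_family_def
  proof
    fix vs
    let ?S = "{0..} \<times> UNIV :: (real \<times> (real^(4 + 3))) set"
    have S: "ample ?S" by (rule ample_halfspace)
    have "smooth_on ?S (\<lambda>p. a i (fst p, snd p $ Inl 0))" for i
      unfolding a_def using flow
      by (intro simple_coeff_smooth[OF _ S])
        (auto simp: hypersymplectic_flow_def linear_fst linear_iff)
    then have "smooth_on ?S (\<lambda>p. g2_coeff vs - (\<Sum>i\<in>UNIV. ?c i vs * a i (fst p, snd p $ Inl 0)))"
      by (intro smooth_on_diff smooth_on_const smooth_on_sum smooth_on_cmult S)
    moreover have "smooth_on ?S (\<lambda>(t, x). G2_form (\<omega> t) x vs) \<longleftrightarrow>
        smooth_on ?S (\<lambda>p. g2_coeff vs - (\<Sum>i\<in>UNIV. ?c i vs * a i (fst p, snd p $ Inl 0)))"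
      by (rule smooth_on_cong) (auto simp: form)
    ultimately show "smooth_on ?S (\<lambda>(t, x). G2_form (\<omega> t) x vs)" by blast
  qed
  moreover have "((\<lambda>s. G2_form (\<omega> s) x vs) has_real_derivative
      hodge_laplacian (G2_metric (G2_form (\<omega> t))) (G2_volume (G2_form (\<omega> t))) 3 (G2_form (\<omega> t)) x vs)
      (at t within {0..})" if t: "t \<ge> 0" for t x vs
  proof -
    let ?B = "\<lambda>i s. a i (t, s)"
    note b = admissibleD[OF eq(2)[OF t]]
    have fl: "flux ?B i differentiable (at s)" for i s
      using smooth_on_real_deriv(1)[OF admissible_smooth(2)[OF eq(2)[OF t]]] real_differentiable_def by blast
    have lap: "hodge_laplacian (G2_metric (G2_form (\<omega> t))) (G2_volume (G2_form (\<omega> t))) 3 (G2_form (\<omega> t)) x vs =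
        lin_covec (laplacian_list ?B (x $ Inl 0)) vs"
      unfolding arg_cong[OF eq(1)[OF t], of G2_form] hodge_laplacian_G2_form_simple[of ?B x, OF b(2,4) fl] ..
    have "((\<lambda>s. g2_coeff vs - (\<Sum>i\<in>UNIV. ?c i vs * a i (s, x $ Inl 0))) has_real_derivative
        0 - (\<Sum>i\<in>UNIV. ?c i vs * deriv (flux ?B i) (x $ Inl 0))) (at t within {0..})"
      unfolding a_def
      by (intro DERIV_diff DERIV_const DERIV_sum DERIV_cmult has_real_derivative_simple_coeff[OF flow simple t])
    \<comment> \<open>Moving \<open>dx_0\<close> in front of \<open>dt i\<close> absorbs the minus
      sign.\<close>
    moreover have "0 - (\<Sum>i\<in>UNIV. ?c i vs * deriv (flux ?B i) (x $ Inl 0)) =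
        lin_covec (laplacian_list ?B (x $ Inl 0)) vs"
      using coord_covec_swap_head[of "Inr i" "Inl 0" "[Inl (spatial i)]" vs for i]
      by (simp add: laplacian_list_def lin_covec_Cons sum_3)
    ultimately have "((\<lambda>s. g2_coeff vs - (\<Sum>i\<in>UNIV. ?c i vs * a i (s, x $ Inl 0))) has_real_derivative
        lin_covec (laplacian_list ?B (x $ Inl 0)) vs) (at t within {0..})" by (simp only:)
    \<comment> \<open>The formula for the form is available at nonnegative times only, so the
      derivative is transferred within that set.\<close>
    then show ?thesis
      unfolding lap
      by (rule has_field_derivative_transform_within[of _ _ _ _ 1]) (use t form in auto)
  qed
  moreover have "G2_structure (G2_form (\<omega> t))" if t: "t \<ge> 0" for t
    using closed_G2_structure_simple[OF eq(2)[OF t]] unfolding arg_cong[OF eq(1)[OF t], of G2_form]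
    by (simp add: closed_G2_structure_def)
  ultimately show ?thesis
    unfolding G2_laplacian_flow_def by blast
qed

section \<open>Convergence\<close>

text \<open>The instance of \<open>circle_reparametrization\<close> for \<open>vol B\<close> scaled
  to have integral \<open>2 * pi\<close>.\<close>

lemma admissible_reparam_exists:
  assumes B: "admissible B"
  shows "\<exists>f h. smooth_on UNIV f \<and> smooth_on UNIV h \<and>
    (\<forall>y. (f has_real_derivative integral {0..2 * pi} (vol B) / (2 * pi) * inverse (vol B (f y))) (at y)) \<and>
    (\<forall>y. f (y + 2 * pi) = f y + 2 * pi) \<and> (\<forall>x. h (x + 2 * pi) = h x + 2 * pi) \<and>
    (\<forall>x. f (h x) = x) \<and> (\<forall>y. h (f y) = y) \<and>
    (\<forall>m :: real \<Rightarrow> real. smooth_on UNIV m \<longrightarrow> smooth_on UNIV (\<lambda>y. m (f y)))"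
proof -
  let ?L = "integral {0..2 * pi} (vol B)"
  note v = admissible_smooth(1)[OF B]
  have cont: "continuous_on S (vol B)" for S
    using smooth_on_imp_continuous_on[OF v] continuous_on_subset by blast
  have L: "?L > 0"
  proof -
    have "\<exists>z\<in>{0..2 * pi}. \<forall>x\<in>{0..2 * pi}. vol B z \<le> vol B x"
      by (rule continuous_attains_inf) (auto intro: cont)
    then obtain z where z: "\<forall>x\<in>{0..2 * pi}. vol B z \<le> vol B x" by blast
    have "integral {0..2 * pi} (\<lambda>x. vol B z) \<le> ?L"
      using z by (intro integral_le integrable_continuous_interval cont) auto
    moreover have "integral {0..2 * pi} (\<lambda>x. vol B z) = 2 * pi * vol B z" by simp
    moreover have "0 < 2 * pi * vol B z" by simp
    ultimately show ?thesis by linarith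
  qed
  have "\<exists>f h. smooth_on UNIV f \<and> smooth_on UNIV h \<and>
    (\<forall>y. (f has_real_derivative inverse (2 * pi / ?L * vol B (f y))) (at y)) \<and>
    (\<forall>y. f (y + 2 * pi) = f y + 2 * pi) \<and> (\<forall>x. h (x + 2 * pi) = h x + 2 * pi) \<and>
    (\<forall>x. f (h x) = x) \<and> (\<forall>y. h (f y) = y) \<and>
    (\<forall>m :: real \<Rightarrow> real. smooth_on UNIV m \<longrightarrow> smooth_on UNIV (\<lambda>y. m (f y)))"
  proof (rule circle_reparametrization)
    show "smooth_on UNIV (\<lambda>x. 2 * pi / ?L * vol B x)"
      by (intro smooth_on_cmult v ample_UNIV)
    show "0 < 2 * pi / ?L * vol B x" for x using L by simp
    show "2 * pi / ?L * vol B (x + 2 * pi) = 2 * pi / ?L * vol B x" for x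
      by (simp add: vol_def mean_log_def admissibleD(3)[OF B])
    show "integral {0..2 * pi} (\<lambda>x. 2 * pi / ?L * vol B x) = 2 * pi"
      using L by simp
  qed
  moreover have "inverse (2 * pi / ?L * c) = ?L / (2 * pi) * inverse c" for c
    using L by (simp add: field_simps)
  ultimately show ?thesis by (simp only:)
qed

lemma higher_deriv_const_diff_sum:
  fixes b :: "'i::finite \<Rightarrow> real \<Rightarrow> real"
  assumes "\<And>i. smooth_on UNIV (b i)"
  shows "(deriv ^^ n) (\<lambda>y. c - (\<Sum>i\<in>UNIV. k i * b i y)) y =
    (if n = 0 then c else 0) - (\<Sum>i\<in>UNIV. k i * (deriv ^^ n) (b i) y)"
proof (induction n arbitrary: y)
  case (Suc n)
  have "((\<lambda>y. (if n = 0 then c else 0) - (\<Sum>i\<in>UNIV. k i * (deriv ^^ n) (b i) y)) has_real_derivative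
      0 - (\<Sum>i\<in>UNIV. k i * deriv ((deriv ^^ n) (b i)) y)) (at y)"
    by (intro DERIV_diff DERIV_const DERIV_sum DERIV_cmult smooth_on_real_deriv smooth_on_real_higher_deriv assms)
  then have "deriv (\<lambda>y. (if n = 0 then c else 0) - (\<Sum>i\<in>UNIV. k i * (deriv ^^ n) (b i) y)) y =
      0 - (\<Sum>i\<in>UNIV. k i * deriv ((deriv ^^ n) (b i)) y)"
    by (rule DERIV_imp_deriv)
  moreover have "(deriv ^^ n) (\<lambda>y. c - (\<Sum>i\<in>UNIV. k i * b i y)) =
      (\<lambda>y. (if n = 0 then c else 0) - (\<Sum>i\<in>UNIV. k i * (deriv ^^ n) (b i) y))"
    by (rule ext) (rule Suc)
  ultimately show ?case
    by (simp only: funpow.simps o_apply nat.distinct if_False)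
qed simp

lemma iter_deriv_G2_form_simple:
  assumes b: "\<And>i. smooth_on UNIV (b i)"
  shows "iter_deriv UNIV vs (\<lambda>x. G2_form (simple_triple b) x ws) x =
    (\<Prod>v\<leftarrow>vs. v $ Inl 0) * ((if vs = [] then g2_coeff ws else 0) -
      (\<Sum>i\<in>UNIV. coord_covec [Inr i, Inl 0, Inl (spatial i)] ws * (deriv ^^ length vs) (b i) (x $ Inl 0)))"
proof -
  let ?H = "\<lambda>y. g2_coeff ws - (\<Sum>i\<in>UNIV. coord_covec [Inr i, Inl 0, Inl (spatial i)] ws * b i y)"
  have H: "smooth_on UNIV ?H"
    by (intro smooth_on_diff smooth_on_const smooth_on_sum smooth_on_cmult b ample_UNIV)
  have "(\<lambda>x. G2_form (simple_triple b) x ws) = (\<lambda>x. 1 * ?H (x $ Inl 0))"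
    by (rule ext) (simp only: G2_form_simple_sum mult_1)
  then show ?thesis
    by (simp only: iter_deriv_coordinate[OF H] higher_deriv_const_diff_sum[OF b]) simp
qed

lemma higher_deriv_const: "(deriv ^^ n) (\<lambda>y. c :: real) = (\<lambda>y. if n = 0 then c else 0)"
  by (induction n) auto

lemma smoothly_converges_G2_form_simple:
  assumes b: "\<forall>\<^sub>F t in at_top. \<forall>i. smooth_on UNIV (b t i)"
    and \<alpha>: "\<forall>\<^sub>F t in at_top. \<alpha> t = G2_form (simple_triple (b t))"
    and lim: "\<And>n i e. e > 0 \<Longrightarrow>
      \<forall>\<^sub>F t in at_top. \<forall>y. \<bar>(deriv ^^ n) (b t i) y - (if n = 0 then 1 else 0)\<bar> < e"
  shows "smoothly_converges \<alpha> (G2_form standard_triple)"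
  unfolding smoothly_converges_def Ck_converges_def
proof (intro allI impI uniform_limitI)
  fix ws vs and e :: real assume e: "e > 0"
  let ?c = "\<lambda>i. coord_covec [Inr i, Inl 0, Inl (spatial i)] ws"
  let ?p = "\<Prod>v\<leftarrow>vs. (v :: real^(4 + 3)) $ Inl 0"
  let ?n = "length vs"
  \<comment> \<open>The summand 1 makes \<open>K\<close> positive and the final estimate
    \<open>(K - 1) * (e / K) < e\<close> strict.\<close>
  define K where "K = 1 + \<bar>?p\<bar> * (\<Sum>i\<in>UNIV. \<bar>?c i\<bar>)"
  have K: "K \<ge> 1" by (auto simp: K_def intro!: mult_nonneg_nonneg sum_nonneg)
  have "\<forall>\<^sub>F t in at_top. \<forall>i\<in>UNIV. \<forall>y. \<bar>(deriv ^^ ?n) (b t i) y - (if ?n = 0 then 1 else 0)\<bar> < e / K"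
  proof (rule eventually_ball_finite)
    have "e / K > 0" using e K by simp
    then show "\<forall>i\<in>UNIV. \<forall>\<^sub>F t in at_top. \<forall>y. \<bar>(deriv ^^ ?n) (b t i) y - (if ?n = 0 then 1 else 0)\<bar> < e / K"
      using lim by blast
  qed simp
  with b \<alpha> show "\<forall>\<^sub>F t in at_top. \<forall>x\<in>UNIV. dist (iter_deriv UNIV vs (\<lambda>x. \<alpha> t x ws) x)
      (iter_deriv UNIV vs (\<lambda>x. G2_form standard_triple x ws) x) < e"
  proof eventually_elim
    case (elim t)
    show ?case
    proof
      fix x :: "real^(4 + 3)"
      let ?d = "\<lambda>i. (deriv ^^ ?n) (b t i) (x $ Inl 0) - (if ?n = 0 then 1 else 0)"
      have "iter_deriv UNIV vs (\<lambda>x. \<alpha> t x ws) x - iter_deriv UNIV vs (\<lambda>x. G2_form standard_triple x ws) x =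
          - (?p * (\<Sum>i\<in>UNIV. ?c i * ?d i))"
        unfolding elim(2) standard_triple_eq using elim(1)
        by (simp add: iter_deriv_G2_form_simple smooth_on_const higher_deriv_const sum_subtractf algebra_simps)
      then have "dist (iter_deriv UNIV vs (\<lambda>x. \<alpha> t x ws) x) (iter_deriv UNIV vs (\<lambda>x. G2_form standard_triple x ws) x)
          = \<bar>?p\<bar> * \<bar>\<Sum>i\<in>UNIV. ?c i * ?d i\<bar>"
        by (simp add: dist_real_def abs_mult)
      also have "\<dots> \<le> \<bar>?p\<bar> * (\<Sum>i\<in>UNIV. \<bar>?c i\<bar> * (e / K))"
      proof (intro mult_left_mono order_trans[OF sum_abs] sum_mono)
        show "\<bar>?c i * ?d i\<bar> \<le> \<bar>?c i\<bar> * (e / K)" for i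
          unfolding abs_mult using elim(3) by (intro mult_left_mono) (auto intro: less_imp_le)
      qed simp
      also have "\<dots> = (K - 1) * (e / K)"
        by (simp only: sum_distrib_right[symmetric] mult.assoc[symmetric]) (simp add: K_def)
      also have "\<dots> < e"
        using K e by (simp add: field_simps)
      finally show "dist (iter_deriv UNIV vs (\<lambda>x. \<alpha> t x ws) x) (iter_deriv UNIV vs (\<lambda>x. G2_form standard_triple x ws) x) < e" .
    qed
  qed
qed

context torus_flow
begin

lemma vol_slice: "vol (\<lambda>i s. A i (t, s)) s = V (t, s)"
  by (simp add: vol_def V_def w_def)

text \<open>Along the arc length parametrization each derivative in \<open>y\<close> is
  \<open>D\<close> times \<open>L / (2 * pi)\<close>, with \<open>L\<close> the length. For
  \<open>n = 0\<close> the function is \<open>L / (2 * pi) * exp (u i)\<close>, on which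
  \<open>D\<close> acts by \<open>D_exp_P\<close>.\<close>

lemma higher_deriv_reparam:
  assumes t: "t > 0"
    and f: "\<And>y. (f has_real_derivative M (\<lambda>p. 1) t / (2 * pi) * inverse (V (t, f y))) (at y)"
  shows "(deriv ^^ n) (\<lambda>y. A i (t, f y) * (M (\<lambda>p. 1) t / (2 * pi) * inverse (V (t, f y)))) =
    (\<lambda>y. (M (\<lambda>p. 1) t / (2 * pi)) ^ Suc n * (exp (u i (t, f y)) * P n i (t, f y)))"
proof (induction n)
  case 0
  show ?case by (simp add: A_eq[OF t] fun_eq_iff)
next
  case (Suc n)
  let ?L = "M (\<lambda>p. 1) t / (2 * pi)" and ?g = "\<lambda>p. exp (u i p) * P n i p"
  have g: "nice ?g" by (intro nice_all nice_P)
  have "((\<lambda>y. ?L ^ Suc n * ?g (t, f y)) has_real_derivative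
      ?L ^ Suc n * (dx ?g (t, f y) * (?L * inverse (V (t, f y))))) (at y)" for y
    by (intro DERIV_cmult DERIV_chain2[OF dx_has_derivative[OF nice_smooth[OF g] t] f])
  moreover have "?L ^ Suc n * (dx ?g (t, f y) * (?L * inverse (V (t, f y)))) =
      ?L ^ Suc (Suc n) * (exp (u i (t, f y)) * P (Suc n) i (t, f y))" for y
  proof -
    have "?L ^ Suc n * (dx ?g (t, f y) * (?L * inverse (V (t, f y)))) = ?L ^ Suc (Suc n) * D ?g (t, f y)"
      by (simp add: D_def)
    then show ?thesis by (simp only: D_exp_P[OF t])
  qed
  ultimately have "deriv (\<lambda>y. ?L ^ Suc n * ?g (t, f y)) =
      (\<lambda>y. ?L ^ Suc (Suc n) * (exp (u i (t, f y)) * P (Suc n) i (t, f y)))"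
    by (intro ext DERIV_imp_deriv) (simp only:)
  then show ?case by (simp only: funpow.simps o_apply Suc)
qed

end

theorem mainTheorem3:
  fixes \<omega> :: "real \<Rightarrow> 3 \<Rightarrow> (real^4) form"
  assumes "simple_type (\<omega> 0)"
    and "hypersymplectic_flow \<omega>"
    and "\<forall>t\<ge>0. simple_type (\<omega> t)"
  shows "(\<forall>t\<ge>0. closed_G2_structure (G2_form (\<omega> t)) \<and> cohomogeneity_one (G2_form (\<omega> t))) \<and>
    G2_laplacian_flow (\<lambda>t. G2_form (\<omega> t)) \<and>
    torsion_free_G2_structure (G2_form standard_triple) \<and>
    (\<exists>F. (\<forall>t\<ge>0. torus_diffeomorphism (F t) \<and> reparametrizes_x0 (F t)) \<and>
         smoothly_converges (\<lambda>t. pullback (F t) (G2_form (\<omega> t))) (G2_form standard_triple))"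
proof -
  define a where "a = simple_coeff \<omega>"
  define B where "B t i s = a i (t, s)" for t i s
  have eq: "\<omega> t = simple_triple (B t)" "admissible (B t)" if "t \<ge> 0" for t
    using simple_type_eq(1,2)[of \<omega> t] assms(3) that unfolding a_def B_def[abs_def] by auto
  interpret torus_flow a
    unfolding a_def by (rule torus_flow_simple_coeff[OF assms(2,3)])
  let ?L = "\<lambda>t. integral {0..2 * pi} (vol (B t))"
  \<comment> \<open>Collecting the properties of \<open>f\<close> and \<open>h\<close> in one
    predicate allows a single choice of both, made separately for each \<open>t\<close>.\<close>
  define reparametrizes where "reparametrizes t f h \<longleftrightarrow> smooth_on UNIV f \<and> smooth_on UNIV h \<and>
    (\<forall>y. (f has_real_derivative ?L t / (2 * pi) * inverse (vol (B t) (f y))) (at y)) \<and>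
    (\<forall>y. f (y + 2 * pi) = f y + 2 * pi) \<and> (\<forall>x. h (x + 2 * pi) = h x + 2 * pi) \<and>
    (\<forall>x. f (h x) = x) \<and> (\<forall>y. h (f y) = y) \<and>
    (\<forall>m :: real \<Rightarrow> real. smooth_on UNIV m \<longrightarrow> smooth_on UNIV (\<lambda>y. m (f y)))" for t f h
  have "\<exists>f h. reparametrizes t f h" if "t \<ge> 0" for t
    unfolding reparametrizes_def by (rule admissible_reparam_exists[OF eq(2)[OF that]])
  then obtain f h where "\<And>t. t \<ge> 0 \<Longrightarrow> reparametrizes t (f t) (h t)"
    by metis
  note fh = this[unfolded reparametrizes_def]
  let ?b = "\<lambda>t i y. B t i (f t y) * (?L t / (2 * pi) * inverse (vol (B t) (f t y)))"
  have b_smooth: "smooth_on UNIV (?b t i)" if t: "t \<ge> 0" for t i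
  proof -
    have "smooth_on UNIV (\<lambda>x. B t i x * (?L t / (2 * pi) * inverse (vol (B t) x)))"
      by (intro smooth_on_mult smooth_on_const smooth_on_inverse admissibleD(1)[OF eq(2)[OF t]]
        admissible_smooth(1)[OF eq(2)[OF t]]) auto
    then show ?thesis using fh[OF t] by blast
  qed
  have pull: "pullback (reparam (f t)) (G2_form (\<omega> t)) = G2_form (simple_triple (?b t))" if t: "t \<ge> 0" for t
    unfolding arg_cong[OF eq(1)[OF t], of G2_form]
    by (rule pullback_reparam_G2_form) (use fh[OF t] in blast)
  have conv: "smoothly_converges (\<lambda>t. pullback (reparam (f t)) (G2_form (\<omega> t))) (G2_form standard_triple)"
  proof (rule smoothly_converges_G2_form_simple[where b = ?b])
    show "\<forall>\<^sub>F t in at_top. \<forall>i. smooth_on UNIV (?b t i)"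
      using eventually_ge_at_top[of 0] by eventually_elim (intro allI b_smooth)
    show "\<forall>\<^sub>F t in at_top. pullback (reparam (f t)) (G2_form (\<omega> t)) = G2_form (simple_triple (?b t))"
      using eventually_ge_at_top[of 0] by eventually_elim (rule pull)
    fix n i and e :: real assume "e > 0"
    then have "\<forall>\<^sub>F t in at_top. \<forall>x. \<bar>(M (\<lambda>p. 1) t / (2 * pi)) ^ Suc n * (exp (u i (t, x)) * P n i (t, x)) -
        (if n = 0 then 1 else 0)\<bar> < e"
      using rescaled_converges[of n i] unfolding vanishes_def by simp
    with eventually_gt_at_top[of 0]
    show "\<forall>\<^sub>F t in at_top. \<forall>y. \<bar>(deriv ^^ n) (?b t i) y - (if n = 0 then 1 else 0)\<bar> < e"
    proof eventually_elim
      case (elim t)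
      have v: "vol (B t) = (\<lambda>s. V (t, s))" by (simp add: fun_eq_iff B_def[abs_def] vol_slice)
      have L: "integral {0..2 * pi} (\<lambda>s. V (t, s)) = M (\<lambda>p. 1) t" by (simp add: M_def circle_integral_def)
      have "(f t has_real_derivative M (\<lambda>p. 1) t / (2 * pi) * inverse (V (t, f t y))) (at y)" for y
        using fh[OF less_imp_le[OF elim(1)], THEN conjunct2, THEN conjunct2, THEN conjunct1, rule_format, of y]
        by (simp only: v L)
      from higher_deriv_reparam[OF elim(1) this, of n i]
      have "(deriv ^^ n) (?b t i) =
          (\<lambda>y. (M (\<lambda>p. 1) t / (2 * pi)) ^ Suc n * (exp (u i (t, f t y)) * P n i (t, f t y)))"
        by (simp only: L v B_def)
      \<comment> \<open>The decay is uniform in \<open>x\<close>, hence holds along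
        \<open>x = f t y\<close>.\<close>
      then show ?case using elim(2) by (simp only:) blast
    qed
  qed
  have "torus_diffeomorphism (reparam (f t)) \<and> reparametrizes_x0 (reparam (f t))" if "t \<ge> 0" for t
    using fh[OF that] torus_diffeomorphism_reparam[of "f t" "h t"] reparametrizes_reparam by blast
  with conv have "\<exists>F. (\<forall>t\<ge>0. torus_diffeomorphism (F t) \<and> reparametrizes_x0 (F t)) \<and>
      smoothly_converges (\<lambda>t. pullback (F t) (G2_form (\<omega> t))) (G2_form standard_triple)"
    by (intro exI[of _ "\<lambda>t. reparam (f t)"]) blast
  moreover have "closed_G2_structure (G2_form (\<omega> t)) \<and> cohomogeneity_one (G2_form (\<omega> t))" if t: "t \<ge> 0" for t
    unfolding arg_cong[OF eq(1)[OF t], of G2_form]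
    using closed_G2_structure_simple[OF eq(2)[OF t]] cohomogeneity_one_simple by blast
  ultimately show ?thesis
    using G2_laplacian_flow_simple[OF assms(2,3)] torsion_free_standard by blast
qed

end
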